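(* Let $G=\langle s_1,\dots,s_r\rangle$ be a free group or free semigroup (with identity) of rank $r$. If $(T,X,\mu,\alpha)$ is a Markov process over $G$ with $H(\alpha)<\infty$ and $\beta$ is a coarsening of $\alpha$, then $$f(T,\alpha|\beta^G)=F(T,\alpha|\beta^G)=F_*(T,\alpha|\beta^G)=f_*(T,\alpha|\beta^G),$$ where $\beta^G$ is the smallest $T(G)$-invariant $\sigma$-algebra containing $\beta$.
   Context: $G=\langle s_1,\dots,s_r\rangle$ is either a free group or a free semigroup with identity $e$ on $s_1,\dots,s_r$. Put $S=\{s_1^{\pm1},\dots,s_r^{\pm1}\}$ in the group case and $S=\{s_1,\dots,s_r\}$ in the semigroup case; $B(e,n)$ is the ball of radius $n$ about $e$ for the word metric of $S$. $G\curvearrowright^T(X,\mathcal B,\mu)$ means that $(X,\mathcal B,\mu)$ is a standard probability space and $g\mapsto T_g$ is a homomorphism from $G$ to the semigroup of measure-preserving transformations of $X$. Partitions are measurable and finite or countably infinite. $\alpha\vee\beta=\{A\cap B\}$; $H(\alpha)=-\sum_{A\in\alpha}\mu(A)\log\mu(A)$. $\beta$ is a coarsening of $\alpha$ if every atom of $\alpha$ is contained, up to measure zero, in an atom of $\beta$. For a sub-$\sigma$-algebra $\mathcal F$, $\mu(A|\mathcal F)$ is the conditional expectation of $\chi_A$ and $H(\alpha|\mathcal F)=\int_X -\log\big(\mu(A_x|\mathcal F)(x)\big)\,d\mu(x)$, where $A_x$ is the atom of $\alpha$ containing $x$. $\alpha^n=\bigvee_{g\in B(e,n)}T_g^{-1}\alpha$.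 $\mathcal F$ is $T(G)$-invariant if $T_g^{-1}A\in\mathcal F$ for all $A\in\mathcal F$, $g\in G$. For such $\mathcal F$ and $s\in S$, $$h(T_s,\alpha|\mathcal F)=\lim_{n\to\infty}\frac1{n+1}H\Big(\bigvee_{i=0}^nT_s^{-i}\alpha\,\Big|\,\mathcal F\Big),$$ $$F(T,\alpha|\mathcal F)=(1-2r)H(\alpha|\mathcal F)+\sum_{i=1}^rH(\alpha\vee T_{s_i}^{-1}\alpha|\mathcal F),\qquad f(T,\alpha|\mathcal F)=\inf_{n>0}F(T,\alpha^n|\mathcal F),$$ $$F_*(T,\alpha|\mathcal F)=(1-r)H(\alpha|\mathcal F)+\sum_{i=1}^rh(T_{s_i},\alpha|\mathcal F),\qquad f_*(T,\alpha|\mathcal F)=\inf_{n>0}F_*(T,\alpha^n|\mathcal F).$$ The left-Cayley graph $\Gamma_L$ has vertex set $G$ and an edge from $g$ to $sg$ for every $g\in G$, $s\in S$; paths in $\Gamma_L$ ignore edge directions. For $g_1,g_2\in G$, $\mathrm{Past}(g_1;g_2)$ is the set of $f\in G$ such that every path in $\Gamma_L$ from $f$ to $g_1$ passes through $g_2$. A $G$-process is a quadruple $(T,X,\mu,\alpha)$ with $G\curvearrowright^T(X,\mathcal B,\mu)$ and $\alpha$ a partition of $X$. It is a Markov process if for every $s\in S$, $g\in G$, $A\in\alpha$, $$\mu\Big(T_{sg}^{-1}A\,\Big|\bigvee_{f\in\mathrm{Past}(sg;g)}T_f^{-1}\alpha\Big)=\mu(T_{sg}^{-1}A\,|\,T_g^{-1}\alpha)\quad\mu\text{-a.e.}$$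 (joins and partitions being identified with the $\sigma$-algebras they generate). *)

theory Defs
  imports "HOL-Probability.Probability" "HOL-Algebra.Generated_Groups"
begin

section \<open>Free groups and free semigroups with identity\<close>

definition word_prod :: "('g, 'b) monoid_scheme \<Rightarrow> 'g list \<Rightarrow> 'g" where
  "word_prod G w = foldr (\<lambda>x y. x \<otimes>\<^bsub>G\<^esub> y) w \<one>\<^bsub>G\<^esub>"

definition is_free_semigroup :: "('g, 'b) monoid_scheme \<Rightarrow> nat \<Rightarrow> (nat \<Rightarrow> 'g) \<Rightarrow> bool" where
  "is_free_semigroup G r s \<longleftrightarrow>
     monoid G \<and> s ` {1..r} \<subseteq> carrier G \<and>
     bij_betw (\<lambda>w. word_prod G (map s w)) (lists {1..r}) (carrier G)"

text \<open>A letter \<open>(i, True)\<close> stands for the generator \<open>s i\<close> and \<open>(i, False)\<close> for its inverse.\<close>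

definition letter_val :: "('g, 'b) monoid_scheme \<Rightarrow> (nat \<Rightarrow> 'g) \<Rightarrow> nat \<times> bool \<Rightarrow> 'g" where
  "letter_val G s l = (if snd l then s (fst l) else inv\<^bsub>G\<^esub> (s (fst l)))"

definition reduced_word :: "(nat \<times> bool) list \<Rightarrow> bool" where
  "reduced_word w \<longleftrightarrow> successively (\<lambda>k l. \<not> (fst k = fst l \<and> snd k \<noteq> snd l)) w"

definition is_free_group :: "('g, 'b) monoid_scheme \<Rightarrow> nat \<Rightarrow> (nat \<Rightarrow> 'g) \<Rightarrow> bool" where
  "is_free_group G r s \<longleftrightarrow>
     group G \<and> s ` {1..r} \<subseteq> carrier G \<and> generate G (s ` {1..r}) = carrier G \<and>
     (\<forall>w \<in> lists ({1..r} \<times> UNIV). w \<noteq> [] \<and> reduced_word w \<longrightarrow>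
        word_prod G (map (letter_val G s) w) \<noteq> \<one>\<^bsub>G\<^esub>)"

datatype free_kind = Free_Group | Free_Semigroup

fun is_free :: "free_kind \<Rightarrow> ('g, 'b) monoid_scheme \<Rightarrow> nat \<Rightarrow> (nat \<Rightarrow> 'g) \<Rightarrow> bool" where
  "is_free Free_Group G r s = is_free_group G r s"
| "is_free Free_Semigroup G r s = is_free_semigroup G r s"

fun letters :: "free_kind \<Rightarrow> ('g, 'b) monoid_scheme \<Rightarrow> nat \<Rightarrow> (nat \<Rightarrow> 'g) \<Rightarrow> 'g set" where
  "letters Free_Group G r s = s ` {1..r} \<union> (\<lambda>i. inv\<^bsub>G\<^esub> (s i)) ` {1..r}"
| "letters Free_Semigroup G r s = s ` {1..r}"

definition word_ball :: "('g, 'b) monoid_scheme \<Rightarrow> 'g set \<Rightarrow> nat \<Rightarrow> 'g set" where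
  "word_ball G S n = {word_prod G w | w. w \<in> lists S \<and> length w \<le> n}"

definition left_cayley_adj :: "('g, 'b) monoid_scheme \<Rightarrow> 'g set \<Rightarrow> 'g \<Rightarrow> 'g \<Rightarrow> bool" where
  "left_cayley_adj G S u v \<longleftrightarrow> (\<exists>x\<in>S. v = x \<otimes>\<^bsub>G\<^esub> u \<or> u = x \<otimes>\<^bsub>G\<^esub> v)"

definition left_cayley_path :: "('g, 'b) monoid_scheme \<Rightarrow> 'g set \<Rightarrow> 'g \<Rightarrow> 'g \<Rightarrow> 'g list \<Rightarrow> bool" where
  "left_cayley_path G S u v p \<longleftrightarrow>
     p \<noteq> [] \<and> p \<in> lists (carrier G) \<and> hd p = u \<and> last p = v \<and>
     successively (left_cayley_adj G S) p"

definition Past :: "('g, 'b) monoid_scheme \<Rightarrow> 'g set \<Rightarrow> 'g \<Rightarrow> 'g \<Rightarrow> 'g set" where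
  "Past G S g1 g2 = {f \<in> carrier G. \<forall>p. left_cayley_path G S f g1 p \<longrightarrow> g2 \<in> set p}"


section \<open>Measure-preserving actions\<close>

text \<open>
  A standard Borel space with a Borel probability measure, or the completion of one: both usual
  conventions for the sigma-algebra of a standard probability space are admitted.
\<close>

definition standard_prob_space :: "'a measure \<Rightarrow> bool" where
  "standard_prob_space M \<longleftrightarrow>
     (\<exists>N X. prob_space N \<and> completely_metrizable_space X \<and> second_countable X \<and>
        space N = topspace X \<and> sets N = sigma_sets (topspace X) {U. openin X U} \<and>
        (M = N \<or> M = completion N))"

definition measure_preserving_map :: "'a measure \<Rightarrow> ('a \<Rightarrow> 'a) \<Rightarrow> bool" where
  "measure_preserving_map M t \<longleftrightarrow>
     t \<in> measurable M M \<and> (\<forall>A\<in>sets M. emeasure M (t -` A \<inter> space M) = emeasure M A)"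

definition mp_action :: "('g, 'b) monoid_scheme \<Rightarrow> 'a measure \<Rightarrow> ('g \<Rightarrow> 'a \<Rightarrow> 'a) \<Rightarrow> bool" where
  "mp_action G M T \<longleftrightarrow>
     standard_prob_space M \<and>
     (\<forall>g\<in>carrier G. measure_preserving_map M (T g)) \<and>
     (\<forall>x\<in>space M. T \<one>\<^bsub>G\<^esub> x = x) \<and>
     (\<forall>g\<in>carrier G. \<forall>h\<in>carrier G. \<forall>x\<in>space M. T (g \<otimes>\<^bsub>G\<^esub> h) x = T g (T h x))"


section \<open>Partitions and entropy\<close>

definition measurable_partition :: "'a measure \<Rightarrow> 'a set set \<Rightarrow> bool" where
  "measurable_partition M \<alpha> \<longleftrightarrow> partition_on (space M) \<alpha> \<and> countable \<alpha> \<and> \<alpha> \<subseteq> sets M"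

text \<open>Empty sets are removed from pullbacks and joins, so that both are again partitions.\<close>

definition pull_part :: "'a measure \<Rightarrow> ('a \<Rightarrow> 'a) \<Rightarrow> 'a set set \<Rightarrow> 'a set set" where
  "pull_part M t \<alpha> = {t -` A \<inter> space M | A. A \<in> \<alpha>} - {{}}"

definition join_part :: "'a set set \<Rightarrow> 'a set set \<Rightarrow> 'a set set" where
  "join_part \<alpha> \<beta> = {A \<inter> B | A B. A \<in> \<alpha> \<and> B \<in> \<beta>} - {{}}"

definition Join_part :: "'a measure \<Rightarrow> 'i set \<Rightarrow> ('i \<Rightarrow> 'a set set) \<Rightarrow> 'a set set" where
  "Join_part M I P = {{x \<in> space M. \<forall>i\<in>I. x \<in> c i} | c. \<forall>i\<in>I. c i \<in> P i} - {{}}"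

definition coarsening :: "'a measure \<Rightarrow> 'a set set \<Rightarrow> 'a set set \<Rightarrow> bool" where
  "coarsening M \<beta> \<alpha> \<longleftrightarrow> (\<forall>A\<in>\<alpha>. \<exists>B\<in>\<beta>. emeasure M (A - B) = 0)"

definition entropy_part :: "'a measure \<Rightarrow> 'a set set \<Rightarrow> ennreal" where
  "entropy_part M \<alpha> = (\<Sum>\<^sub>\<infinity>A\<in>\<alpha>. ennreal (- (measure M A * ln (measure M A))))"

definition atom_of :: "'a set set \<Rightarrow> 'a \<Rightarrow> 'a set" where
  "atom_of \<alpha> x = (THE A. A \<in> \<alpha> \<and> x \<in> A)"

text \<open>
  Sub-sigma-algebras are represented by measures \<open>F\<close> of which only \<open>space F\<close> and \<open>sets F\<close> matter.
  The points \<open>x\<close> at which the conditional probability of the atom of \<open>x\<close> vanishes form a null set,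
  so the library's convention \<open>ln 0 = 0\<close> does not affect the integral.
\<close>

definition cond_entropy :: "'a measure \<Rightarrow> 'a measure \<Rightarrow> 'a set set \<Rightarrow> ereal" where
  "cond_entropy M F \<alpha> = enn2ereal
     (\<integral>\<^sup>+x. ennreal (- ln (real_cond_exp M F (indicator (atom_of \<alpha> x)) x)) \<partial>M)"

definition invariant_sigma_algebra ::
  "('g, 'b) monoid_scheme \<Rightarrow> 'a measure \<Rightarrow> ('g \<Rightarrow> 'a \<Rightarrow> 'a) \<Rightarrow> 'a set set \<Rightarrow> bool" where
  "invariant_sigma_algebra G M T \<A> \<longleftrightarrow>
     sigma_algebra (space M) \<A> \<and> \<A> \<subseteq> sets M \<and>
     (\<forall>g\<in>carrier G. \<forall>A\<in>\<A>. T g -` A \<inter> space M \<in> \<A>)"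

text \<open>The sigma-algebra \<open>\<beta>\<^sup>G\<close>.\<close>

definition inv_hull ::
  "('g, 'b) monoid_scheme \<Rightarrow> 'a measure \<Rightarrow> ('g \<Rightarrow> 'a \<Rightarrow> 'a) \<Rightarrow> 'a set set \<Rightarrow> 'a measure" where
  "inv_hull G M T \<beta> =
     sigma (space M) (\<Inter>{\<A>. invariant_sigma_algebra G M T \<A> \<and> \<beta> \<subseteq> \<A>})"

text \<open>The partition \<open>\<alpha>\<^sup>n\<close>.\<close>

definition ball_part ::
  "('g, 'b) monoid_scheme \<Rightarrow> 'g set \<Rightarrow> 'a measure \<Rightarrow> ('g \<Rightarrow> 'a \<Rightarrow> 'a) \<Rightarrow> 'a set set \<Rightarrow> nat \<Rightarrow> 'a set set"
  where "ball_part G S M T \<alpha> n = Join_part M (word_ball G S n) (\<lambda>g. pull_part M (T g) \<alpha>)"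

definition entropy_rate :: "'a measure \<Rightarrow> ('a \<Rightarrow> 'a) \<Rightarrow> 'a measure \<Rightarrow> 'a set set \<Rightarrow> ereal" where
  "entropy_rate M t F \<alpha> =
     lim (\<lambda>n. ereal (1 / real (n + 1)) *
            cond_entropy M F (Join_part M {0..n} (\<lambda>i. pull_part M (t ^^ i) \<alpha>)))"

definition F_cond ::
  "nat \<Rightarrow> (nat \<Rightarrow> 'g) \<Rightarrow> 'a measure \<Rightarrow> ('g \<Rightarrow> 'a \<Rightarrow> 'a) \<Rightarrow> 'a measure \<Rightarrow> 'a set set \<Rightarrow> ereal" where
  "F_cond r s M T F \<alpha> =
     ereal (1 - 2 * real r) * cond_entropy M F \<alpha> +
     (\<Sum>i=1..r. cond_entropy M F (join_part \<alpha> (pull_part M (T (s i)) \<alpha>)))"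

definition F_star_cond ::
  "nat \<Rightarrow> (nat \<Rightarrow> 'g) \<Rightarrow> 'a measure \<Rightarrow> ('g \<Rightarrow> 'a \<Rightarrow> 'a) \<Rightarrow> 'a measure \<Rightarrow> 'a set set \<Rightarrow> ereal" where
  "F_star_cond r s M T F \<alpha> =
     ereal (1 - real r) * cond_entropy M F \<alpha> + (\<Sum>i=1..r. entropy_rate M (T (s i)) F \<alpha>)"

definition f_cond ::
  "free_kind \<Rightarrow> ('g, 'b) monoid_scheme \<Rightarrow> nat \<Rightarrow> (nat \<Rightarrow> 'g) \<Rightarrow> 'a measure \<Rightarrow> ('g \<Rightarrow> 'a \<Rightarrow> 'a) \<Rightarrow>
     'a measure \<Rightarrow> 'a set set \<Rightarrow> ereal" where
  "f_cond k G r s M T F \<alpha> =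
     (INF n\<in>{0<..}. F_cond r s M T F (ball_part G (letters k G r s) M T \<alpha> n))"

definition f_star_cond ::
  "free_kind \<Rightarrow> ('g, 'b) monoid_scheme \<Rightarrow> nat \<Rightarrow> (nat \<Rightarrow> 'g) \<Rightarrow> 'a measure \<Rightarrow> ('g \<Rightarrow> 'a \<Rightarrow> 'a) \<Rightarrow>
     'a measure \<Rightarrow> 'a set set \<Rightarrow> ereal" where
  "f_star_cond k G r s M T F \<alpha> =
     (INF n\<in>{0<..}. F_star_cond r s M T F (ball_part G (letters k G r s) M T \<alpha> n))"


section \<open>Markov processes\<close>

definition G_process ::
  "('g, 'b) monoid_scheme \<Rightarrow> ('g \<Rightarrow> 'a \<Rightarrow> 'a) \<Rightarrow> 'a measure \<Rightarrow> 'a set set \<Rightarrow> bool" where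
  "G_process G T M \<alpha> \<longleftrightarrow> mp_action G M T \<and> measurable_partition M \<alpha>"

definition markov_process ::
  "('g, 'b) monoid_scheme \<Rightarrow> 'g set \<Rightarrow> ('g \<Rightarrow> 'a \<Rightarrow> 'a) \<Rightarrow> 'a measure \<Rightarrow> 'a set set \<Rightarrow> bool" where
  "markov_process G S T M \<alpha> \<longleftrightarrow>
     G_process G T M \<alpha> \<and>
     (\<forall>x\<in>S. \<forall>g\<in>carrier G. \<forall>A\<in>\<alpha>.
        AE y in M.
          real_cond_exp M (sigma (space M) (\<Union>f\<in>Past G S (x \<otimes>\<^bsub>G\<^esub> g) g. pull_part M (T f) \<alpha>))
            (indicator (T (x \<otimes>\<^bsub>G\<^esub> g) -` A \<inter> space M)) y =
          real_cond_exp M (sigma (space M) (pull_part M (T g) \<alpha>))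
            (indicator (T (x \<otimes>\<^bsub>G\<^esub> g) -` A \<inter> space M)) y)"

end

theory Submission
  imports Defs
begin

text \<open>
  Write \<open>\<alpha>\<^sub>g\<close> for \<open>T\<^sub>g\<inverse>\<alpha>\<close>. In both the group and the semigroup case the elements of \<open>G\<close> are reduced words,
  and the left Cayley graph is the tree in which the parent of a nonempty word \<open>w\<close> is \<open>tl w\<close>. Every
  entropy in the theorem is the entropy given \<open>\<beta>\<^sup>G\<close> of a join \<open>\<Or>\<^bsub>g\<in>B\<^esub> \<alpha>\<^sub>g\<close> over a finite subtree
  \<open>B\<close> containing \<open>e\<close>: balls and unions of right translates of balls by powers of \<open>s\<^sub>j\<close>.

  The probabilistic core is that the process stays Markov relative to \<open>\<beta>\<^sup>G\<close>. Let \<open>v = l w\<close> be a child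
  of \<open>w\<close>. By the Markov property, applied vertex by vertex upwards (\<open>screens_desc\<close>), the labels in the
  subtree of \<open>v\<close> and the labels outside it are independent given \<open>\<alpha>\<^sub>w\<close>. As \<open>\<beta>\<close> is a coarsening, \<open>\<beta>\<^sup>G\<close> is
  generated by functions of the labels outside the subtree and functions of the labels inside it.
  The former give no further information about \<open>\<alpha>\<^sub>v\<close>, and the latter may be added to the condition on
  both sides (\<open>screens_swap\<close>). So \<open>H(\<alpha>\<^sub>v | \<alpha>\<^sub>J \<or> \<beta>\<^sup>G)\<close>, for any set \<open>J\<close> outside the subtree with \<open>w \<in> J\<close>,
  is the entropy of \<open>\<alpha>\<^sub>v\<close> given \<open>\<alpha>\<^sub>w\<close> and the coarse labels in the subtree, and right translation
  shows that this depends on the letter \<open>l\<close> only (\<open>label_entropy_edge\<close>). In the group case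
  the letters \<open>s\<^sub>j\<close> and \<open>s\<^sub>j\<inverse>\<close> give the same value (\<open>edge_entropy_inv\<close>). Call it \<open>c\<^sub>j\<close>, and put
  \<open>h = H(\<alpha> | \<beta>\<^sup>G)\<close>.

  The chain rule then yields \<open>H(\<alpha>\<^sub>B | \<beta>\<^sup>G) = h + \<Sum> c\<close>, with one term for each edge of the tree \<open>B\<close>
  (\<open>label_entropy_subtree\<close>), and the rest is counting edges. Passing from \<open>\<Union>\<^bsub>m\<le>N\<^esub> B(e,n) s\<^sub>j\<^sup>m\<close> to
  the same union up to \<open>N + 1\<close> adds the words of length \<open>n + N + 1\<close> that end in \<open>s\<^sub>j\<^bsup>N+1\<^esup>\<close>, and their
  total weight \<open>d\<^sub>j(n)\<close> does not depend on \<open>N\<close> (\<open>sum_ball_orbit\<close>). Hence \<open>h(T\<^sub>s, \<alpha>\<^sup>n | \<beta>\<^sup>G)\<close>, for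
  \<open>s = s\<^sub>j\<close>, is exactly the first increment \<open>d\<^sub>j(n)\<close>, which gives \<open>F = F\<^sub>*\<close> for every \<open>\<alpha>\<^sup>n\<close>. The common value
  is \<open>(1 - r) H(\<alpha>\<^sup>n | \<beta>\<^sup>G) + \<Sum>\<^sub>j d\<^sub>j(n)\<close>, and it is independent of \<open>n\<close>: a word can be prolonged by each of
  the \<open>r\<close> generators, except that a word ending in an inverse generator excludes one of them
  (\<open>weighted_euler_characteristic\<close>). For \<open>n = 0\<close> it is \<open>(1 - r) h + \<Sum>\<^sub>j c\<^sub>j\<close>. All infima are
  therefore infima of constants.
\<close>

section \<open>Conditional probabilities given sub-\<sigma>-algebras\<close>

abbreviation cprob :: "'a measure \<Rightarrow> 'a measure \<Rightarrow> 'a set \<Rightarrow> 'a \<Rightarrow> real" where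
  "cprob M F A \<equiv> real_cond_exp M F (indicator A)"

context prob_space
begin

lemma sigma_finite_subalgebraI: "subalgebra M F \<Longrightarrow> sigma_finite_subalgebra M F"
  by (intro finite_measure_subalgebra_is_sigma_finite)
    (simp add: finite_measure_subalgebra_def finite_measure_subalgebra_axioms_def finite_measure_axioms)

lemma cprob_measurable:
  "cprob M F A \<in> borel_measurable F"
  by (rule borel_measurable_cond_exp)

lemma cprob_measurable_upper:
  assumes "subalgebra M F" "sets F \<subseteq> sets N" "space N = space M"
  shows "cprob M F A \<in> borel_measurable N"
  by (rule measurable_from_subalg[OF _ cprob_measurable])
    (use assms in \<open>auto simp: subalgebra_def\<close>)

lemma integrable_unit_interval:
  fixes f :: "'a \<Rightarrow> real"
  assumes "f \<in> borel_measurable M" "AE x in M. 0 \<le> f x \<and> f x \<le> 1"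
  shows "integrable M f"
  by (rule integrable_const_bound[where B = 1]) (use assms in auto)

lemma cprob_unit:
  assumes F: "subalgebra M F" and A: "A \<in> sets M"
  shows "AE x in M. 0 \<le> cprob M F A x \<and> cprob M F A x \<le> 1"
proof -
  interpret sigma_finite_subalgebra M F by (rule sigma_finite_subalgebraI[OF F])
  have "AE x in M. 0 \<le> cprob M F A x"
    by (rule real_cond_exp_pos) (use A in auto)
  moreover have "AE x in M. cprob M F A x \<le> 1"
    by (rule real_cond_exp_le_c)
      (use A in \<open>auto simp: emeasure_eq_measure intro!: integrable_real_indicator AE_I2 split: split_indicator\<close>)
  ultimately show ?thesis by auto
qed

lemma integrable_mult_unit:
  fixes f g :: "'a \<Rightarrow> real"
  assumes "f \<in> borel_measurable M" "AE x in M. 0 \<le> f x \<and> f x \<le> 1"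
    and "g \<in> borel_measurable M" "AE x in M. 0 \<le> g x \<and> g x \<le> 1"
  shows "integrable M (\<lambda>x. f x * g x)"
proof (rule integrable_unit_interval)
  show "AE x in M. 0 \<le> f x * g x \<and> f x * g x \<le> 1"
    using assms(2,4) by eventually_elim (auto intro: mult_le_one)
qed (use assms in auto)

lemma integral_mult_cprob:
  assumes F: "subalgebra M F" and A: "A \<in> sets M"
    and f: "f \<in> borel_measurable F" "AE x in M. 0 \<le> f x \<and> f x \<le> 1"
  shows "(\<integral>x. f x * cprob M F A x \<partial>M) = (\<integral>x. f x * indicator A x \<partial>M)"
proof -
  interpret sigma_finite_subalgebra M F by (rule sigma_finite_subalgebraI[OF F])
  have fM: "f \<in> borel_measurable M" by (rule measurable_from_subalg[OF F f(1)])
  show ?thesis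
    by (rule real_cond_exp_intg(2))
      (use A f fM in \<open>auto intro!: integrable_mult_unit simp: indicator_def\<close>)
qed

lemma AE_unit_indicator: "AE x in M. 0 \<le> (indicator U x :: real) \<and> indicator U x \<le> (1::real)"
  by (auto simp: indicator_def)

lemma integral_indicator_mult_indicator:
  assumes "U \<in> sets M" "A \<in> sets M"
  shows "(\<integral>x. indicator U x * (indicator A x :: real) \<partial>M) = measure M (U \<inter> A)"
proof -
  have "(\<integral>x. indicator U x * indicator A x \<partial>M) = (\<integral>x. (indicator (U \<inter> A) x :: real) \<partial>M)"
    by (rule Bochner_Integration.integral_cong) (auto simp: indicator_def)
  also have "\<dots> = measure M (U \<inter> A)" using assms by simp
  finally show ?thesis .
qed

lemma integral_indicator_mult_cprob:
  assumes F: "subalgebra M F" and A: "A \<in> sets M" and U: "U \<in> sets F"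
  shows "(\<integral>x. indicator U x * cprob M F A x \<partial>M) = measure M (U \<inter> A)"
proof -
  have "U \<in> sets M" using F U by (auto simp: subalgebra_def)
  then show ?thesis
    using integral_mult_cprob[OF F A, of "indicator U"] U A
    by (simp add: AE_unit_indicator integral_indicator_mult_indicator)
qed

text \<open>
  Both sides of the defining identity of a conditional probability are finite measures in the test
  set, so by Dynkin's lemma it is enough to test on a generating \<open>\<inter>\<close>-stable family.
\<close>

lemma cprob_eqI:
  assumes F: "subalgebra M F" and A: "A \<in> sets M"
    and g: "g \<in> borel_measurable F" "AE x in M. 0 \<le> g x \<and> g x \<le> 1"
    and E: "sets F = sigma_sets (space M) E" "Int_stable E" "E \<subseteq> Pow (space M)" "space M \<in> E"
    and int: "\<And>U. U \<in> E \<Longrightarrow> (\<integral>x. indicator U x * g x \<partial>M) = measure M (U \<inter> A)"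
  shows "AE x in M. cprob M F A x = g x"
proof -
  interpret sigma_finite_subalgebra M F by (rule sigma_finite_subalgebraI[OF F])
  have gM [measurable]: "g \<in> borel_measurable M" by (rule measurable_from_subalg[OF F g(1)])
  have gi: "integrable M g" by (rule integrable_unit_interval) (use g gM in auto)
  have FM: "U \<in> sets M" if "U \<in> sets F" for U using F that by (auto simp: subalgebra_def)
  have sM: "U \<in> sets M" if "U \<in> sigma_sets (space M) E" for U using FM E(1) that by simp
  have ii: "integrable M (\<lambda>x. indicator U x * g x)" if "U \<in> sets M" for U
    using integrable_mult_indicator[OF that gi] by simp
  have key: "(\<integral>x. indicator U x * g x \<partial>M) = measure M (U \<inter> A)"
    if "U \<in> sigma_sets (space M) E" for U
    using E(2,3) that
  proof (induction rule: sigma_sets_induct_disjoint)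
    case (basic U) then show ?case by (rule int)
  next
    case empty show ?case by simp
  next
    case (compl U)
    have U: "U \<in> sets M" using sM compl(1) .
    have "(\<integral>x. indicator (space M - U) x * g x \<partial>M) =
          (\<integral>x. indicator (space M) x * g x - indicator U x * g x \<partial>M)"
      by (rule Bochner_Integration.integral_cong) (auto simp: indicator_def)
    also have "\<dots> = measure M (space M \<inter> A) - measure M (U \<inter> A)"
      using U by (subst Bochner_Integration.integral_diff) (auto simp: ii int[OF E(4)] compl(2))
    also have "\<dots> = measure M ((space M - U) \<inter> A)"
    proof -
      have "measure M (space M \<inter> A) = measure M ((space M - U) \<inter> A) + measure M (U \<inter> A)"
        using U A sets.sets_into_space[OF A]
        by (subst finite_measure_Union[symmetric]) (auto intro!: arg_cong[where f = "measure M"])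
      then show ?thesis by simp
    qed
    finally show ?case .
  next
    case (union U)
    have U: "U i \<in> sets M" for i using sM union(2) by blast
    have "(\<lambda>i. measure M (U i \<inter> A)) sums measure M (\<Union>i. U i \<inter> A)"
      by (rule finite_measure_UNION) (use U A union(1) in \<open>auto simp: disjoint_family_on_def\<close>)
    moreover have "(\<integral>x\<in>(\<Union>i. U i). g x \<partial>M) = (\<Sum>i. \<integral>x\<in>U i. g x \<partial>M)"
    proof (rule lebesgue_integral_countable_add)
      show "set_integrable M (\<Union>i. U i) g"
        unfolding set_integrable_def using U by (intro integrable_mult_indicator gi) auto
      show "U i \<inter> U j = {}" if "i \<noteq> j" for i j using that union(1) by (auto simp: disjoint_family_on_def)
    qed (use U in auto)
    ultimately have "measure M (\<Union>i. U i \<inter> A) = (\<integral>x\<in>(\<Union>i. U i). g x \<partial>M)"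
      using union(3) by (auto simp: set_lebesgue_integral_def sums_iff)
    moreover have "(\<Union>i. U i \<inter> A) = (\<Union>i. U i) \<inter> A" by auto
    ultimately show ?case by (simp add: set_lebesgue_integral_def)
  qed
  show ?thesis
  proof (rule real_cond_exp_charact)
    fix U assume U: "U \<in> sets F"
    have "(\<integral>x\<in>U. indicator A x \<partial>M) = measure M (U \<inter> A)"
      using integral_indicator_mult_indicator[OF FM[OF U] A] by (simp add: set_lebesgue_integral_def)
    with key U E(1) show "(\<integral>x\<in>U. indicator A x \<partial>M) = (\<integral>x\<in>U. g x \<partial>M)"
      by (simp add: set_lebesgue_integral_def)
  qed (use A gi g in \<open>auto simp: emeasure_eq_measure intro!: integrable_real_indicator\<close>)
qed

lemma cprob_eqI_sets:
  assumes F: "subalgebra M F" and A: "A \<in> sets M"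
    and g: "g \<in> borel_measurable F" "AE x in M. 0 \<le> g x \<and> g x \<le> 1"
    and int: "\<And>U. U \<in> sets F \<Longrightarrow> (\<integral>x. indicator U x * g x \<partial>M) = measure M (U \<inter> A)"
  shows "AE x in M. cprob M F A x = g x"
proof (rule cprob_eqI[OF F A g])
  have sp: "space F = space M" using F by (simp add: subalgebra_def)
  show "sets F = sigma_sets (space M) (sets F)" using sets.sigma_sets_eq[of F] sp by simp
  show "Int_stable (sets F)" by (auto simp: Int_stable_def)
  show "sets F \<subseteq> Pow (space M)" using sets.space_closed[of F] sp by simp
  show "space M \<in> sets F" using sets.top[of F] sp by simp
qed (rule int)

text \<open>
  By the tower property, the prediction from \<open>F\<close> is the average over \<open>F\<close> of the prediction from \<open>F2\<close>,
  which by assumption is already measurable over \<open>F1\<close> and so over \<open>F\<close>.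
\<close>

lemma cprob_sandwich:
  assumes A: "A \<in> sets M"
    and F1: "subalgebra M F1" and F: "subalgebra M F" and F2: "subalgebra M F2"
    and sub: "sets F1 \<subseteq> sets F" "sets F \<subseteq> sets F2"
    and eq: "AE x in M. cprob M F2 A x = cprob M F1 A x"
  shows "AE x in M. cprob M F A x = cprob M F1 A x"
proof (rule cprob_eqI_sets[OF F A])
  show "cprob M F1 A \<in> borel_measurable F"
    by (rule cprob_measurable_upper[OF F1]) (use F sub in \<open>auto simp: subalgebra_def\<close>)
  show "AE x in M. 0 \<le> cprob M F1 A x \<and> cprob M F1 A x \<le> 1" by (rule cprob_unit[OF F1 A])
  fix U assume U: "U \<in> sets F"
  have [measurable]: "U \<in> sets M" using U F by (auto simp: subalgebra_def)
  have "(\<integral>x. indicator U x * cprob M F1 A x \<partial>M) = (\<integral>x. indicator U x * cprob M F2 A x \<partial>M)"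
    by (rule integral_cong_AE) (use eq in \<open>auto\<close>)
  also have "\<dots> = measure M (U \<inter> A)"
    by (rule integral_indicator_mult_cprob[OF F2 A]) (use U sub in auto)
  finally show "(\<integral>x. indicator U x * cprob M F1 A x \<partial>M) = measure M (U \<inter> A)" .
qed

lemma cprob_cong_sets: "sets F = sets F' \<Longrightarrow> cprob M F A = cprob M F' A"
  using sets_eq_imp_space_eq[of F F']
  by (simp add: real_cond_exp_def nn_cond_exp_def subalgebra_def restr_to_subalg_def cong: if_cong)

text \<open>
  A test set may be replaced by an almost equal one without changing either side of the defining
  identity of a conditional probability.
\<close>

lemma cprob_null_extension:
  assumes A: "A \<in> sets M" and F: "subalgebra M F" and N: "subalgebra M N"
    and sub: "sets F \<subseteq> sets N"
    and approx: "\<And>U. U \<in> sets N \<Longrightarrow> \<exists>V\<in>sets F. AE x in M. x \<in> U \<longleftrightarrow> x \<in> V"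
  shows "AE x in M. cprob M N A x = cprob M F A x"
proof (rule cprob_eqI_sets[OF N A])
  show "cprob M F A \<in> borel_measurable N"
    by (rule cprob_measurable_upper[OF F]) (use N sub in \<open>auto simp: subalgebra_def\<close>)
  show "AE x in M. 0 \<le> cprob M F A x \<and> cprob M F A x \<le> 1" by (rule cprob_unit[OF F A])
  fix U assume U: "U \<in> sets N"
  then have [measurable]: "U \<in> sets M" using N by (auto simp: subalgebra_def)
  obtain V where V: "V \<in> sets F" and eq: "AE x in M. x \<in> U \<longleftrightarrow> x \<in> V" using approx[OF U] by blast
  then have [measurable]: "V \<in> sets M" using F by (auto simp: subalgebra_def)
  have "(\<integral>x. indicator U x * cprob M F A x \<partial>M) = (\<integral>x. indicator V x * cprob M F A x \<partial>M)"
  proof (rule integral_cong_AE)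
    show "AE x in M. indicator U x * cprob M F A x = indicator V x * cprob M F A x"
      using eq by eventually_elim (auto simp: indicator_def)
  qed auto
  also have "\<dots> = measure M (V \<inter> A)" by (rule integral_indicator_mult_cprob[OF F A V])
  also have "\<dots> = measure M (U \<inter> A)"
  proof (rule finite_measure_eq_AE)
    show "AE x in M. x \<in> V \<inter> A \<longleftrightarrow> x \<in> U \<inter> A" using eq by eventually_elim auto
  qed (use A in auto)
  finally show "(\<integral>x. indicator U x * cprob M F A x \<partial>M) = measure M (U \<inter> A)" .
qed

text \<open>
  The sets that are almost equal to members of \<open>F2\<close> form a \<open>\<sigma>\<close>-algebra \<open>N\<close> that contains \<open>F1\<close> as well,
  and by the preceding lemma \<open>N\<close> predicts like \<open>F1\<close> and like \<open>F2\<close>. This is what allows a coarsening up to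
  null sets to be treated as an exact one.
\<close>

lemma cprob_null_equivalent:
  assumes A: "A \<in> sets M"
    and F1: "sets F1 = sigma_sets (space M) E1" "E1 \<subseteq> sets M"
    and F2: "sets F2 = sigma_sets (space M) E2" "E2 \<subseteq> sets M"
    and E12: "\<And>U. U \<in> E1 \<Longrightarrow> \<exists>V\<in>sets F2. AE x in M. x \<in> U \<longleftrightarrow> x \<in> V"
    and E21: "\<And>U. U \<in> E2 \<Longrightarrow> \<exists>V\<in>sets F1. AE x in M. x \<in> U \<longleftrightarrow> x \<in> V"
  shows "AE x in M. cprob M F1 A x = cprob M F2 A x"
proof -
  define near :: "'a measure \<Rightarrow> 'a set set"
    where "near F = {U \<in> sets M. \<exists>V\<in>sets F. AE x in M. x \<in> U \<longleftrightarrow> x \<in> V}" for F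
  have sub: "subalgebra M F" if "sets F = sigma_sets (space M) E" "E \<subseteq> sets M" for F E
  proof -
    have "E \<subseteq> Pow (space M)" using that(2) sets.space_closed by blast
    then have "sets F = sets (sigma (space M) E)" using that(1) by simp
    then have "space F = space M" using sets_eq_imp_space_eq[of F "sigma (space M) E"]
      by (simp add: space_measure_of_conv)
    moreover have "sets F \<subseteq> sets M" using that sets.sigma_sets_subset by simp
    ultimately show ?thesis by (simp add: subalgebra_def)
  qed
  have S1: "subalgebra M F1" and S2: "subalgebra M F2" using sub F1 F2 by blast+
  have sa: "sigma_algebra (space M) (near F)" if F: "subalgebra M F" for F
  proof -
    have sp: "space F = space M" and FM: "sets F \<subseteq> sets M" using F by (auto simp: subalgebra_def)
    show ?thesis
    proof (rule sigma_algebra_iff2[THEN iffD2], safe)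
      show "x \<in> space M" if "U \<in> near F" "x \<in> U" for x U
        using that sets.sets_into_space by (auto simp: near_def)
      show "{} \<in> near F" by (auto simp: near_def)
      show "space M - U \<in> near F" if U: "U \<in> near F" for U
      proof -
        obtain V where V: "V \<in> sets F" "AE x in M. x \<in> U \<longleftrightarrow> x \<in> V" "U \<in> sets M"
          using U by (auto simp: near_def)
        have "space M - V \<in> sets F" using V(1) sp by (metis sets.compl_sets)
        moreover have "AE x in M. x \<in> space M - U \<longleftrightarrow> x \<in> space M - V"
          using V(2) by eventually_elim auto
        ultimately show ?thesis using V(3) unfolding near_def by blast
      qed
      show "(\<Union>i. U i) \<in> near F" if U: "range U \<subseteq> near F" for U :: "nat \<Rightarrow> 'a set"
      proof -
        have "\<forall>i. \<exists>V. V \<in> sets F \<and> (AE x in M. x \<in> U i \<longleftrightarrow> x \<in> V)" "\<And>i. U i \<in> sets M"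
          using U by (auto simp: near_def)
        then obtain V where V: "\<And>i. V i \<in> sets F" "\<And>i. AE x in M. x \<in> U i \<longleftrightarrow> x \<in> V i" by metis
        have "AE x in M. \<forall>i. x \<in> U i \<longleftrightarrow> x \<in> V i" using V(2) by (simp add: AE_all_countable)
        then have "AE x in M. x \<in> (\<Union>i. U i) \<longleftrightarrow> x \<in> (\<Union>i. V i)" by eventually_elim auto
        moreover have "(\<Union>i. V i) \<in> sets F" using V(1) by auto
        moreover have "(\<Union>i. U i) \<in> sets M" using \<open>\<And>i. U i \<in> sets M\<close> by auto
        ultimately show ?thesis unfolding near_def by blast
      qed
    qed
  qed
  define N where "N = sigma (space M) (near F2)"
  have nM: "near F \<subseteq> Pow (space M)" for F using sets.sets_into_space by (auto simp: near_def)
  have setsN: "sets N = near F2"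
    unfolding N_def using nM by (simp add: sigma_algebra.sigma_sets_eq[OF sa[OF S2]])
  have SN: "subalgebra M N"
    using setsN nM by (auto simp: subalgebra_def N_def near_def space_measure_of_conv)
  have "sets F1 \<subseteq> near F2"
    unfolding F1(1) by (rule sigma_algebra.sigma_sets_subset[OF sa[OF S2]])
      (use E12 F1(2) in \<open>auto simp: near_def\<close>)
  have "sets F2 \<subseteq> near F1"
    unfolding F2(1) by (rule sigma_algebra.sigma_sets_subset[OF sa[OF S1]])
      (use E21 F2(2) in \<open>auto simp: near_def\<close>)
  have "AE x in M. cprob M N A x = cprob M F1 A x"
  proof (rule cprob_null_extension[OF A S1 SN])
    show "sets F1 \<subseteq> sets N" using setsN \<open>sets F1 \<subseteq> near F2\<close> by simp
    fix U assume "U \<in> sets N"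
    then obtain V where V: "V \<in> sets F2" "AE x in M. x \<in> U \<longleftrightarrow> x \<in> V" by (auto simp: setsN near_def)
    with \<open>sets F2 \<subseteq> near F1\<close> obtain W where W: "W \<in> sets F1" "AE x in M. x \<in> V \<longleftrightarrow> x \<in> W"
      by (auto simp: near_def)
    show "\<exists>V\<in>sets F1. AE x in M. x \<in> U \<longleftrightarrow> x \<in> V"
      using V(2) W by (auto intro!: bexI[of _ W])
  qed
  moreover have "AE x in M. cprob M N A x = cprob M F2 A x"
  proof (rule cprob_null_extension[OF A S2 SN])
    show "sets F2 \<subseteq> sets N" using setsN S2 by (auto simp: near_def subalgebra_def)
  qed (auto simp: setsN near_def)
  ultimately show ?thesis by auto
qed

text \<open>
  Inside \<open>Y\<close> the \<open>\<sigma>\<close>-algebra \<open>F'\<close> is no finer than \<open>F\<close>, so there the conditional probability of \<open>W\<close> is the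
  elementary quotient of those of \<open>Y \<inter> W\<close> and \<open>Y\<close>. The statement is multiplied out to avoid dividing
  by zero.
\<close>

lemma cprob_on_atom:
  assumes F: "subalgebra M F" and F': "subalgebra M F'" and sub: "sets F \<subseteq> sets F'"
    and Y: "Y \<in> sets F'" and W: "W \<in> sets M"
    and trace: "\<And>U. U \<in> sets F' \<Longrightarrow> \<exists>V\<in>sets F. U \<inter> Y = V \<inter> Y"
  shows "AE x in M. x \<in> Y \<longrightarrow> cprob M F' W x * cprob M F Y x = cprob M F (Y \<inter> W) x"
proof -
  interpret sigma_finite_subalgebra M F by (rule sigma_finite_subalgebraI[OF F])
  have YM [measurable]: "Y \<in> sets M" using Y F' by (auto simp: subalgebra_def)
  have YW [measurable]: "Y \<inter> W \<in> sets M" using W by auto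
  define p where "p = cprob M F Y"
  define q where "q = cprob M F (Y \<inter> W)"
  have pq [measurable]: "p \<in> borel_measurable F" "q \<in> borel_measurable F"
    unfolding p_def q_def by (rule cprob_measurable)+
  have pqM [measurable]: "p \<in> borel_measurable M" "q \<in> borel_measurable M"
    unfolding p_def q_def by simp_all
  have pqF' [measurable]: "p \<in> borel_measurable F'" "q \<in> borel_measurable F'"
    unfolding p_def q_def by (rule cprob_measurable_upper[OF F]; use F' sub in \<open>simp add: subalgebra_def\<close>)+
  have "AE x in M. q x \<le> p x" unfolding p_def q_def
    by (rule real_cond_exp_mono)
      (auto simp: emeasure_eq_measure intro!: integrable_real_indicator split: split_indicator)
  then have unit: "AE x in M. 0 \<le> q x \<and> q x \<le> p x \<and> p x \<le> 1"
    using cprob_unit[OF F YM] cprob_unit[OF F YW] unfolding p_def q_def by eventually_elim auto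
  have quot: "AE x in M. 0 \<le> q x / p x \<and> q x / p x \<le> 1"
    using unit by eventually_elim (auto simp: divide_le_eq_1)
  have "AE x in M. cprob M F' (Y \<inter> W) x = indicator Y x * (q x / p x)"
  proof (rule cprob_eqI_sets[OF F' YW])
    show "(\<lambda>x. indicator Y x * (q x / p x)) \<in> borel_measurable F'" using Y by measurable
    show "AE x in M. 0 \<le> indicator Y x * (q x / p x) \<and> indicator Y x * (q x / p x) \<le> 1"
      using quot by eventually_elim (auto split: split_indicator)
    fix U assume U: "U \<in> sets F'"
    then have [measurable]: "U \<in> sets M" using F' by (auto simp: subalgebra_def)
    obtain V where V: "V \<in> sets F" "U \<inter> Y = V \<inter> Y" using trace[OF U] by blast
    have [measurable]: "V \<in> sets M" using V F by (auto simp: subalgebra_def)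
    have "(\<integral>x. indicator U x * (indicator Y x * (q x / p x)) \<partial>M) =
          (\<integral>x. indicator V x * (q x / p x) * indicator Y x \<partial>M)"
      by (rule Bochner_Integration.integral_cong) (use V(2) in \<open>auto split: split_indicator\<close>)
    also have "\<dots> = (\<integral>x. indicator V x * (q x / p x) * p x \<partial>M)"
      unfolding p_def
    proof (rule integral_mult_cprob[OF F YM, symmetric], fold p_def)
      show "(\<lambda>x. indicator V x * (q x / p x)) \<in> borel_measurable F" using V(1) by measurable
      show "AE x in M. 0 \<le> indicator V x * (q x / p x) \<and> indicator V x * (q x / p x) \<le> 1"
        using quot by eventually_elim (auto split: split_indicator)
    qed
    \<comment> \<open>Where \<open>p\<close> vanishes the quotient is \<open>0\<close>, and so is \<open>q\<close>, because \<open>q \<le> p\<close>.\<close>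
    also have "\<dots> = (\<integral>x. indicator V x * q x \<partial>M)"
    proof (rule integral_cong_AE)
      show "AE x in M. indicator V x * (q x / p x) * p x = indicator V x * q x"
        using unit by eventually_elim auto
    qed auto
    also have "\<dots> = measure M (V \<inter> (Y \<inter> W))"
      unfolding q_def by (rule integral_indicator_mult_cprob[OF F YW V(1)])
    also have "V \<inter> (Y \<inter> W) = U \<inter> (Y \<inter> W)" using V(2) by auto
    finally show "(\<integral>x. indicator U x * (indicator Y x * (q x / p x)) \<partial>M) = measure M (U \<inter> (Y \<inter> W))" .
  qed
  moreover have "AE x in M. cprob M F' (Y \<inter> W) x = indicator Y x * cprob M F' W x"
  proof (rule cprob_eqI_sets[OF F' YW])
    show "(\<lambda>x. indicator Y x * cprob M F' W x) \<in> borel_measurable F'"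
      using Y cprob_measurable[of F' W] by measurable
    show "AE x in M. 0 \<le> indicator Y x * cprob M F' W x \<and> indicator Y x * cprob M F' W x \<le> 1"
      using cprob_unit[OF F' W] by eventually_elim (auto split: split_indicator)
    fix U assume U: "U \<in> sets F'"
    have "(\<integral>x. indicator U x * (indicator Y x * cprob M F' W x) \<partial>M) =
          (\<integral>x. indicator (U \<inter> Y) x * cprob M F' W x \<partial>M)"
      by (rule Bochner_Integration.integral_cong) (auto split: split_indicator)
    also have "\<dots> = measure M ((U \<inter> Y) \<inter> W)"
      by (rule integral_indicator_mult_cprob[OF F' W]) (use U Y in auto)
    finally show "(\<integral>x. indicator U x * (indicator Y x * cprob M F' W x) \<partial>M) = measure M (U \<inter> (Y \<inter> W))"
      by (simp add: Int_assoc)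
  qed
  ultimately show ?thesis using unit
    unfolding p_def[symmetric] q_def[symmetric] by eventually_elim auto
qed

text \<open>
  The event on which the conditional probability of \<open>Y\<close> vanishes is itself a test set, and testing on
  it shows that it meets \<open>Y\<close> in a null set.
\<close>

lemma cprob_pos:
  assumes F: "subalgebra M F" and Y: "Y \<in> sets M"
  shows "AE x in M. x \<in> Y \<longrightarrow> 0 < cprob M F Y x"
proof -
  have sp: "space F = space M" using F by (simp add: subalgebra_def)
  define U where "U = {x \<in> space M. cprob M F Y x \<le> 0}"
  have U: "U \<in> sets F" unfolding U_def sp[symmetric] using cprob_measurable[of F Y] by measurable
  then have [measurable]: "U \<in> sets M" using F by (auto simp: subalgebra_def)
  have "(\<integral>x. indicator U x * cprob M F Y x \<partial>M) = (\<integral>x. 0 \<partial>M)"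
  proof (rule integral_cong_AE)
    show "AE x in M. indicator U x * cprob M F Y x = 0"
      using cprob_unit[OF F Y] by eventually_elim (auto simp: U_def indicator_def)
  qed auto
  then have "measure M (U \<inter> Y) = 0" using integral_indicator_mult_cprob[OF F Y U] by simp
  then have "AE x in M. x \<notin> U \<inter> Y" using Y by (subst AE_iff_measurable[of "U \<inter> Y"]) (auto simp: emeasure_eq_measure dest: sets.sets_into_space)
  then show ?thesis using AE_space by eventually_elim (auto simp: U_def)
qed

end

section \<open>Countable labels, screening off, and conditional entropy\<close>

text \<open>
  Countable partitions are handled through the labels of their atoms. All \<open>\<sigma>\<close>-algebras below are
  generated by subfamilies of one family of labels, so joins of \<open>\<sigma>\<close>-algebras are unions of index sets.
\<close>

locale label_family = prob_space M for M :: "'a measure" +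
  fixes Z :: "'i \<Rightarrow> 'a \<Rightarrow> 'c"
  assumes Z_measurable: "Z i \<in> measurable M (count_space UNIV)"
    and Z_countable: "countable (Z i ` space M)"
begin

text \<open>
  Arbitrary sets \<open>C\<close> of labels are admitted, which makes functions of labels measurable at sight. As
  labels take countably many values, single values generate the same \<open>\<sigma>\<close>-algebra.
\<close>

definition alg :: "'i set \<Rightarrow> 'a measure" where
  "alg I = sigma (space M) {Z i -` C \<inter> space M | i C. i \<in> I}"

lemma Z_event [measurable]: "Z i -` C \<inter> space M \<in> sets M"
  by (rule measurable_sets[OF Z_measurable]) simp

lemma space_alg [simp]: "space (alg I) = space M"
  by (simp add: alg_def space_measure_of_conv)

lemma sets_alg: "sets (alg I) = sigma_sets (space M) {Z i -` C \<inter> space M | i C. i \<in> I}"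
  unfolding alg_def by (rule sets_measure_of) auto

lemma Z_event_alg: "i \<in> I \<Longrightarrow> Z i -` C \<inter> space M \<in> sets (alg I)"
  unfolding sets_alg by (rule sigma_sets.Basic) blast

lemma alg_least:
  assumes "sigma_algebra (space M) S" "\<And>i C. i \<in> I \<Longrightarrow> Z i -` C \<inter> space M \<in> S"
  shows "sets (alg I) \<subseteq> S"
  unfolding sets_alg by (rule sigma_algebra.sigma_sets_subset[OF assms(1)]) (use assms(2) in auto)

lemma alg_least':
  assumes "space N = space M" "\<And>i C. i \<in> I \<Longrightarrow> Z i -` C \<inter> space M \<in> sets N"
  shows "sets (alg I) \<subseteq> sets N"
  by (rule alg_least) (use assms sets.sigma_algebra_axioms[of N] in auto)

lemma subalgebra_alg: "subalgebra M (alg I)"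
  using alg_least'[of M I] by (simp add: subalgebra_def)

lemma alg_sets_M: "U \<in> sets (alg I) \<Longrightarrow> U \<in> sets M"
  using subalgebra_alg[of I] by (auto simp: subalgebra_def)

lemma alg_mono: "I \<subseteq> J \<Longrightarrow> sets (alg I) \<subseteq> sets (alg J)"
  by (rule alg_least') (auto simp: space_alg intro: Z_event_alg)

lemma cprob_alg_measurable: "I \<subseteq> J \<Longrightarrow> cprob M (alg I) A \<in> borel_measurable (alg J)"
  by (rule cprob_measurable_upper[OF subalgebra_alg alg_mono]) (simp_all add: space_alg)

lemma alg_eq_sigma_sets:
  assumes "E \<subseteq> sets (alg I)"
    and "\<And>i c. i \<in> I \<Longrightarrow> c \<in> Z i ` space M \<Longrightarrow> Z i -` {c} \<inter> space M \<in> sigma_sets (space M) E"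
  shows "sets (alg I) = sigma_sets (space M) E"
proof
  have "E \<subseteq> Pow (space M)" using assms(1) sets.space_closed[of "alg I"] by auto
  then have sa: "sigma_algebra (space M) (sigma_sets (space M) E)" by (rule sigma_algebra_sigma_sets)
  show "sets (alg I) \<subseteq> sigma_sets (space M) E"
  proof (rule alg_least[OF sa])
    fix i C assume i: "i \<in> I"
    have "Z i -` C \<inter> space M = (\<Union>c\<in>C \<inter> Z i ` space M. Z i -` {c} \<inter> space M)" by auto
    also have "\<dots> \<in> sigma_sets (space M) E"
      by (rule sigma_algebra.countable_UN'[OF sa])
        (use assms(2)[OF i] Z_countable in auto)
    finally show "Z i -` C \<inter> space M \<in> sigma_sets (space M) E" .
  qed
  show "sigma_sets (space M) E \<subseteq> sets (alg I)"
    using sets.sigma_sets_subset[OF assms(1)] by simp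
qed

lemma cprob_alg_Un_eqI:
  assumes A: "A \<in> sets M"
    and g: "g \<in> borel_measurable (alg (I \<union> J))" "AE x in M. 0 \<le> g x \<and> g x \<le> 1"
    and int: "\<And>U V. U \<in> sets (alg I) \<Longrightarrow> V \<in> sets (alg J) \<Longrightarrow>
      (\<integral>x. indicator U x * indicator V x * g x \<partial>M) = measure M (U \<inter> V \<inter> A)"
  shows "AE x in M. cprob M (alg (I \<union> J)) A x = g x"
proof (rule cprob_eqI[OF subalgebra_alg A g, where E = "{U \<inter> V | U V. U \<in> sets (alg I) \<and> V \<in> sets (alg J)}"])
  let ?E = "{U \<inter> V | U V. U \<in> sets (alg I) \<and> V \<in> sets (alg J)}"
  show "sets (alg (I \<union> J)) = sigma_sets (space M) ?E"
  proof (rule alg_eq_sigma_sets)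
    show "?E \<subseteq> sets (alg (I \<union> J))" using alg_mono[of I "I \<union> J"] alg_mono[of J "I \<union> J"] by auto
    fix i c assume "i \<in> I \<union> J"
    moreover have "space M \<in> sets (alg I)" "space M \<in> sets (alg J)"
      using sets.top[of "alg I"] sets.top[of "alg J"] by auto
    ultimately have "Z i -` {c} \<inter> space M \<in> ?E"
      using Z_event_alg[of i I "{c}"] Z_event_alg[of i J "{c}"] by blast
    then show "Z i -` {c} \<inter> space M \<in> sigma_sets (space M) ?E" by (rule sigma_sets.Basic)
  qed
  show "Int_stable ?E"
  proof (rule Int_stableI, safe)
    fix U V U' V'
    assume "U \<in> sets (alg I)" "V \<in> sets (alg J)" "U' \<in> sets (alg I)" "V' \<in> sets (alg J)"
    then have "U \<inter> U' \<in> sets (alg I)" "V \<inter> V' \<in> sets (alg J)" by auto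
    moreover have "U \<inter> V \<inter> (U' \<inter> V') = (U \<inter> U') \<inter> (V \<inter> V')" by blast
    ultimately show "\<exists>U'' V''. U \<inter> V \<inter> (U' \<inter> V') = U'' \<inter> V'' \<and> U'' \<in> sets (alg I) \<and> V'' \<in> sets (alg J)"
      by blast
  qed
  show "?E \<subseteq> Pow (space M)" using sets.sets_into_space by fastforce
  show "space M \<in> ?E" using sets.top[of "alg I"] sets.top[of "alg J"] by auto
  fix W assume "W \<in> ?E"
  then obtain U V where W: "W = U \<inter> V" "U \<in> sets (alg I)" "V \<in> sets (alg J)" by blast
  have "(\<integral>x. indicator W x * g x \<partial>M) = (\<integral>x. indicator U x * indicator V x * g x \<partial>M)"
    by (rule Bochner_Integration.integral_cong) (auto simp: W(1) split: split_indicator)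
  then show "(\<integral>x. indicator W x * g x \<partial>M) = measure M (W \<inter> A)" using int W by simp
qed

text \<open>
  For one additional label \<open>d\<close> the events \<open>Z d = c\<close> are enough, and it is for such events that the
  Markov property is available.
\<close>

lemma cprob_alg_insert_eqI:
  assumes A: "A \<in> sets M"
    and g: "g \<in> borel_measurable (alg (insert d D))" "AE x in M. 0 \<le> g x \<and> g x \<le> 1"
    and int: "\<And>U. U \<in> sets (alg D) \<Longrightarrow> (\<integral>x. indicator U x * g x \<partial>M) = measure M (U \<inter> A)"
    and int': "\<And>U c. U \<in> sets (alg D) \<Longrightarrow> c \<in> Z d ` space M \<Longrightarrow>
      (\<integral>x. indicator U x * indicator (Z d -` {c} \<inter> space M) x * g x \<partial>M) =
      measure M (U \<inter> (Z d -` {c} \<inter> space M) \<inter> A)"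
  shows "AE x in M. cprob M (alg (insert d D)) A x = g x"
proof (rule cprob_eqI[OF subalgebra_alg A g,
      where E = "sets (alg D) \<union> {U \<inter> (Z d -` {c} \<inter> space M) | U c. U \<in> sets (alg D) \<and> c \<in> Z d ` space M}"])
  let ?E = "sets (alg D) \<union> {U \<inter> (Z d -` {c} \<inter> space M) | U c. U \<in> sets (alg D) \<and> c \<in> Z d ` space M}"
  have top: "space M \<in> sets (alg D)" using sets.top[of "alg D"] by simp
  show "sets (alg (insert d D)) = sigma_sets (space M) ?E"
  proof (rule alg_eq_sigma_sets)
    show "?E \<subseteq> sets (alg (insert d D))"
      using alg_mono[of D "insert d D"] Z_event_alg[of d "insert d D"] by auto
    fix i c assume "i \<in> insert d D" and c: "c \<in> Z i ` space M"
    then consider "i = d" | "i \<in> D" by blast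
    then have "Z i -` {c} \<inter> space M \<in> ?E"
    proof cases
      case 1
      then have "Z i -` {c} \<inter> space M = space M \<inter> (Z d -` {c} \<inter> space M)" by auto
      with top c 1 show ?thesis by blast
    qed (use Z_event_alg in auto)
    then show "Z i -` {c} \<inter> space M \<in> sigma_sets (space M) ?E" by (rule sigma_sets.Basic)
  qed
  show "Int_stable ?E"
  proof (rule Int_stableI)
    fix a b assume "a \<in> ?E" "b \<in> ?E"
    then consider "a \<in> sets (alg D)" "b \<in> sets (alg D)"
      | V c where "a \<in> sets (alg D)" "b = V \<inter> (Z d -` {c} \<inter> space M)" "V \<in> sets (alg D)" "c \<in> Z d ` space M"
      | U c where "b \<in> sets (alg D)" "a = U \<inter> (Z d -` {c} \<inter> space M)" "U \<in> sets (alg D)" "c \<in> Z d ` space M"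
      | U V c c' where "a = U \<inter> (Z d -` {c} \<inter> space M)" "b = V \<inter> (Z d -` {c'} \<inter> space M)"
          "U \<in> sets (alg D)" "V \<in> sets (alg D)" "c \<in> Z d ` space M"
      by blast
    then show "a \<inter> b \<in> ?E"
    proof cases
      case 1 then show ?thesis by auto
    next
      case (2 V c)
      then have "a \<inter> b = (a \<inter> V) \<inter> (Z d -` {c} \<inter> space M)" "a \<inter> V \<in> sets (alg D)" by auto
      with 2 show ?thesis by blast
    next
      case (3 V c)
      then have "a \<inter> b = (V \<inter> b) \<inter> (Z d -` {c} \<inter> space M)" "V \<inter> b \<in> sets (alg D)" by auto
      with 3 show ?thesis by blast
    next
      case (4 U V c c')
      show ?thesis
      proof (cases "c = c'")
        case True
        with 4 have "a \<inter> b = (U \<inter> V) \<inter> (Z d -` {c} \<inter> space M)" "U \<inter> V \<in> sets (alg D)" by auto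
        with 4 show ?thesis by blast
      next
        case False
        with 4 have "a \<inter> b = {}" by auto
        then show ?thesis by simp
      qed
    qed
  qed
  show "?E \<subseteq> Pow (space M)" using sets.sets_into_space[of _ "alg D"] by auto
  show "space M \<in> ?E" using top by simp
  fix W assume "W \<in> ?E"
  then show "(\<integral>x. indicator W x * g x \<partial>M) = measure M (W \<inter> A)"
  proof
    assume "W \<in> {U \<inter> (Z d -` {c} \<inter> space M) | U c. U \<in> sets (alg D) \<and> c \<in> Z d ` space M}"
    then obtain U c where W: "W = U \<inter> (Z d -` {c} \<inter> space M)" "U \<in> sets (alg D)" "c \<in> Z d ` space M"
      by blast
    have "(\<integral>x. indicator W x * g x \<partial>M) =
      (\<integral>x. indicator U x * indicator (Z d -` {c} \<inter> space M) x * g x \<partial>M)"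
      by (rule Bochner_Integration.integral_cong) (auto simp: W(1) split: split_indicator)
    then show ?thesis using int' W by simp
  qed (rule int)
qed

text \<open>
  An increasing union of \<open>\<sigma>\<close>-algebras is \<open>\<inter>\<close>-stable, so the candidate \<open>g\<close> may be tested at the finite
  stages.
\<close>

lemma cprob_alg_UN_eqI:
  fixes D :: "nat \<Rightarrow> 'i set"
  assumes A: "A \<in> sets M" and D: "incseq D"
    and g: "g \<in> borel_measurable (alg (\<Union>n. D n))" "AE x in M. 0 \<le> g x \<and> g x \<le> 1"
    and int: "\<And>n U. U \<in> sets (alg (D n)) \<Longrightarrow> (\<integral>x. indicator U x * g x \<partial>M) = measure M (U \<inter> A)"
  shows "AE x in M. cprob M (alg (\<Union>n. D n)) A x = g x"
proof (rule cprob_eqI[OF subalgebra_alg A g, where E = "\<Union>n. sets (alg (D n))"])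
  show "sets (alg (\<Union>n. D n)) = sigma_sets (space M) (\<Union>n. sets (alg (D n)))"
  proof (rule alg_eq_sigma_sets)
    show "(\<Union>n. sets (alg (D n))) \<subseteq> sets (alg (\<Union>n. D n))"
      using alg_mono[of "D _" "\<Union>n. D n"] by blast
    fix i c assume "i \<in> (\<Union>n. D n)"
    then show "Z i -` {c} \<inter> space M \<in> sigma_sets (space M) (\<Union>n. sets (alg (D n)))"
      by (intro sigma_sets.Basic) (auto intro: Z_event_alg)
  qed
  show "Int_stable (\<Union>n. sets (alg (D n)))"
  proof (rule Int_stableI, safe)
    fix U V m n assume "U \<in> sets (alg (D m))" "V \<in> sets (alg (D n))"
    moreover have "sets (alg (D m)) \<subseteq> sets (alg (D (max m n)))" "sets (alg (D n)) \<subseteq> sets (alg (D (max m n)))"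
      by (intro alg_mono incseqD[OF D]; simp)+
    ultimately show "U \<inter> V \<in> (\<Union>n. sets (alg (D n)))" by blast
  qed
  show "(\<Union>n. sets (alg (D n))) \<subseteq> Pow (space M)" using sets.sets_into_space[of _ "alg (D _)"] by auto
  show "space M \<in> (\<Union>n. sets (alg (D n)))" using sets.top[of "alg (D 0)"] by auto
qed (use int in blast)

text \<open>
  Conditional independence of \<open>P\<close> and \<open>D\<close> given \<open>Q\<close>, when \<open>Q \<subseteq> D\<close>, in the asymmetric form that says
  that \<open>D\<close> predicts \<open>P\<close> no better than \<open>Q\<close> does.
\<close>

definition screens :: "'i set \<Rightarrow> 'i set \<Rightarrow> 'i set \<Rightarrow> bool" where
  "screens Q P D \<longleftrightarrow>
     (\<forall>U\<in>sets (alg P). AE x in M. cprob M (alg D) U x = cprob M (alg Q) U x)"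

lemma screensD:
  "screens Q P D \<Longrightarrow> U \<in> sets (alg P) \<Longrightarrow> AE x in M. cprob M (alg D) U x = cprob M (alg Q) U x"
  by (auto simp: screens_def)

lemma AE_unit_mult:
  fixes f g :: "'a \<Rightarrow> real"
  assumes "AE x in M. 0 \<le> f x \<and> f x \<le> 1" "AE x in M. 0 \<le> g x \<and> g x \<le> 1"
  shows "AE x in M. 0 \<le> f x * g x \<and> f x * g x \<le> 1"
  using assms by eventually_elim (auto intro: mult_le_one)

text \<open>
  Conditional independence is symmetric, and it survives when a part \<open>D'\<close> of \<open>D\<close> is moved into the
  condition. In the test integral over \<open>U \<inter> V\<close>, the indicator of \<open>U\<close> is replaced by its prediction from \<open>D\<close>,
  that is, from \<open>Q\<close>. The integrand is then measurable over \<open>Q \<union> D'\<close> apart from the prediction of \<open>A\<close>,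
  which may be replaced by the indicator of \<open>A\<close>. Undoing the first replacement ends the proof.
\<close>

lemma screens_swap:
  assumes S: "screens Q P D" and "Q \<subseteq> D" "Q \<subseteq> P" "D' \<subseteq> D" and A: "A \<in> sets (alg D)"
  shows "AE x in M. cprob M (alg (P \<union> D')) A x = cprob M (alg (Q \<union> D')) A x"
proof (rule cprob_alg_Un_eqI)
  have AM [measurable]: "A \<in> sets M" using alg_sets_M A .
  let ?e = "cprob M (alg (Q \<union> D')) A"
  show "A \<in> sets M" by fact
  show "?e \<in> borel_measurable (alg (P \<union> D'))" by (rule cprob_alg_measurable) (use assms in auto)
  show e: "AE x in M. 0 \<le> ?e x \<and> ?e x \<le> 1" by (rule cprob_unit[OF subalgebra_alg AM])
  fix U V assume U: "U \<in> sets (alg P)" and V: "V \<in> sets (alg D')"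
  have UM [measurable]: "U \<in> sets M" and VM [measurable]: "V \<in> sets M" using alg_sets_M U V by auto
  have VD: "V \<in> sets (alg D)" using V alg_mono[of D' D] assms by auto
  have V': "V \<in> sets (alg (Q \<union> D'))" using V alg_mono[of D' "Q \<union> D'"] by auto
  let ?u = "cprob M (alg Q) U"
  have u: "AE x in M. 0 \<le> ?u x \<and> ?u x \<le> 1" by (rule cprob_unit[OF subalgebra_alg UM])
  have eD: "?e \<in> borel_measurable (alg D)" by (rule cprob_alg_measurable) (use assms in auto)
  have uQ: "?u \<in> borel_measurable (alg (Q \<union> D'))" by (rule cprob_alg_measurable) auto
  have "(\<integral>x. indicator U x * indicator V x * ?e x \<partial>M) = (\<integral>x. (indicator V x * ?e x) * indicator U x \<partial>M)"
    by (simp add: mult_ac)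
  also have "\<dots> = (\<integral>x. (indicator V x * ?e x) * cprob M (alg D) U x \<partial>M)"
    by (rule integral_mult_cprob[OF subalgebra_alg UM, symmetric])
      (use VD eD in \<open>auto simp del: AE_conj_iff intro!: AE_unit_mult AE_unit_indicator e\<close>)
  also have "\<dots> = (\<integral>x. (indicator V x * ?u x) * ?e x \<partial>M)"
    by (rule integral_cong_AE) (use screensD[OF S U] in auto)
  also have "\<dots> = (\<integral>x. (indicator V x * ?u x) * indicator A x \<partial>M)"
    by (rule integral_mult_cprob[OF subalgebra_alg AM])
      (use V' uQ in \<open>auto simp del: AE_conj_iff intro!: AE_unit_mult AE_unit_indicator u\<close>)
  also have "\<dots> = (\<integral>x. (indicator V x * indicator A x) * cprob M (alg D) U x \<partial>M)"
    by (rule integral_cong_AE) (use screensD[OF S U] in auto)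
  also have "\<dots> = (\<integral>x. (indicator V x * indicator A x) * indicator U x \<partial>M)"
    by (rule integral_mult_cprob[OF subalgebra_alg UM])
      (use VD A in \<open>auto intro!: AE_I2 split: split_indicator\<close>)
  also have "\<dots> = (\<integral>x. indicator (U \<inter> V) x * indicator A x \<partial>M)"
    by (rule Bochner_Integration.integral_cong) (auto split: split_indicator)
  also have "\<dots> = measure M (U \<inter> V \<inter> A)"
    by (rule integral_indicator_mult_indicator) auto
  finally show "(\<integral>x. indicator U x * indicator V x * ?e x \<partial>M) = measure M (U \<inter> V \<inter> A)" .
qed

text \<open>
  The contraction rule for conditional independence: \<open>D\<close> is independent of \<open>P\<close> given \<open>Q\<close>, and the new
  label is independent of \<open>P\<close> given \<open>D\<close>.
\<close>

lemma screens_insert: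
  assumes S: "screens Q P D" and "Q \<subseteq> D"
    and new: "\<And>c. c \<in> Z d ` space M \<Longrightarrow> AE x in M. cprob M (alg (P \<union> D)) (Z d -` {c} \<inter> space M) x =
                     cprob M (alg D) (Z d -` {c} \<inter> space M) x"
  shows "screens Q P (insert d D)"
  unfolding screens_def
proof (intro ballI cprob_alg_insert_eqI)
  fix U assume U: "U \<in> sets (alg P)"
  show UM [measurable]: "U \<in> sets M" using alg_sets_M U .
  let ?u = "cprob M (alg Q) U"
  show "?u \<in> borel_measurable (alg (insert d D))" by (rule cprob_alg_measurable) (use assms in auto)
  show u: "AE x in M. 0 \<le> ?u x \<and> ?u x \<le> 1" by (rule cprob_unit[OF subalgebra_alg UM])
  fix V assume V: "V \<in> sets (alg D)"
  have VM [measurable]: "V \<in> sets M" using alg_sets_M V by auto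
  have "(\<integral>x. indicator V x * ?u x \<partial>M) = (\<integral>x. indicator V x * cprob M (alg D) U x \<partial>M)"
    by (rule integral_cong_AE) (use screensD[OF S U] in auto)
  then show "(\<integral>x. indicator V x * ?u x \<partial>M) = measure M (V \<inter> U)"
    using integral_indicator_mult_cprob[OF subalgebra_alg UM V] by simp
  fix c assume c: "c \<in> Z d ` space M"
  let ?A = "Z d -` {c} \<inter> space M"
  let ?a = "cprob M (alg D) ?A"
  have a: "AE x in M. 0 \<le> ?a x \<and> ?a x \<le> 1" by (rule cprob_unit[OF subalgebra_alg Z_event])
  have VPD: "V \<in> sets (alg (P \<union> D))" and UPD: "U \<in> sets (alg (P \<union> D))"
    using V U alg_mono[of D "P \<union> D"] alg_mono[of P "P \<union> D"] by auto
  have uPD: "?u \<in> borel_measurable (alg (P \<union> D))" and aPD: "?a \<in> borel_measurable (alg D)"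
    by (rule cprob_alg_measurable; use assms in auto)+
  have "(\<integral>x. indicator V x * indicator ?A x * ?u x \<partial>M) = (\<integral>x. (indicator V x * ?u x) * indicator ?A x \<partial>M)"
    by (simp add: mult_ac)
  also have "\<dots> = (\<integral>x. (indicator V x * ?u x) * cprob M (alg (P \<union> D)) ?A x \<partial>M)"
    by (rule integral_mult_cprob[OF subalgebra_alg Z_event, symmetric])
      (use VPD uPD in \<open>auto simp del: AE_conj_iff intro!: AE_unit_mult AE_unit_indicator u\<close>)
  also have "\<dots> = (\<integral>x. (indicator V x * ?a x) * cprob M (alg D) U x \<partial>M)"
    by (rule integral_cong_AE) (use screensD[OF S U] new[OF c] in auto)
  also have "\<dots> = (\<integral>x. (indicator V x * ?a x) * indicator U x \<partial>M)"
    by (rule integral_mult_cprob[OF subalgebra_alg UM])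
      (use V aPD in \<open>auto simp del: AE_conj_iff intro!: AE_unit_mult AE_unit_indicator a\<close>)
  also have "\<dots> = (\<integral>x. (indicator V x * indicator U x) * cprob M (alg (P \<union> D)) ?A x \<partial>M)"
    by (rule integral_cong_AE) (use new[OF c] in auto)
  also have "\<dots> = (\<integral>x. (indicator V x * indicator U x) * indicator ?A x \<partial>M)"
    by (rule integral_mult_cprob[OF subalgebra_alg Z_event])
      (use VPD UPD in \<open>auto intro!: AE_I2 split: split_indicator\<close>)
  also have "\<dots> = (\<integral>x. indicator (V \<inter> ?A) x * indicator U x \<partial>M)"
    by (rule Bochner_Integration.integral_cong) (auto split: split_indicator)
  also have "\<dots> = measure M (V \<inter> ?A \<inter> U)"
    by (rule integral_indicator_mult_indicator) auto
  finally show "(\<integral>x. indicator V x * indicator ?A x * ?u x \<partial>M) = measure M (V \<inter> ?A \<inter> U)" .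
qed

lemma screens_UN:
  fixes D :: "nat \<Rightarrow> 'i set"
  assumes S: "\<And>n. screens Q P (D n)" and D: "incseq D" and Q: "Q \<subseteq> D 0"
  shows "screens Q P (\<Union>n. D n)"
  unfolding screens_def
proof (intro ballI cprob_alg_UN_eqI D)
  fix U assume U: "U \<in> sets (alg P)"
  show UM [measurable]: "U \<in> sets M" using alg_sets_M U .
  let ?u = "cprob M (alg Q) U"
  show "?u \<in> borel_measurable (alg (\<Union>n. D n))" by (rule cprob_alg_measurable) (use Q in auto)
  show "AE x in M. 0 \<le> ?u x \<and> ?u x \<le> 1" by (rule cprob_unit[OF subalgebra_alg UM])
  fix n V assume V: "V \<in> sets (alg (D n))"
  then have [measurable]: "V \<in> sets M" using alg_sets_M by auto
  have "(\<integral>x. indicator V x * ?u x \<partial>M) = (\<integral>x. indicator V x * cprob M (alg (D n)) U x \<partial>M)"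
    by (rule integral_cong_AE) (use screensD[OF S[of n] U] in auto)
  then show "(\<integral>x. indicator V x * ?u x \<partial>M) = measure M (V \<inter> U)"
    using integral_indicator_mult_cprob[OF subalgebra_alg UM V] by simp
qed

end

context prob_space
begin

text \<open>
  Information functions \<open>- ln p\<close> are unbounded, so they are integrated as nonnegative extended functions,
  for which the corresponding version of conditional expectation is needed.
\<close>

lemma nn_cond_exp_indicator:
  assumes F: "subalgebra M F" and Y: "Y \<in> sets M"
  shows "AE x in M. nn_cond_exp M F (indicator Y) x = ennreal (cprob M F Y x)"
proof -
  interpret sigma_finite_subalgebra M F by (rule sigma_finite_subalgebraI[OF F])
  have [measurable]: "cprob M F Y \<in> borel_measurable F" by (rule cprob_measurable)
  have u: "AE x in M. 0 \<le> cprob M F Y x \<and> cprob M F Y x \<le> 1" by (rule cprob_unit[OF F Y])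
  show ?thesis
  proof (rule AE_symmetric, rule nn_cond_exp_charact)
    fix U assume U: "U \<in> sets F"
    then have [measurable]: "U \<in> sets M" using F by (auto simp: subalgebra_def)
    have "(\<integral>\<^sup>+x\<in>U. ennreal (cprob M F Y x) \<partial>M) = (\<integral>\<^sup>+x. ennreal (indicator U x * cprob M F Y x) \<partial>M)"
      by (intro nn_integral_cong) (auto split: split_indicator)
    also have "\<dots> = ennreal (\<integral>x. indicator U x * cprob M F Y x \<partial>M)"
    proof (rule nn_integral_eq_integral)
      show "integrable M (\<lambda>x. indicator U x * cprob M F Y x)"
        by (rule integrable_mult_unit) (use u in \<open>auto split: split_indicator\<close>)
      show "AE x in M. 0 \<le> indicator U x * cprob M F Y x" using u by eventually_elim auto
    qed
    also have "\<dots> = ennreal (measure M (U \<inter> Y))" by (simp add: integral_indicator_mult_cprob[OF F Y U])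
    also have "\<dots> = emeasure M (U \<inter> Y)" by (simp add: emeasure_eq_measure)
    also have "\<dots> = (\<integral>\<^sup>+x\<in>U. indicator Y x \<partial>M)"
      using Y by (simp add: indicator_inter_arith[symmetric] mult.commute Int_commute)
    finally show "(\<integral>\<^sup>+x\<in>U. indicator Y x \<partial>M) = (\<integral>\<^sup>+x\<in>U. ennreal (cprob M F Y x) \<partial>M)" by simp
  qed (use Y in auto)
qed

text \<open>
  Jensen's inequality for \<open>\<phi>(p) = - p ln p\<close>, in the form \<open>E \<phi>(p) \<le> \<phi>(E p)\<close>: the graph of \<open>\<phi>\<close> lies
  below its tangent at \<open>m = E p\<close>, which is \<open>- p ln m + m - p\<close> and has expectation \<open>\<phi>(m)\<close>.
\<close>

lemma information_le_entropy_term: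
  assumes F: "subalgebra M F" and Y: "Y \<in> sets M"
  shows "(\<integral>\<^sup>+x. ennreal (- ln (cprob M F Y x)) * indicator Y x \<partial>M)
           \<le> ennreal (- (measure M Y * ln (measure M Y)))"
proof -
  interpret sigma_finite_subalgebra M F by (rule sigma_finite_subalgebraI[OF F])
  define p where "p = cprob M F Y"
  define m where "m = measure M Y"
  have [measurable]: "p \<in> borel_measurable F" unfolding p_def by (rule cprob_measurable)
  have [measurable]: "p \<in> borel_measurable M" unfolding p_def by simp
  have u: "AE x in M. 0 \<le> p x \<and> p x \<le> 1" unfolding p_def by (rule cprob_unit[OF F Y])
  have pint: "integrable M p" by (rule integrable_unit_interval) (use u in auto)
  have top: "space M \<in> sets F" using F sets.top[of F] by (simp add: subalgebra_def)
  have "(\<integral>x. p x \<partial>M) = (\<integral>x. indicator (space M) x * p x \<partial>M)"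
    by (rule Bochner_Integration.integral_cong) auto
  also have "\<dots> = measure M (space M \<inter> Y)"
    unfolding p_def by (rule integral_indicator_mult_cprob[OF F Y top])
  also have "space M \<inter> Y = Y" using sets.sets_into_space[OF Y] by auto
  finally have Ep: "(\<integral>x. p x \<partial>M) = m" by (simp add: m_def)
  have "(\<integral>\<^sup>+x. ennreal (- ln (p x)) * indicator Y x \<partial>M) =
        (\<integral>\<^sup>+x. ennreal (- ln (p x)) * nn_cond_exp M F (indicator Y) x \<partial>M)"
    by (rule nn_cond_exp_intg[symmetric]) (use Y in auto)
  also have "\<dots> = (\<integral>\<^sup>+x. ennreal (- (p x * ln (p x))) \<partial>M)"
  proof (rule nn_integral_cong_AE)
    show "AE x in M. ennreal (- ln (p x)) * nn_cond_exp M F (indicator Y) x = ennreal (- (p x * ln (p x)))"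
      using nn_cond_exp_indicator[OF F Y] u
    proof eventually_elim
      case (elim x)
      then have "ennreal (- ln (p x)) * ennreal (p x) = ennreal (- ln (p x) * p x)"
        by (subst ennreal_mult'') auto
      with elim show ?case by (simp add: p_def mult.commute)
    qed
  qed
  also have "\<dots> \<le> ennreal (- (m * ln m))"
  proof (cases "m = 0")
    case True
    have "AE x in M. p x = 0"
      using integral_nonneg_eq_0_iff_AE[OF pint] u Ep True by auto
    then have "(\<integral>\<^sup>+x. ennreal (- (p x * ln (p x))) \<partial>M) = (\<integral>\<^sup>+x. 0 \<partial>M)"
      by (intro nn_integral_cong_AE) auto
    then show ?thesis by simp
  next
    case False
    then have m: "0 < m" using measure_nonneg[of M Y] by (simp add: m_def less_le)
    have tangent: "- (a * ln a) \<le> - a * ln m + m - a" if a: "0 \<le> a" for a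
    proof (cases "a = 0")
      case True with m show ?thesis by simp
    next
      case False
      with a have a: "0 < a" by simp
      then have "ln (m / a) \<le> m / a - 1" using m by (intro ln_le_minus_one) auto
      then have "a * ln (m / a) \<le> a * (m / a - 1)" using a by (intro mult_left_mono) auto
      with a m show ?thesis by (simp add: ln_div algebra_simps)
    qed
    have tint: "integrable M (\<lambda>x. - p x * ln m + m - p x)" using pint by simp
    have "(\<integral>\<^sup>+x. ennreal (- (p x * ln (p x))) \<partial>M) \<le> (\<integral>\<^sup>+x. ennreal (- p x * ln m + m - p x) \<partial>M)"
      by (rule nn_integral_mono_AE) (use u tangent in \<open>auto intro!: ennreal_leI\<close>)
    also have "\<dots> = ennreal (\<integral>x. - p x * ln m + m - p x \<partial>M)"
    proof (rule nn_integral_eq_integral[OF tint])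
      show "AE x in M. 0 \<le> - p x * ln m + m - p x" using u
      proof eventually_elim
        case (elim x)
        have "0 \<le> - (p x * ln (p x))"
          using elim by (cases "p x = 0") (auto simp: mult_nonneg_nonpos)
        with tangent[of "p x"] elim show ?case by simp
      qed
    qed
    also have "(\<integral>x. - p x * ln m + m - p x \<partial>M) = - (m * ln m)"
      using pint Ep by (simp add: prob_space)
    finally show ?thesis .
  qed
  finally show ?thesis by (simp add: p_def m_def)
qed

end

text \<open>
  Passage from the integral over counting measure, for which sums and integrals can be interchanged,
  to the unordered sum that defines the entropy of a partition.
\<close>

lemma nn_integral_count_space_le_infsum:
  fixes g :: "'b \<Rightarrow> ennreal"
  assumes "countable C"
  shows "(\<integral>\<^sup>+c. g c \<partial>count_space C) \<le> (\<Sum>\<^sub>\<infinity>c\<in>C. g c)"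
proof -
  have fin: "sum g K \<le> (\<Sum>\<^sub>\<infinity>c\<in>C. g c)" if "finite K" "K \<subseteq> C" for K
    by (subst nonneg_infsum_complete) (use that in \<open>auto intro!: SUP_upper\<close>)
  define N where "N = to_nat_on C ` C"
  have bij: "bij_betw (from_nat_into C) N C"
    unfolding N_def by (rule bij_betw_byWitness[where f' = "to_nat_on C"]) (use assms in auto)
  have "(\<integral>\<^sup>+c. g c \<partial>count_space C) = (\<integral>\<^sup>+n. g (from_nat_into C n) \<partial>count_space N)"
    by (rule nn_integral_bij_count_space[OF bij, symmetric])
  also have "\<dots> = (\<integral>\<^sup>+n. g (from_nat_into C n) * indicator N n \<partial>count_space UNIV)"
    by (subst nn_integral_count_space_indicator) auto
  also have "\<dots> = (\<Sum>n. g (from_nat_into C n) * indicator N n)" by (rule nn_integral_count_space_nat)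
  also have "\<dots> \<le> (\<Sum>\<^sub>\<infinity>c\<in>C. g c)"
  proof (rule suminf_le_const)
    fix n
    have "(\<Sum>i<n. g (from_nat_into C i) * indicator N i) = (\<Sum>i\<in>{..<n} \<inter> N. g (from_nat_into C i))"
      by (simp add: sum.inter_restrict indicator_def if_distrib cong: if_cong)
    also have "\<dots> = sum g (from_nat_into C ` ({..<n} \<inter> N))"
      by (rule sum.reindex_cong[symmetric, OF _ refl refl])
        (use bij in \<open>auto simp: bij_betw_def intro: inj_on_subset\<close>)
    also have "\<dots> \<le> (\<Sum>\<^sub>\<infinity>c\<in>C. g c)" by (rule fin) (use bij in \<open>auto simp: bij_betw_def\<close>)
    finally show "(\<Sum>i<n. g (from_nat_into C i) * indicator N i) \<le> (\<Sum>\<^sub>\<infinity>c\<in>C. g c)" .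
  qed auto
  finally show ?thesis .
qed

context label_family
begin

definition fibre :: "'i set \<Rightarrow> 'a \<Rightarrow> 'a set" where
  "fibre B x = {y \<in> space M. \<forall>i\<in>B. Z i y = Z i x}"

text \<open>The conditional entropy \<open>H(\<Or>\<^bsub>i\<in>B\<^esub> Z\<^sub>i | Z\<^sub>j, j \<in> I)\<close>.\<close>

definition label_entropy :: "'i set \<Rightarrow> 'i set \<Rightarrow> ennreal" where
  "label_entropy B I = (\<integral>\<^sup>+x. ennreal (- ln (cprob M (alg I) (fibre B x) x)) \<partial>M)"

lemma fibre_alg:
  assumes "finite B"
  shows "fibre B x \<in> sets (alg B)"
proof (cases "B = {}")
  case True
  then have "fibre B x = space (alg B)" by (simp add: fibre_def)
  then show ?thesis using sets.top[of "alg B"] by simp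
next
  case False
  then have "fibre B x = (\<Inter>i\<in>B. Z i -` {Z i x} \<inter> space M)" by (auto simp: fibre_def)
  moreover have "(\<Inter>i\<in>B. Z i -` {Z i x} \<inter> space M) \<in> sets (alg B)"
    by (rule sets.finite_INT[OF assms False]) (rule Z_event_alg)
  ultimately show ?thesis by simp
qed

lemma fibre_event [measurable]: "finite B \<Longrightarrow> fibre B x \<in> sets M"
  using fibre_alg alg_sets_M by blast

lemma fibre_cong: "y \<in> fibre B x \<Longrightarrow> B' \<subseteq> B \<Longrightarrow> fibre B' y = fibre B' x"
  by (auto simp: fibre_def subset_iff)

lemma mem_fibre_self: "x \<in> space M \<Longrightarrow> x \<in> fibre B x"
  by (simp add: fibre_def)

lemma countable_fibre:
  assumes "finite B"
  shows "countable (fibre B ` space M)"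
proof -
  let ?r = "\<lambda>x. restrict (\<lambda>i. Z i x) B"
  have "?r ` space M \<subseteq> (\<Pi>\<^sub>E i\<in>B. Z i ` space M)" by auto
  moreover have "countable (\<Pi>\<^sub>E i\<in>B. Z i ` space M)" using assms Z_countable by (intro countable_PiE)
  ultimately have "countable (?r ` space M)" by (rule countable_subset)
  moreover have "fibre B ` space M = (\<lambda>f. {y \<in> space M. \<forall>i\<in>B. Z i y = f i}) ` ?r ` space M"
    unfolding image_image by (rule image_cong) (auto simp: fibre_def)
  ultimately show ?thesis by simp
qed

text \<open>
  There are only countably many fibres, so exceptional null sets that depend on the fibre can be
  discarded simultaneously; \<open>x0\<close> represents the fibre of \<open>x\<close>.
\<close>

lemma AE_fibre_rep:
  assumes B: "finite B" and P: "\<And>x0. x0 \<in> space M \<Longrightarrow> AE x in M. P x0 x"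
  shows "AE x in M. \<exists>x0\<in>space M. x \<in> fibre B x0 \<and> P x0 x"
proof -
  define rep where "rep Y = (SOME x0. x0 \<in> space M \<and> Y = fibre B x0)" for Y
  have rep: "rep Y \<in> space M \<and> Y = fibre B (rep Y)" if "Y \<in> fibre B ` space M" for Y
    unfolding rep_def by (rule someI_ex) (use that in auto)
  have "AE x in M. \<forall>Y\<in>fibre B ` space M. P (rep Y) x"
    by (rule AE_ball_countable[THEN iffD2, OF countable_fibre[OF B]]) (use rep P in blast)
  then show ?thesis using AE_space
  proof eventually_elim
    case (elim x)
    let ?Y = "fibre B x"
    have Y: "?Y \<in> fibre B ` space M" using elim by auto
    from rep[OF Y] have r: "rep ?Y \<in> space M" "?Y = fibre B (rep ?Y)" by auto
    have "x \<in> fibre B (rep ?Y)" using mem_fibre_self[of x B] elim r(2) by simp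
    with r(1) elim Y show ?case by blast
  qed
qed

lemma fibre_measurable:
  assumes B: "finite B"
  shows "(\<lambda>x. cprob M F (fibre B x) x) \<in> borel_measurable M"
proof (rule measurable_compose_countable'[where I = "fibre B ` space M" and f = "\<lambda>Y x. cprob M F Y x"])
  show "countable (fibre B ` space M)" by (rule countable_fibre[OF B])
  show "fibre B \<in> measurable M (count_space (fibre B ` space M))"
  proof (rule measurable_count_space_eq_countable[THEN iffD2, OF countable_fibre[OF B]], intro conjI ballI)
    fix Y assume "Y \<in> fibre B ` space M"
    then obtain x0 where x0: "x0 \<in> space M" "Y = fibre B x0" by auto
    have "fibre B -` {Y} \<inter> space M = fibre B x0"
      unfolding x0 using mem_fibre_self fibre_cong[of _ B x0 B] by (auto simp: fibre_def)
    then show "fibre B -` {Y} \<inter> space M \<in> sets M" using fibre_event[OF B] by simp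
  qed auto
qed (simp add: borel_measurable_cond_exp2)

lemma label_entropy_cong_cprob:
  assumes B: "finite B"
    and eq: "\<And>x0. x0 \<in> space M \<Longrightarrow> AE x in M. cprob M F (fibre B x0) x = cprob M F' (fibre B x0) x"
  shows "(\<integral>\<^sup>+x. ennreal (- ln (cprob M F (fibre B x) x)) \<partial>M) =
         (\<integral>\<^sup>+x. ennreal (- ln (cprob M F' (fibre B x) x)) \<partial>M)"
proof (rule nn_integral_cong_AE)
  have "AE x in M. \<exists>x0\<in>space M. x \<in> fibre B x0 \<and> cprob M F (fibre B x0) x = cprob M F' (fibre B x0) x"
    by (rule AE_fibre_rep[OF B]) (rule eq)
  then show "AE x in M. ennreal (- ln (cprob M F (fibre B x) x)) = ennreal (- ln (cprob M F' (fibre B x) x))"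
    by eventually_elim (metis fibre_cong order_refl)
qed

text \<open>On a fibre the labels in \<open>B\<close> are constant, so they do not enlarge the trace of the \<open>\<sigma>\<close>-algebra.\<close>

lemma alg_trace_fibre:
  assumes U: "U \<in> sets (alg (I \<union> B))"
  shows "\<exists>V\<in>sets (alg I). U \<inter> fibre B x0 = V \<inter> fibre B x0"
proof -
  let ?Y = "fibre B x0"
  let ?S = "{U. U \<subseteq> space M \<and> (\<exists>V\<in>sets (alg I). U \<inter> ?Y = V \<inter> ?Y)}"
  have "sigma_algebra (space M) ?S"
  proof (rule sigma_algebra_iff2[THEN iffD2], safe)
    show "\<exists>V\<in>sets (alg I). {} \<inter> ?Y = V \<inter> ?Y" by (rule bexI[of _ "{}"]) auto
    show "\<exists>V\<in>sets (alg I). (space M - U) \<inter> ?Y = V \<inter> ?Y" if "V \<in> sets (alg I)" "U \<inter> ?Y = V \<inter> ?Y" for U V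
      using that sets.compl_sets[OF that(1)] by (intro bexI[of _ "space M - V"]) auto
    fix U :: "nat \<Rightarrow> 'a set" assume "range U \<subseteq> ?S"
    then have "\<forall>i. \<exists>V. V \<in> sets (alg I) \<and> U i \<inter> ?Y = V \<inter> ?Y" "\<And>i. U i \<subseteq> space M" by blast+
    then obtain V where V: "\<And>i. V i \<in> sets (alg I)" "\<And>i. U i \<inter> ?Y = V i \<inter> ?Y" by metis
    have "(\<Union>i. V i) \<in> sets (alg I)" using V(1) by auto
    moreover have "(\<Union>i. U i) \<inter> ?Y = (\<Union>i. V i) \<inter> ?Y" using V(2) by blast
    ultimately show "\<exists>V\<in>sets (alg I). (\<Union>i. U i) \<inter> ?Y = V \<inter> ?Y" by blast
    show "x \<in> space M" if "x \<in> U i" for x i using that \<open>\<And>i. U i \<subseteq> space M\<close> by blast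
  qed auto
  then have "sets (alg (I \<union> B)) \<subseteq> ?S"
  proof (rule alg_least)
    fix i C assume i: "i \<in> I \<union> B"
    show "Z i -` C \<inter> space M \<in> ?S"
    proof (cases "i \<in> I")
      case True then show ?thesis using Z_event_alg[OF True, of C] by auto
    next
      case False
      with i have iB: "i \<in> B" by auto
      show ?thesis
      proof (cases "Z i x0 \<in> C")
        case True
        with iB have "(Z i -` C \<inter> space M) \<inter> ?Y = space M \<inter> ?Y" by (auto simp: fibre_def)
        then show ?thesis using sets.top[of "alg I"] by auto
      next
        case False
        with iB have "(Z i -` C \<inter> space M) \<inter> ?Y = {} \<inter> ?Y" by (auto simp: fibre_def)
        then show ?thesis using sets.empty_sets[of "alg I"] by blast
      qed
    qed
  qed
  with U show ?thesis by blast
qed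

text \<open>
  The chain rule holds pointwise for information functions: apply \<open>- ln\<close> to the quotient formula
  \<open>cprob_on_atom\<close> on the fibres of \<open>B\<close>.
\<close>

lemma label_entropy_chain:
  assumes B: "finite B"
  shows "label_entropy (insert v B) I = label_entropy B I + label_entropy {v} (I \<union> B)"
proof -
  let ?q = "\<lambda>x. cprob M (alg I) (fibre (insert v B) x) x"
  let ?p = "\<lambda>x. cprob M (alg I) (fibre B x) x"
  let ?t = "\<lambda>x. cprob M (alg (I \<union> B)) (fibre {v} x) x"
  have fin: "finite (insert v B)" using B by simp
  have [measurable]: "?p \<in> borel_measurable M" "?t \<in> borel_measurable M"
    by (rule fibre_measurable; use B in simp)+
  have split: "fibre (insert v B) x0 = fibre B x0 \<inter> fibre {v} x0" for x0 by (auto simp: fibre_def)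
  let ?P = "\<lambda>x0 x. (x \<in> fibre B x0 \<longrightarrow>
        cprob M (alg (I \<union> B)) (fibre {v} x0) x * cprob M (alg I) (fibre B x0) x =
        cprob M (alg I) (fibre (insert v B) x0) x \<and> 0 < cprob M (alg I) (fibre B x0) x) \<and>
      (x \<in> fibre (insert v B) x0 \<longrightarrow> 0 < cprob M (alg I) (fibre (insert v B) x0) x) \<and>
      cprob M (alg (I \<union> B)) (fibre {v} x0) x \<le> 1 \<and> cprob M (alg I) (fibre B x0) x \<le> 1"
  have loc: "AE x in M. ?P x0 x" for x0
  proof -
    have "AE x in M. x \<in> fibre B x0 \<longrightarrow>
        cprob M (alg (I \<union> B)) (fibre {v} x0) x * cprob M (alg I) (fibre B x0) x =
        cprob M (alg I) (fibre (insert v B) x0) x"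
      unfolding split
    proof (rule cprob_on_atom[OF subalgebra_alg subalgebra_alg])
      show "fibre B x0 \<in> sets (alg (I \<union> B))" using fibre_alg[OF B, of x0] alg_mono[of B "I \<union> B"] by auto
    qed (auto intro: alg_trace_fibre alg_mono[THEN subsetD])
    moreover have "AE x in M. x \<in> fibre B x0 \<longrightarrow> 0 < cprob M (alg I) (fibre B x0) x"
      using B by (intro cprob_pos[OF subalgebra_alg]) auto
    moreover have "AE x in M. x \<in> fibre (insert v B) x0 \<longrightarrow> 0 < cprob M (alg I) (fibre (insert v B) x0) x"
      using B by (intro cprob_pos[OF subalgebra_alg]) auto
    moreover have "AE x in M. 0 \<le> cprob M (alg (I \<union> B)) (fibre {v} x0) x \<and> cprob M (alg (I \<union> B)) (fibre {v} x0) x \<le> 1"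
      by (intro cprob_unit[OF subalgebra_alg]) auto
    moreover have "AE x in M. 0 \<le> cprob M (alg I) (fibre B x0) x \<and> cprob M (alg I) (fibre B x0) x \<le> 1"
      using B by (intro cprob_unit[OF subalgebra_alg]) auto
    ultimately show ?thesis by eventually_elim auto
  qed
  have pt: "AE x in M. ennreal (- ln (?q x)) = ennreal (- ln (?p x)) + ennreal (- ln (?t x))"
    using AE_fibre_rep[OF fin, where P = ?P, OF loc]
  proof eventually_elim
    case (elim x)
    then obtain x0 where x0: "x \<in> fibre (insert v B) x0"
      and l: "cprob M (alg (I \<union> B)) (fibre {v} x0) x * cprob M (alg I) (fibre B x0) x =
        cprob M (alg I) (fibre (insert v B) x0) x" "0 < cprob M (alg I) (fibre B x0) x"
        "0 < cprob M (alg I) (fibre (insert v B) x0) x"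
        "cprob M (alg (I \<union> B)) (fibre {v} x0) x \<le> 1" "cprob M (alg I) (fibre B x0) x \<le> 1"
      unfolding split by auto
    have same: "fibre B x = fibre B x0" "fibre {v} x = fibre {v} x0" "fibre (insert v B) x = fibre (insert v B) x0"
      by (rule fibre_cong[OF x0]; auto)+
    have tp: "?t x * ?p x = ?q x" "0 < ?p x" "0 < ?q x" "?t x \<le> 1" "?p x \<le> 1" using l same by simp_all
    then have t: "0 < ?t x" by (metis zero_less_mult_pos2)
    have "- ln (?q x) = - ln (?p x) + - ln (?t x)"
      using tp t by (subst tp(1)[symmetric], subst ln_mult) auto
    moreover have "0 \<le> - ln (?p x)" "0 \<le> - ln (?t x)" using tp t by auto
    ultimately show ?case by (simp only: ennreal_plus)
  qed
  have "label_entropy (insert v B) I = (\<integral>\<^sup>+x. ennreal (- ln (?p x)) + ennreal (- ln (?t x)) \<partial>M)"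
    unfolding label_entropy_def by (rule nn_integral_cong_AE[OF pt])
  also have "\<dots> = label_entropy B I + label_entropy {v} (I \<union> B)"
    unfolding label_entropy_def by (rule nn_integral_add) auto
  finally show ?thesis .
qed

lemma label_entropy_singleton_le_entropy:
  assumes C: "countable C" "Z i ` space M \<subseteq> C"
  shows "label_entropy {i} I \<le> (\<Sum>\<^sub>\<infinity>c\<in>C. ennreal (- (measure M (Z i -` {c} \<inter> space M) * ln (measure M (Z i -` {c} \<inter> space M)))))"
proof -
  let ?Y = "\<lambda>c. Z i -` {c} \<inter> space M"
  have "label_entropy {i} I = (\<integral>\<^sup>+x. (\<integral>\<^sup>+c. ennreal (- ln (cprob M (alg I) (?Y c) x)) * indicator (?Y c) x \<partial>count_space C) \<partial>M)"
    unfolding label_entropy_def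
  proof (rule nn_integral_cong)
    fix x assume x: "x \<in> space M"
    have f: "fibre {i} x = ?Y (Z i x)" by (auto simp: fibre_def)
    have "(\<integral>\<^sup>+c. ennreal (- ln (cprob M (alg I) (?Y c) x)) * indicator (?Y c) x \<partial>count_space C) =
      (\<integral>\<^sup>+c. ennreal (- ln (cprob M (alg I) (?Y (Z i x)) x)) * indicator {Z i x} c \<partial>count_space C)"
      by (rule nn_integral_cong) (use x in \<open>auto split: split_indicator\<close>)
    also have "\<dots> = ennreal (- ln (cprob M (alg I) (?Y (Z i x)) x))"
      using C(2) x by (subst nn_integral_cmult_indicator) auto
    finally show "ennreal (- ln (cprob M (alg I) (fibre {i} x) x)) =
      (\<integral>\<^sup>+c. ennreal (- ln (cprob M (alg I) (?Y c) x)) * indicator (?Y c) x \<partial>count_space C)"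
      using f by simp
  qed
  also have "\<dots> = (\<integral>\<^sup>+c. (\<integral>\<^sup>+x. ennreal (- ln (cprob M (alg I) (?Y c) x)) * indicator (?Y c) x \<partial>M) \<partial>count_space C)"
    by (rule nn_integral_count_space_nn_integral) (use C in auto)
  also have "\<dots> \<le> (\<integral>\<^sup>+c. ennreal (- (measure M (?Y c) * ln (measure M (?Y c)))) \<partial>count_space C)"
    by (intro nn_integral_mono information_le_entropy_term[OF subalgebra_alg]) auto
  also have "\<dots> \<le> (\<Sum>\<^sub>\<infinity>c\<in>C. ennreal (- (measure M (?Y c) * ln (measure M (?Y c)))))"
    by (rule nn_integral_count_space_le_infsum[OF C(1)])
  finally show ?thesis .
qed

text \<open>
  If \<open>\<sigma>\<close> describes on the indices what precomposition with \<open>t\<close> does to the labels, then the preimages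
  under \<open>t\<close> of the events of \<open>I\<close> form the \<open>\<sigma>\<close>-algebra of \<open>\<sigma> ` I\<close>, and conditional probabilities
  follow because \<open>t\<close> preserves the measure.
\<close>

lemma cprob_shift:
  assumes t: "t \<in> measurable M M" and mp: "distr M M t = M"
    and \<sigma>: "\<And>i x. i \<in> I \<Longrightarrow> x \<in> space M \<Longrightarrow> Z (\<sigma> i) x = Z i (t x)"
    and Y: "Y \<in> sets M"
  shows "AE x in M. cprob M (alg (\<sigma> ` I)) (t -` Y \<inter> space M) x = cprob M (alg I) Y (t x)"
proof -
  have vim: "Z (\<sigma> i) -` C \<inter> space M = t -` (Z i -` C \<inter> space M) \<inter> space M" if "i \<in> I" for i C
    using \<sigma>[OF that] measurable_space[OF t] by auto
  have t': "t \<in> measurable (alg (\<sigma> ` I)) (alg I)"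
    unfolding alg_def[of I]
  proof (rule measurable_measure_of)
    fix A assume "A \<in> {Z i -` C \<inter> space M | i C. i \<in> I}"
    then obtain i C where i: "i \<in> I" "A = Z i -` C \<inter> space M" by blast
    show "t -` A \<inter> space (alg (\<sigma> ` I)) \<in> sets (alg (\<sigma> ` I))"
      using Z_event_alg[of "\<sigma> i" "\<sigma> ` I" C] i vim[OF i(1), of C] by simp
  qed (use measurable_space[OF t] in auto)
  have tY: "t -` Y \<inter> space M \<in> sets M" by (rule measurable_sets[OF t Y])
  have meas_eq: "measure M (t -` A \<inter> space M) = measure M A" if "A \<in> sets M" for A
    using measure_distr[OF t that] mp by simp
  show ?thesis
  proof (rule cprob_eqI[OF subalgebra_alg tY, where E = "{t -` U \<inter> space M | U. U \<in> sets (alg I)}"])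
    let ?E = "{t -` U \<inter> space M | U. U \<in> sets (alg I)}"
    show "(\<lambda>x. cprob M (alg I) Y (t x)) \<in> borel_measurable (alg (\<sigma> ` I))"
      using measurable_compose[OF t' cprob_measurable] .
    have "AE x in distr M M t. 0 \<le> cprob M (alg I) Y x \<and> cprob M (alg I) Y x \<le> 1"
      unfolding mp by (rule cprob_unit[OF subalgebra_alg Y])
    then show "AE x in M. 0 \<le> cprob M (alg I) Y (t x) \<and> cprob M (alg I) Y (t x) \<le> 1"
      by (rule AE_distrD[OF t])
    show "sets (alg (\<sigma> ` I)) = sigma_sets (space M) ?E"
    proof (rule alg_eq_sigma_sets)
      show "?E \<subseteq> sets (alg (\<sigma> ` I))" using measurable_sets[OF t'] by auto
      fix j c assume "j \<in> \<sigma> ` I"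
      then obtain i where i: "i \<in> I" "j = \<sigma> i" by auto
      show "Z j -` {c} \<inter> space M \<in> sigma_sets (space M) ?E"
        unfolding i(2) vim[OF i(1)] by (rule sigma_sets.Basic) (use Z_event_alg[OF i(1)] in blast)
    qed
    show "Int_stable ?E"
    proof (rule Int_stableI, safe)
      fix U V assume "U \<in> sets (alg I)" "V \<in> sets (alg I)"
      then show "\<exists>W. t -` U \<inter> space M \<inter> (t -` V \<inter> space M) = t -` W \<inter> space M \<and> W \<in> sets (alg I)"
        by (intro exI[of _ "U \<inter> V"]) auto
    qed
    show "?E \<subseteq> Pow (space M)" by auto
    show "space M \<in> ?E" using sets.top[of "alg I"] measurable_space[OF t] by (auto intro!: exI[of _ "space M"])
    fix W assume "W \<in> ?E"
    then obtain U where U: "U \<in> sets (alg I)" "W = t -` U \<inter> space M" by blast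
    have UM [measurable]: "U \<in> sets M" using alg_sets_M U(1) .
    have "(\<integral>x. indicator W x * cprob M (alg I) Y (t x) \<partial>M) = (\<integral>x. indicator U (t x) * cprob M (alg I) Y (t x) \<partial>M)"
      by (rule Bochner_Integration.integral_cong) (auto simp: U(2) split: split_indicator)
    also have "\<dots> = (\<integral>x. indicator U x * cprob M (alg I) Y x \<partial>distr M M t)"
      by (rule integral_distr[symmetric, OF t]) auto
    also have "\<dots> = measure M (U \<inter> Y)"
      unfolding mp by (rule integral_indicator_mult_cprob[OF subalgebra_alg Y U(1)])
    also have "\<dots> = measure M (t -` (U \<inter> Y) \<inter> space M)" using meas_eq[of "U \<inter> Y"] Y by simp
    also have "t -` (U \<inter> Y) \<inter> space M = W \<inter> (t -` Y \<inter> space M)" using U(2) by auto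
    finally show "(\<integral>x. indicator W x * cprob M (alg I) Y (t x) \<partial>M) = measure M (W \<inter> (t -` Y \<inter> space M))" .
  qed
qed

lemma label_entropy_shift:
  assumes t: "t \<in> measurable M M" and mp: "distr M M t = M" and B: "finite B"
    and \<sigma>: "\<And>i x. i \<in> I \<union> B \<Longrightarrow> x \<in> space M \<Longrightarrow> Z (\<sigma> i) x = Z i (t x)"
  shows "label_entropy (\<sigma> ` B) (\<sigma> ` I) = label_entropy B I"
proof -
  have fibt: "fibre (\<sigma> ` B) x = t -` fibre B (t x) \<inter> space M" if "x \<in> space M" for x
    using \<sigma> that measurable_space[OF t] by (auto simp: fibre_def)
  have fibre_meas: "(\<lambda>x. cprob M (alg I) (fibre B x) x) \<in> borel_measurable M" by (rule fibre_measurable[OF B])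
  have AE1: "AE x in M. \<exists>x0\<in>space M. x \<in> fibre (\<sigma> ` B) x0 \<and>
      cprob M (alg (\<sigma> ` I)) (fibre (\<sigma> ` B) x0) x = cprob M (alg I) (fibre B (t x0)) (t x)"
  proof (rule AE_fibre_rep[where P = "\<lambda>x0 x.
      cprob M (alg (\<sigma> ` I)) (fibre (\<sigma> ` B) x0) x = cprob M (alg I) (fibre B (t x0)) (t x)"])
    show "finite (\<sigma> ` B)" using B by simp
    fix x0 assume x0: "x0 \<in> space M"
    show "AE x in M. cprob M (alg (\<sigma> ` I)) (fibre (\<sigma> ` B) x0) x = cprob M (alg I) (fibre B (t x0)) (t x)"
      unfolding fibt[OF x0] by (rule cprob_shift[OF t mp _ fibre_event[OF B]]) (use \<sigma> in auto)
  qed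
  have "label_entropy (\<sigma> ` B) (\<sigma> ` I) = (\<integral>\<^sup>+x. ennreal (- ln (cprob M (alg I) (fibre B (t x)) (t x))) \<partial>M)"
    unfolding label_entropy_def
  proof (rule nn_integral_cong_AE)
    show "AE x in M. ennreal (- ln (cprob M (alg (\<sigma> ` I)) (fibre (\<sigma> ` B) x) x)) =
        ennreal (- ln (cprob M (alg I) (fibre B (t x)) (t x)))"
      using AE1 AE_space
    proof eventually_elim
      case (elim x)
      then obtain x0 where x0: "x0 \<in> space M" "x \<in> fibre (\<sigma> ` B) x0"
        "cprob M (alg (\<sigma> ` I)) (fibre (\<sigma> ` B) x0) x = cprob M (alg I) (fibre B (t x0)) (t x)" by blast
      have "fibre (\<sigma> ` B) x = fibre (\<sigma> ` B) x0" using fibre_cong[OF x0(2)] by simp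
      moreover have "fibre B (t x) = fibre B (t x0)"
        using x0(2) fibre_cong[of "t x" B "t x0" B] unfolding fibt[OF x0(1)] by simp
      ultimately show ?case using x0(3) by simp
    qed
  qed
  also have "\<dots> = (\<integral>\<^sup>+x. ennreal (- ln (cprob M (alg I) (fibre B x) x)) \<partial>distr M M t)"
    by (rule nn_integral_distr[symmetric, OF t]) (use fibre_meas in measurable)
  also have "\<dots> = label_entropy B I" by (simp add: mp label_entropy_def)
  finally show ?thesis .
qed

end

section \<open>Reduced words and the tree of a free group or semigroup\<close>

definition inv_letter :: "nat \<times> bool \<Rightarrow> nat \<times> bool" where
  "inv_letter l = (fst l, \<not> snd l)"

lemma inv_letter_inv_letter [simp]: "inv_letter (inv_letter l) = l"
  by (simp add: inv_letter_def)

lemma reduced_word_iff: "reduced_word w \<longleftrightarrow> successively (\<lambda>l l'. l' \<noteq> inv_letter l) w"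
proof -
  have "(\<lambda>k l. \<not> (fst k = fst l \<and> snd k \<noteq> snd l)) = (\<lambda>l l'. l' \<noteq> inv_letter l)"
    by (auto simp: inv_letter_def fun_eq_iff prod_eq_iff)
  then show ?thesis by (simp only: reduced_word_def)
qed

text \<open>
  A semigroup has positive letters only. Over this alphabet every word is reduced, so words over
  \<open>alphabet k r\<close> that are reduced describe the elements of \<open>G\<close> in both cases.
\<close>

definition alphabet :: "free_kind \<Rightarrow> nat \<Rightarrow> (nat \<times> bool) set" where
  "alphabet k r = {1..r} \<times> (case k of Free_Group \<Rightarrow> UNIV | Free_Semigroup \<Rightarrow> {True})"

definition words :: "free_kind \<Rightarrow> nat \<Rightarrow> (nat \<times> bool) list set" where
  "words k r = {w \<in> lists (alphabet k r). reduced_word w}"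

lemma Nil_words [simp]: "[] \<in> words k r"
  by (simp add: words_def reduced_word_def)

lemma Cons_words:
  "l # w \<in> words k r \<longleftrightarrow> l \<in> alphabet k r \<and> w \<in> words k r \<and> (w \<noteq> [] \<longrightarrow> hd w \<noteq> inv_letter l)"
  by (cases w) (auto simp: words_def reduced_word_iff)

lemma append_words:
  "u @ w \<in> words k r \<longleftrightarrow>
     u \<in> words k r \<and> w \<in> words k r \<and> (u \<noteq> [] \<and> w \<noteq> [] \<longrightarrow> hd w \<noteq> inv_letter (last u))"
  by (auto simp: words_def reduced_word_iff successively_append_iff)

lemma snoc_words:
  "u @ [l] \<in> words k r \<longleftrightarrow> u \<in> words k r \<and> l \<in> alphabet k r \<and> (u \<noteq> [] \<longrightarrow> l \<noteq> inv_letter (last u))"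
  by (auto simp: append_words Cons_words)

lemma tl_words: "w \<in> words k r \<Longrightarrow> tl w \<in> words k r"
  by (cases w) (auto simp: Cons_words)

lemma words_alphabet: "w \<in> words k r \<Longrightarrow> l \<in> set w \<Longrightarrow> l \<in> alphabet k r"
  by (auto simp: words_def)

lemma pos_letter_alphabet [simp]: "(j, True) \<in> alphabet k r \<longleftrightarrow> j \<in> {1..r}"
  by (auto simp: alphabet_def split: free_kind.splits)

lemma fst_alphabet: "l \<in> alphabet k r \<Longrightarrow> fst l \<in> {1..r}"
  by (auto simp: alphabet_def)

lemma finite_words_le: "finite {w \<in> words k r. length w \<le> n}"
proof (rule finite_subset)
  show "{w \<in> words k r. length w \<le> n} \<subseteq> {w. set w \<subseteq> alphabet k r \<and> length w \<le> n}"
    by (auto simp: words_def)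
  show "finite {w. set w \<subseteq> alphabet k r \<and> length w \<le> n}"
    by (rule finite_lists_length_le) (auto simp: alphabet_def split: free_kind.splits)
qed

lemma replicate_words:
  assumes "j \<in> {1..r}" shows "replicate m (j, True) \<in> words k r"
  using assms by (induction m) (auto simp: Cons_words inv_letter_def hd_replicate)

lemma append_replicate_words:
  assumes "v \<in> words k r" "v \<noteq> []" "last v = (j, True)"
  shows "v @ replicate m (j, True) \<in> words k r"
proof -
  have "(j, True) \<in> alphabet k r" using words_alphabet[OF assms(1), of "last v"] last_in_set[OF assms(2)] assms(3) by simp
  then show ?thesis
    using assms replicate_words[of j r m k] by (cases m) (auto simp: append_words inv_letter_def)
qed

locale free_generators =
  fixes k :: free_kind and G :: "('g, 'b) monoid_scheme" and r :: nat and s :: "nat \<Rightarrow> 'g"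
  assumes free: "is_free k G r s"
begin

abbreviation "W \<equiv> words k r"
abbreviation "\<Lambda> \<equiv> alphabet k r"
abbreviation "lv \<equiv> letter_val G s"

definition val :: "(nat \<times> bool) list \<Rightarrow> 'g" where
  "val w = word_prod G (map lv w)"

lemma monoid_G: "monoid G"
  using free by (cases k) (auto simp: is_free_group_def is_free_semigroup_def group.is_monoid)

sublocale monoid G by (rule monoid_G)

lemma group_G: "k = Free_Group \<Longrightarrow> group G"
  using free by (simp add: is_free_group_def)

lemma gen_closed: "j \<in> {1..r} \<Longrightarrow> s j \<in> carrier G"
  using free by (cases k) (auto simp: is_free_group_def is_free_semigroup_def)

lemma lv_True [simp]: "lv (j, True) = s j"
  by (simp add: letter_val_def)

lemma lv_closed: "l \<in> \<Lambda> \<Longrightarrow> lv l \<in> carrier G"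
proof (cases k)
  case Free_Group
  assume "l \<in> \<Lambda>"
  then show ?thesis
    using gen_closed group.inv_closed[OF group_G[OF Free_Group]] by (auto simp: letter_val_def alphabet_def)
next
  case Free_Semigroup
  assume "l \<in> \<Lambda>"
  then show ?thesis using gen_closed Free_Semigroup by (auto simp: letter_val_def alphabet_def)
qed

lemma lv_image: "lv ` \<Lambda> = letters k G r s"
proof
  show "lv ` \<Lambda> \<subseteq> letters k G r s"
    by (cases k) (auto simp: letter_val_def alphabet_def)
  show "letters k G r s \<subseteq> lv ` \<Lambda>"
  proof (cases k)
    case Free_Group
    have "s i \<in> lv ` \<Lambda>" "inv\<^bsub>G\<^esub> (s i) \<in> lv ` \<Lambda>" if "i \<in> {1..r}" for i
      using that by (auto simp: alphabet_def letter_val_def Free_Group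
          intro: image_eqI[of _ _ "(i, True)"] image_eqI[of _ _ "(i, False)"])
    then show ?thesis by (auto simp: Free_Group)
  next
    case Free_Semigroup
    have "s i \<in> lv ` \<Lambda>" if "i \<in> {1..r}" for i
      using that by (intro image_eqI[of _ _ "(i, True)"]) auto
    then show ?thesis by (auto simp: Free_Semigroup)
  qed
qed

lemma val_Nil [simp]: "val [] = \<one>\<^bsub>G\<^esub>"
  by (simp add: val_def word_prod_def)

lemma val_Cons: "val (l # w) = lv l \<otimes>\<^bsub>G\<^esub> val w"
  by (simp add: val_def word_prod_def)

lemma val_closed': "set w \<subseteq> \<Lambda> \<Longrightarrow> val w \<in> carrier G"
  by (induction w) (auto simp: val_Cons lv_closed)

lemma val_closed: "w \<in> W \<Longrightarrow> val w \<in> carrier G"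
  by (rule val_closed') (auto simp: words_def)

lemma val_append:
  assumes "set u \<subseteq> \<Lambda>" "set w \<subseteq> \<Lambda>" shows "val (u @ w) = val u \<otimes>\<^bsub>G\<^esub> val w"
  using assms by (induction u) (auto simp: val_Cons val_closed' lv_closed m_assoc)

lemma words_set: "w \<in> W \<Longrightarrow> set w \<subseteq> \<Lambda>"
  by (auto simp: words_def)

lemma inv_letter_cancel:
  assumes "k = Free_Group" "l \<in> \<Lambda>"
  shows "lv (inv_letter l) \<otimes>\<^bsub>G\<^esub> lv l = \<one>\<^bsub>G\<^esub>" "inv_letter l \<in> \<Lambda>" "lv (inv_letter l) = inv\<^bsub>G\<^esub> lv l"
proof -
  interpret group G by (rule group_G[OF assms(1)])
  show "inv_letter l \<in> \<Lambda>" using assms by (auto simp: alphabet_def inv_letter_def)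
  have c: "s (fst l) \<in> carrier G" using gen_closed fst_alphabet assms(2) by blast
  then show "lv (inv_letter l) = inv\<^bsub>G\<^esub> lv l" by (auto simp: letter_val_def inv_letter_def)
  with c show "lv (inv_letter l) \<otimes>\<^bsub>G\<^esub> lv l = \<one>\<^bsub>G\<^esub>"
    by (auto simp: letter_val_def inv_letter_def)
qed

lemma inv_letter_notin_semigroup:
  assumes "l \<in> \<Lambda>" "inv_letter l \<in> \<Lambda>" shows "k = Free_Group"
  using assms by (cases k) (auto simp: alphabet_def inv_letter_def)

lemma rev_inv_words:
  assumes "k = Free_Group" "u \<in> W"
  shows "rev (map inv_letter u) \<in> W" "val (rev (map inv_letter u)) \<otimes>\<^bsub>G\<^esub> val u = \<one>\<^bsub>G\<^esub>"
proof -
  interpret group G by (rule group_G[OF assms(1)])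
  have rw: "rev (map inv_letter u) \<in> W" if "u \<in> W" for u using that
  proof (induction u)
    case (Cons l u)
    then have "l \<in> \<Lambda>" "u \<in> W" "u \<noteq> [] \<longrightarrow> hd u \<noteq> inv_letter l" by (auto simp: Cons_words)
    moreover have "last (rev (map inv_letter u)) = inv_letter (hd u)" if "u \<noteq> []"
      using that by (simp add: last_rev hd_map)
    ultimately show ?case
      using Cons.IH inv_letter_cancel(2)[OF assms(1)] by (auto simp: snoc_words)
  qed simp
  show "rev (map inv_letter u) \<in> W" by (rule rw[OF assms(2)])
  show "val (rev (map inv_letter u)) \<otimes>\<^bsub>G\<^esub> val u = \<one>\<^bsub>G\<^esub>" using assms(2)
  proof (induction u)
    case (Cons l u)
    then have lu: "l \<in> \<Lambda>" "u \<in> W" by (auto simp: Cons_words)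
    let ?R = "rev (map inv_letter u)"
    have c: "val ?R \<in> carrier G" "val u \<in> carrier G" "lv l \<in> carrier G" "lv (inv_letter l) \<in> carrier G"
      using rw[OF lu(2)] lu val_closed lv_closed inv_letter_cancel(2)[OF assms(1) lu(1)] by auto
    have "val (rev (map inv_letter (l # u))) = val ?R \<otimes>\<^bsub>G\<^esub> lv (inv_letter l)"
      using c words_set[OF rw[OF lu(2)]] inv_letter_cancel(2)[OF assms(1) lu(1)]
      by (simp add: val_append val_Cons)
    then have "val (rev (map inv_letter (l # u))) \<otimes>\<^bsub>G\<^esub> val (l # u) =
        val ?R \<otimes>\<^bsub>G\<^esub> ((lv (inv_letter l) \<otimes>\<^bsub>G\<^esub> lv l) \<otimes>\<^bsub>G\<^esub> val u)"
      using c by (simp add: val_Cons m_assoc)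
    then show ?case using c Cons.IH[OF lu(2)] inv_letter_cancel(1)[OF assms(1) lu(1)] by simp
  qed simp
qed

text \<open>
  In a group, common first letters cancel. If the first letters differ, then the formal inverse of one
  word followed by the other is reduced, and it represents \<open>\<one>\<close>; so it is empty.
\<close>

lemma val_inj: "u \<in> W \<Longrightarrow> w \<in> W \<Longrightarrow> val u = val w \<Longrightarrow> u = w"
proof (cases k)
  case Free_Group
  interpret group G by (rule group_G[OF Free_Group])
  have triv: "w = []" if "w \<in> W" "val w = \<one>\<^bsub>G\<^esub>" for w
    using free that by (auto simp: Free_Group is_free_group_def val_def words_def alphabet_def)
  show "u \<in> W \<Longrightarrow> w \<in> W \<Longrightarrow> val u = val w \<Longrightarrow> u = w"
  proof (induction u arbitrary: w)
    case Nil
    then show ?case using triv[of w] by simp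
  next
    case (Cons l u)
    show ?case
    proof (cases "w \<noteq> [] \<and> hd w = l")
      case True
      then obtain w' where w: "w = l # w'" by (cases w) auto
      have "l \<in> \<Lambda>" "u \<in> W" "w' \<in> W" using Cons.prems w by (auto simp: Cons_words)
      moreover from this have "val u = val w'"
        using Cons.prems(3) unfolding w val_Cons by (simp add: lv_closed val_closed)
      ultimately show ?thesis using Cons.IH w by simp
    next
      case False
      let ?R = "rev (map inv_letter (l # u))"
      have R: "?R \<in> W" "val ?R \<otimes>\<^bsub>G\<^esub> val (l # u) = \<one>\<^bsub>G\<^esub>"
        using rev_inv_words[OF Free_Group Cons.prems(1)] by auto
      have "last ?R = inv_letter l" by simp
      then have "?R @ w \<in> W"
        using R(1) Cons.prems(2) False by (intro append_words[THEN iffD2]) (metis inv_letter_inv_letter)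
      moreover have "val (?R @ w) = \<one>\<^bsub>G\<^esub>"
        using R Cons.prems(3) val_append[OF words_set[OF R(1)] words_set[OF Cons.prems(2)]] by simp
      ultimately have "?R @ w = []" by (rule triv)
      then show ?thesis by simp
    qed
  qed
next
  case Free_Semigroup
  assume u: "u \<in> W" and w: "w \<in> W" and eq: "val u = val w"
  have pos: "(fst l, True) = l" "lv l = s (fst l)" "fst l \<in> {1..r}" if "v \<in> W" "l \<in> set v" for v l
    using words_alphabet[OF that] by (auto simp: Free_Semigroup alphabet_def)
  have map_s: "map lv v = map s (map fst v)" "v = map (\<lambda>i. (i, True)) (map fst v)"
    "map fst v \<in> lists {1..r}" if "v \<in> W" for v
  proof -
    show "map lv v = map s (map fst v)" using pos(2)[OF that] by (simp del: lv_True)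
    show "v = map (\<lambda>i. (i, True)) (map fst v)"
      unfolding map_map by (rule map_idI[symmetric]) (use pos(1)[OF that] in simp)
    show "map fst v \<in> lists {1..r}" using pos(3)[OF that] by auto
  qed
  have "inj_on (\<lambda>w. word_prod G (map s w)) (lists {1..r})"
    using free by (simp add: Free_Semigroup is_free_semigroup_def bij_betw_def)
  then have "map fst u = map fst w"
  proof (rule inj_onD)
    show "word_prod G (map s (map fst u)) = word_prod G (map s (map fst w))"
      using eq unfolding val_def map_s(1)[OF u] map_s(1)[OF w] .
  qed (fact map_s(3)[OF u] map_s(3)[OF w])+
  then show "u = w" using map_s(2)[OF u] map_s(2)[OF w] by metis
qed

text \<open>
  Left multiplication by a letter moves from a word to a child or to its parent: the left Cayley
  graph is the tree of reduced words with parent function \<open>tl\<close>.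
\<close>

lemma left_step:
  assumes "l \<in> \<Lambda>" "u \<in> W"
  obtains u' where "u' \<in> W" "lv l \<otimes>\<^bsub>G\<^esub> val u = val u'" "u' = l # u \<or> u = inv_letter l # u'"
proof (cases "u \<noteq> [] \<and> hd u = inv_letter l")
  case True
  then obtain u' where u: "u = inv_letter l # u'" by (cases u) auto
  then have u': "u' \<in> W" "inv_letter l \<in> \<Lambda>" using assms by (auto simp: Cons_words)
  have k: "k = Free_Group" by (rule inv_letter_notin_semigroup) (use assms u' in auto)
  have "lv l \<otimes>\<^bsub>G\<^esub> (lv (inv_letter l) \<otimes>\<^bsub>G\<^esub> val u') = (lv l \<otimes>\<^bsub>G\<^esub> lv (inv_letter l)) \<otimes>\<^bsub>G\<^esub> val u'"
    using assms u' by (simp add: m_assoc lv_closed val_closed)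
  also have "\<dots> = val u'"
    using inv_letter_cancel(1)[OF k u'(2)] u' by (simp add: val_closed)
  finally show ?thesis using that[of u'] u u' by (simp add: val_Cons)
next
  case False
  then show ?thesis using that[of "l # u"] assms by (auto simp: Cons_words val_Cons)
qed

lemma right_step:
  assumes "j \<in> {1..r}" "u \<in> W"
  shows "u @ [(j, True)] \<in> W \<and> val u \<otimes>\<^bsub>G\<^esub> s j = val (u @ [(j, True)]) \<or>
         (\<exists>u'\<in>W. u = u' @ [(j, False)] \<and> val u \<otimes>\<^bsub>G\<^esub> s j = val u')"
proof (cases "u \<noteq> [] \<and> last u = (j, False)")
  case True
  then obtain u' where u: "u = u' @ [(j, False)]" by (metis append_butlast_last_id)
  then have u': "u' \<in> W" "(j, False) \<in> \<Lambda>" using assms by (auto simp: snoc_words)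
  have k: "k = Free_Group"
    by (rule inv_letter_notin_semigroup[of "(j, True)"]) (use assms u' in \<open>auto simp: inv_letter_def\<close>)
  have c: "lv (j, False) \<otimes>\<^bsub>G\<^esub> s j = \<one>\<^bsub>G\<^esub>"
    using inv_letter_cancel(1)[OF k, of "(j, True)"] assms by (simp add: inv_letter_def)
  have "val u \<otimes>\<^bsub>G\<^esub> s j = val u' \<otimes>\<^bsub>G\<^esub> (lv (j, False) \<otimes>\<^bsub>G\<^esub> s j)"
    using u' assms(1) words_set[OF u'(1)] lv_closed[OF u'(2)] gen_closed
    by (simp add: u val_append val_Cons val_closed m_assoc)
  then show ?thesis using u u' c by (auto simp: val_closed)
next
  case False
  then have "u \<noteq> [] \<longrightarrow> (j, True) \<noteq> inv_letter (last u)" by (auto simp: inv_letter_def prod_eq_iff)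
  then have "u @ [(j, True)] \<in> W" using assms by (simp add: snoc_words)
  moreover have "val (u @ [(j, True)]) = val u \<otimes>\<^bsub>G\<^esub> s j"
    using assms words_set[OF assms(2)] by (simp add: val_append val_Cons gen_closed)
  ultimately show ?thesis by simp
qed

lemma word_ball_eq: "word_ball G (letters k G r s) n = val ` {u \<in> W. length u \<le> n}"
proof
  have reduce: "\<exists>u\<in>W. length u \<le> length w \<and> word_prod G w = val u" if "w \<in> lists (letters k G r s)" for w
    using that
  proof (induction w)
    case Nil
    then show ?case by (auto simp: word_prod_def intro!: bexI[of _ "[]"])
  next
    case (Cons x w)
    then obtain u where u: "u \<in> W" "length u \<le> length w" "word_prod G w = val u" by auto
    obtain l where l: "l \<in> \<Lambda>" "x = lv l" using Cons.hyps lv_image by blast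
    obtain u' where u': "u' \<in> W" "lv l \<otimes>\<^bsub>G\<^esub> val u = val u'" "u' = l # u \<or> u = inv_letter l # u'"
      by (rule left_step[OF l(1) u(1)])
    have "word_prod G (x # w) = val u'" using u(3) l(2) u'(2) by (simp add: word_prod_def)
    moreover have "length u' \<le> length (x # w)" using u'(3) u(2) by auto
    ultimately show ?case using u'(1) by blast
  qed
  show "word_ball G (letters k G r s) n \<subseteq> val ` {u \<in> W. length u \<le> n}"
  proof
    fix g assume "g \<in> word_ball G (letters k G r s) n"
    then obtain w where w: "w \<in> lists (letters k G r s)" "length w \<le> n" "g = word_prod G w"
      unfolding word_ball_def by blast
    obtain u where "u \<in> W" "length u \<le> length w" "word_prod G w = val u" using reduce[OF w(1)] by blast
    with w show "g \<in> val ` {u \<in> W. length u \<le> n}" by (intro image_eqI[of _ _ u]) auto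
  qed
  show "val ` {u \<in> W. length u \<le> n} \<subseteq> word_ball G (letters k G r s) n"
  proof safe
    fix u assume "u \<in> W" "length u \<le> n"
    then show "val u \<in> word_ball G (letters k G r s) n"
      unfolding word_ball_def val_def lv_image[symmetric]
      using words_set[of u] by (intro CollectI exI[of _ "map lv u"]) (auto simp del: lv_True intro!: imageI)
  qed
qed

lemma val_surj: "val ` W = carrier G"
proof (cases k)
  case Free_Group
  interpret group G by (rule group_G[OF Free_Group])
  have mult: "\<exists>w\<in>W. val u \<otimes>\<^bsub>G\<^esub> val v = val w" if "u \<in> W" "v \<in> W" for u v
    using that(1)
  proof (induction u)
    case Nil then show ?case using that(2) by (auto simp: val_closed)
  next
    case (Cons l u)
    then have lu: "l \<in> \<Lambda>" "u \<in> W" by (auto simp: Cons_words)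
    with Cons.IH obtain w where w: "w \<in> W" "val u \<otimes>\<^bsub>G\<^esub> val v = val w" by blast
    obtain w' where w': "w' \<in> W" "lv l \<otimes>\<^bsub>G\<^esub> val w = val w'" by (rule left_step[OF lu(1) w(1)])
    have "val (l # u) \<otimes>\<^bsub>G\<^esub> val v = lv l \<otimes>\<^bsub>G\<^esub> (val u \<otimes>\<^bsub>G\<^esub> val v)"
      using lu that(2) by (simp add: val_Cons m_assoc lv_closed val_closed)
    with w w' show ?case by auto
  qed
  have "\<exists>w\<in>W. g = val w" if "g \<in> generate G (s ` {1..r})" for g
    using that
  proof (induction rule: generate.induct)
    case one show ?case by (rule bexI[of _ "[]"]) auto
  next
    case (incl h)
    then obtain j where j: "j \<in> {1..r}" "h = s j" by auto
    then show ?case by (intro bexI[of _ "[(j, True)]"]) (auto simp: val_Cons gen_closed Cons_words)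
  next
    case (inv h)
    then obtain j where j: "j \<in> {1..r}" "h = s j" by auto
    then have l: "(j, False) \<in> \<Lambda>" by (auto simp: alphabet_def Free_Group)
    have "val [(j, False)] = inv\<^bsub>G\<^esub> h" using j by (simp add: val_Cons gen_closed letter_val_def)
    then show ?case using l by (intro bexI[of _ "[(j, False)]"]) (auto simp: Cons_words)
  next
    case (eng h1 h2)
    then show ?case using mult by blast
  qed
  moreover have "generate G (s ` {1..r}) = carrier G"
    using free by (simp add: Free_Group is_free_group_def)
  ultimately show ?thesis using val_closed by blast
next
  case Free_Semigroup
  have "g \<in> val ` W" if g: "g \<in> carrier G" for g
  proof -
    have "carrier G = (\<lambda>w. word_prod G (map s w)) ` lists {1..r}"
      using free by (simp add: Free_Semigroup is_free_semigroup_def bij_betw_def)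
    with g obtain w where w: "w \<in> lists {1..r}" "g = word_prod G (map s w)" by blast
    let ?u = "map (\<lambda>i. (i, True)) w"
    have "?u \<in> W"
      using w(1) by (induction w) (auto simp: Cons_words inv_letter_def hd_map)
    moreover have "map lv ?u = map s w" by simp
    then have "g = val ?u" using w(2) unfolding val_def by metis
    ultimately show ?thesis by blast
  qed
  then show ?thesis using val_closed by blast
qed

lemma adj_words:
  assumes "u \<in> W" "v \<in> W" "left_cayley_adj G (letters k G r s) (val u) (val v)"
  shows "\<exists>l. v = l # u \<or> u = l # v"
proof -
  have step: "\<exists>l'. v = l' # u \<or> u = l' # v" if uv: "u \<in> W" "v \<in> W" "l \<in> \<Lambda>" "val v = lv l \<otimes>\<^bsub>G\<^esub> val u" for u v l
  proof -
    obtain u' where u': "u' \<in> W" "lv l \<otimes>\<^bsub>G\<^esub> val u = val u'" "u' = l # u \<or> u = inv_letter l # u'"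
      by (rule left_step[OF uv(3,1)])
    then have "v = u'" using val_inj uv by simp
    with u'(3) show ?thesis by blast
  qed
  obtain l where "l \<in> \<Lambda>" "val v = lv l \<otimes>\<^bsub>G\<^esub> val u \<or> val u = lv l \<otimes>\<^bsub>G\<^esub> val v"
    using assms(3) unfolding left_cayley_adj_def lv_image[symmetric] by blast
  then show ?thesis using step assms(1,2) by blast
qed

text \<open>
  The subtree of \<open>l # w\<close> consists of the words with suffix \<open>l # w\<close>. A path that enters it must do so
  along the edge from \<open>w\<close> to \<open>l # w\<close>.
\<close>

lemma val_in_Past:
  assumes v: "l # w \<in> W" and u: "u \<in> W" and "\<not> suffix (l # w) u"
  shows "val u \<in> Past G (letters k G r s) (val (l # w)) (val w)"
proof -
  have "val w \<in> set p"
    if "left_cayley_path G (letters k G r s) (val u) (val (l # w)) p" "u \<in> W" "\<not> suffix (l # w) u" for p u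
    using that
  proof (induction p arbitrary: u)
    case Nil then show ?case by (simp add: left_cayley_path_def)
  next
    case (Cons g p)
    show ?case
    proof (cases p)
      case Nil
      with Cons.prems(1) have "val u = val (l # w)" by (auto simp: left_cayley_path_def)
      then have "u = l # w" using val_inj Cons.prems(2) v by blast
      with Cons.prems(3) show ?thesis by simp
    next
      case (Cons g' p')
      have g: "g = val u" and adj: "left_cayley_adj G (letters k G r s) g g'"
        and path: "left_cayley_path G (letters k G r s) g' (val (l # w)) p" and g': "g' \<in> carrier G"
        using Cons.prems(1) Cons by (auto simp: left_cayley_path_def)
      obtain u' where u': "u' \<in> W" "g' = val u'" using g' val_surj by blast
      show ?thesis
      proof (cases "suffix (l # w) u'")
        case False
        then show ?thesis using Cons.IH[of u'] path u' by simp
      next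
        case True
        obtain l' where "u' = l' # u \<or> u = l' # u'" using adj_words[OF Cons.prems(2) u'(1)] adj g u' by auto
        with True Cons.prems(3) have "u' = l' # u" by (auto simp: suffix_ConsI)
        with True Cons.prems(3) have "w = u" by (auto simp: suffix_Cons)
        then show ?thesis using g by simp
      qed
    qed
  qed
  then show ?thesis using val_closed[OF u] assms by (auto simp: Past_def)
qed

end

section \<open>Counting words by first and last letter\<close>

context free_generators
begin

text \<open>The words of the set \<open>\<Union>m\<le>N. B(e,n) s\<^sub>j\<^sup>m\<close>.\<close>

definition ball_orbit :: "nat \<Rightarrow> nat \<Rightarrow> nat \<Rightarrow> (nat \<times> bool) list set" where
  "ball_orbit n j N = {v \<in> W. \<exists>u m. v = u @ replicate m (j, True) \<and> length u \<le> n \<and> m \<le> N}"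

lemma ball_orbit_0: "ball_orbit n j 0 = {u \<in> W. length u \<le> n}"
  by (auto simp: ball_orbit_def)

lemma ball_orbit_words: "ball_orbit n j N \<subseteq> W"
  by (auto simp: ball_orbit_def)

lemma finite_ball_orbit: "finite (ball_orbit n j N)"
  by (rule finite_subset[OF _ finite_words_le[of k r "n + N"]]) (auto simp: ball_orbit_def)

lemma Nil_ball_orbit: "[] \<in> ball_orbit n j N"
  by (auto simp: ball_orbit_def)

text \<open>So \<open>ball_orbit n j N\<close> is a subtree containing the root.\<close>

lemma tl_ball_orbit:
  assumes "v \<in> ball_orbit n j N" shows "tl v \<in> ball_orbit n j N"
proof -
  obtain u m where v: "v \<in> W" "v = u @ replicate m (j, True)" "length u \<le> n" "m \<le> N"
    using assms by (auto simp: ball_orbit_def)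
  have "\<exists>u' m'. tl v = u' @ replicate m' (j, True) \<and> length u' \<le> n \<and> m' \<le> N"
  proof (cases u)
    case Nil
    then show ?thesis using v by (intro exI[of _ "[]"] exI[of _ "m - 1"]) (cases m; auto)
  next
    case (Cons l u')
    then show ?thesis using v by (intro exI[of _ u'] exI[of _ m]) auto
  qed
  then show ?thesis unfolding ball_orbit_def using tl_words[OF v(1)] by blast
qed

text \<open>
  Right multiplication by \<open>s j\<close> can cancel a last letter only if no power of \<open>s j\<close> has been appended
  yet, and then it leads back into the ball.
\<close>

lemma val_ball_orbit:
  assumes j: "j \<in> {1..r}"
  shows "val ` ball_orbit n j N = {val u \<otimes>\<^bsub>G\<^esub> s j [^]\<^bsub>G\<^esub> m | u m. u \<in> W \<and> length u \<le> n \<and> m \<le> N}"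
proof
  have pow: "val (replicate m (j, True)) = s j [^]\<^bsub>G\<^esub> m" for m
  proof (induction m)
    case (Suc m)
    have "val (replicate (Suc m) (j, True)) = s j \<otimes>\<^bsub>G\<^esub> s j [^]\<^bsub>G\<^esub> m" by (simp add: val_Cons Suc)
    also have "\<dots> = s j [^]\<^bsub>G\<^esub> Suc m" by (rule nat_pow_Suc2[symmetric, OF gen_closed[OF j]])
    finally show ?case .
  qed simp
  show "val ` ball_orbit n j N \<subseteq> {val u \<otimes>\<^bsub>G\<^esub> s j [^]\<^bsub>G\<^esub> m | u m. u \<in> W \<and> length u \<le> n \<and> m \<le> N}"
  proof safe
    fix v assume "v \<in> ball_orbit n j N"
    then obtain u m where v: "u @ replicate m (j, True) \<in> W" "v = u @ replicate m (j, True)" "length u \<le> n" "m \<le> N"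
      by (auto simp: ball_orbit_def)
    have "val v = val u \<otimes>\<^bsub>G\<^esub> s j [^]\<^bsub>G\<^esub> m"
      using words_set[OF v(1)] by (simp add: v(2) val_append pow)
    then show "\<exists>u m. val v = val u \<otimes>\<^bsub>G\<^esub> s j [^]\<^bsub>G\<^esub> m \<and> u \<in> W \<and> length u \<le> n \<and> m \<le> N"
      using v by (auto simp: append_words)
  qed
  have "val u \<otimes>\<^bsub>G\<^esub> s j [^]\<^bsub>G\<^esub> m \<in> val ` ball_orbit n j m" if "u \<in> W" "length u \<le> n" for u m
  proof (induction m)
    case 0
    then show ?case using that val_closed[of u] by (auto simp: ball_orbit_0)
  next
    case (Suc m)
    then obtain v where v: "v \<in> ball_orbit n j m" "val u \<otimes>\<^bsub>G\<^esub> s j [^]\<^bsub>G\<^esub> m = val v" by auto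
    then obtain w i where w: "v = w @ replicate i (j, True)" "length w \<le> n" "i \<le> m" "v \<in> W"
      by (auto simp: ball_orbit_def)
    have eq: "val u \<otimes>\<^bsub>G\<^esub> s j [^]\<^bsub>G\<^esub> Suc m = val v \<otimes>\<^bsub>G\<^esub> s j"
      using v(2) val_closed[OF that(1)] gen_closed[OF j] by (simp add: m_assoc[symmetric])
    from right_step[OF j w(4)] show ?case
    proof (elim disjE conjE bexE)
      assume a: "v @ [(j, True)] \<in> W" "val v \<otimes>\<^bsub>G\<^esub> s j = val (v @ [(j, True)])"
      have "v @ [(j, True)] = w @ replicate (Suc i) (j, True)" by (simp add: w(1) replicate_append_same)
      with a(1) w(2,3) have "v @ [(j, True)] \<in> ball_orbit n j (Suc m)"
        unfolding ball_orbit_def by (intro CollectI conjI exI[of _ w] exI[of _ "Suc i"]) auto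
      with a(2) eq show ?thesis by auto
    next
      fix v' assume a: "v' \<in> W" "v = v' @ [(j, False)]" "val v \<otimes>\<^bsub>G\<^esub> s j = val v'"
      have "i = 0"
      proof (rule ccontr)
        assume "i \<noteq> 0"
        then have "last v = (j, True)" by (simp add: w(1))
        with a(2) show False by simp
      qed
      with a(1,2) w have "v' \<in> ball_orbit n j (Suc m)"
        unfolding ball_orbit_def by (intro CollectI conjI exI[of _ v'] exI[of _ 0]) auto
      with a(3) eq show ?thesis by auto
    qed
  qed
  moreover have "ball_orbit n j m \<subseteq> ball_orbit n j N" if "m \<le> N" for m
    using that by (auto simp: ball_orbit_def intro: order_trans)
  ultimately show "{val u \<otimes>\<^bsub>G\<^esub> s j [^]\<^bsub>G\<^esub> m | u m. u \<in> W \<and> length u \<le> n \<and> m \<le> N} \<subseteq> val ` ball_orbit n j N"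
    by blast
qed

definition sphere_to :: "nat \<Rightarrow> nat \<times> bool \<Rightarrow> (nat \<times> bool) list set" where
  "sphere_to n l = {v \<in> W. length v = n \<and> v \<noteq> [] \<and> last v = l}"

lemma sphere_to_snoc: "v \<in> sphere_to n l \<Longrightarrow> v = butlast v @ [l]"
  using append_butlast_last_id[of v] by (auto simp: sphere_to_def)

lemma finite_sphere_to: "finite (sphere_to n l)"
  by (rule finite_subset[OF _ finite_words_le[of k r n]]) (auto simp: sphere_to_def)

text \<open>
  A word \<open>u s\<^sub>j\<^bsup>N+1\<^esup>\<close> with \<open>u\<close> shorter than \<open>n\<close> is not new, since \<open>u s\<^sub>j\<close> still lies in the ball. Up to \<open>N\<close>
  trailing letters, the new words are the words of length \<open>n + 1\<close> that end in \<open>s\<^sub>j\<close>.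
\<close>

lemma ball_orbit_Suc:
  "ball_orbit n j (Suc N) = ball_orbit n j N \<union> (\<lambda>v. v @ replicate N (j, True)) ` sphere_to (Suc n) (j, True)"
  (is "_ = _ \<union> ?f ` ?S")
proof
  show "ball_orbit n j (Suc N) \<subseteq> ball_orbit n j N \<union> ?f ` ?S"
  proof
    fix v assume "v \<in> ball_orbit n j (Suc N)"
    then obtain u m where v: "v \<in> W" "v = u @ replicate m (j, True)" "length u \<le> n" "m \<le> Suc N"
      by (auto simp: ball_orbit_def)
    consider "m \<le> N" | "m = Suc N" "length u < n" | "m = Suc N" "length u = n"
      using v(3,4) by linarith
    then show "v \<in> ball_orbit n j N \<union> ?f ` ?S"
    proof cases
      case 1 then show ?thesis using v by (auto simp: ball_orbit_def)
    next
      case 2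
      then have "v = (u @ [(j, True)]) @ replicate N (j, True)" by (simp add: v(2))
      with 2 v(1) have "v \<in> ball_orbit n j N"
        unfolding ball_orbit_def by (intro CollectI conjI exI[of _ "u @ [(j, True)]"] exI[of _ N]) auto
      then show ?thesis by simp
    next
      case 3
      then have eq: "v = (u @ [(j, True)]) @ replicate N (j, True)" by (simp add: v(2))
      with v(1) have "u @ [(j, True)] \<in> W" by (simp only: append_words[of "u @ [(j, True)]"])
      with 3 have "u @ [(j, True)] \<in> ?S" by (simp add: sphere_to_def)
      with eq show ?thesis by blast
    qed
  qed
  have "?f v \<in> ball_orbit n j (Suc N)" if v: "v \<in> ?S" for v
  proof -
    have "?f v \<in> W" by (rule append_replicate_words) (use v in \<open>auto simp: sphere_to_def\<close>)
    moreover have "v = butlast v @ [(j, True)]" by (rule sphere_to_snoc[OF v])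
    then have "?f v = butlast v @ replicate (Suc N) (j, True)"
      by (metis append.assoc append_Cons append_Nil replicate_Suc)
    moreover have "length (butlast v) \<le> n" using v by (simp add: sphere_to_def)
    ultimately show ?thesis unfolding ball_orbit_def by blast
  qed
  moreover have "ball_orbit n j N \<subseteq> ball_orbit n j (Suc N)"
    by (auto simp: ball_orbit_def intro: le_SucI)
  ultimately show "ball_orbit n j N \<union> ?f ` ?S \<subseteq> ball_orbit n j (Suc N)" by blast
qed

text \<open>
  The weight of a word depends on its first letter, that is, on the edge to its parent, and this is
  unchanged by the trailing letters. So all increments are equal.
\<close>

lemma sum_ball_orbit:
  fixes c :: "nat \<times> bool \<Rightarrow> real"
  shows "(\<Sum>v\<in>ball_orbit n j N - {[]}. c (hd v)) =
     (\<Sum>v\<in>{u \<in> W. length u \<le> n} - {[]}. c (hd v)) + real N * (\<Sum>v\<in>sphere_to (Suc n) (j, True). c (hd v))"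
proof (induction N)
  case 0 then show ?case by (simp add: ball_orbit_0)
next
  case (Suc N)
  let ?f = "\<lambda>v. v @ replicate N (j, True)" and ?S = "sphere_to (Suc n) (j, True)"
  have "length v \<le> n + N" if "v \<in> ball_orbit n j N" for v using that by (auto simp: ball_orbit_def)
  then have disj: "(ball_orbit n j N - {[]}) \<inter> ?f ` ?S = {}" by (force simp: sphere_to_def)
  have "ball_orbit n j (Suc N) - {[]} = (ball_orbit n j N - {[]}) \<union> ?f ` ?S"
    unfolding ball_orbit_Suc by (auto simp: sphere_to_def)
  then have "(\<Sum>v\<in>ball_orbit n j (Suc N) - {[]}. c (hd v)) =
      (\<Sum>v\<in>ball_orbit n j N - {[]}. c (hd v)) + (\<Sum>v\<in>?f ` ?S. c (hd v))"
    using disj by (simp add: sum.union_disjoint finite_ball_orbit finite_sphere_to)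
  also have "(\<Sum>v\<in>?f ` ?S. c (hd v)) = (\<Sum>v\<in>?S. c (hd v))"
    by (subst sum.reindex) (auto simp: inj_on_def sphere_to_def intro!: sum.cong)
  finally show ?case using Suc.IH by (simp add: algebra_simps)
qed

text \<open>
  A word ending in a positive letter can be prolonged by all \<open>r\<close> positive letters, a word ending in
  a negative letter by all but one.
\<close>

lemma sum_sphere_to_positive_Suc:
  fixes c :: "nat \<times> bool \<Rightarrow> real"
  shows "(\<Sum>j=1..r. \<Sum>v\<in>sphere_to (Suc (Suc n)) (j, True). c (hd v)) =
    (\<Sum>j=1..r. \<Sum>v\<in>sphere_to (Suc n) (j, True). c (hd v)) +
    (real r - 1) * (\<Sum>v\<in>{v \<in> W. length v = Suc n}. c (hd v))"
proof -
  let ?L = "{v \<in> W. length v = Suc n}"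
  have fin: "finite ?L" by (rule finite_subset[OF _ finite_words_le[of k r "Suc n"]]) auto
  have last_L: "fst (last v) \<in> {1..r}" if "v \<in> ?L" for v
    using that words_alphabet[of v k r "last v"] fst_alphabet by (cases v rule: rev_cases) auto
  have step: "(\<Sum>v\<in>sphere_to (Suc (Suc n)) (j, True). c (hd v)) =
      (\<Sum>v\<in>?L. if last v = (j, False) then 0 else c (hd v))" if j: "j \<in> {1..r}" for j
  proof -
    have im: "sphere_to (Suc (Suc n)) (j, True) = (\<lambda>v. v @ [(j, True)]) ` {v \<in> ?L. last v \<noteq> (j, False)}"
    proof safe
      fix v assume "v \<in> sphere_to (Suc (Suc n)) (j, True)"
      with sphere_to_snoc[OF this] have v: "v \<in> W" "length v = Suc (Suc n)" "v = butlast v @ [(j, True)]"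
        by (simp_all add: sphere_to_def)
      then have "butlast v @ [(j, True)] \<in> W" by simp
      then have "butlast v \<in> W" "butlast v \<noteq> [] \<longrightarrow> last (butlast v) \<noteq> (j, False)"
        by (auto simp: snoc_words inv_letter_def)
      moreover have "length (butlast v) = Suc n" "butlast v \<noteq> []" using v(2) by (cases v; auto)+
      ultimately have "butlast v \<in> {v \<in> ?L. last v \<noteq> (j, False)}" by auto
      with v(3) show "v \<in> (\<lambda>v. v @ [(j, True)]) ` {v \<in> ?L. last v \<noteq> (j, False)}" by blast
    next
      fix v assume v: "v \<in> W" "length v = Suc n" "last v \<noteq> (j, False)"
      then have "(j, True) \<noteq> inv_letter (last v)" by (auto simp: inv_letter_def prod_eq_iff)
      then show "v @ [(j, True)] \<in> sphere_to (Suc (Suc n)) (j, True)"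
        using v j by (auto simp: sphere_to_def snoc_words)
    qed
    have "(\<Sum>v\<in>sphere_to (Suc (Suc n)) (j, True). c (hd v)) = (\<Sum>v\<in>{v \<in> ?L. last v \<noteq> (j, False)}. c (hd v))"
      unfolding im by (subst sum.reindex) (auto simp: inj_on_def hd_append intro!: sum.cong)
    also have "\<dots> = (\<Sum>v\<in>?L. if last v \<noteq> (j, False) then c (hd v) else 0)"
      using sum.inter_filter[OF fin, of "\<lambda>v. c (hd v)" "\<lambda>v. last v \<noteq> (j, False)"] by simp
    also have "\<dots> = (\<Sum>v\<in>?L. if last v = (j, False) then 0 else c (hd v))"
      by (rule sum.cong) auto
    finally show ?thesis .
  qed
  have pos: "(\<Sum>v\<in>sphere_to (Suc n) (j, True). c (hd v)) = (\<Sum>v\<in>?L. if last v = (j, True) then c (hd v) else 0)" for j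
  proof -
    have "sphere_to (Suc n) (j, True) = {v \<in> ?L. last v = (j, True)}" by (auto simp: sphere_to_def)
    then show ?thesis using sum.inter_filter[OF fin, of "\<lambda>v. c (hd v)" "\<lambda>v. last v = (j, True)"] by simp
  qed
  have "(\<Sum>j=1..r. \<Sum>v\<in>sphere_to (Suc (Suc n)) (j, True). c (hd v)) =
      (\<Sum>j=1..r. \<Sum>v\<in>?L. if last v = (j, False) then 0 else c (hd v))"
    by (rule sum.cong) (use step in auto)
  also have "\<dots> = (\<Sum>v\<in>?L. \<Sum>j=1..r. if last v = (j, False) then 0 else c (hd v))" by (rule sum.swap)
  also have "\<dots> = (\<Sum>v\<in>?L. (\<Sum>j=1..r. if last v = (j, True) then c (hd v) else 0) + (real r - 1) * c (hd v))"
  proof (rule sum.cong[OF refl])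
    fix v assume v: "v \<in> ?L"
    obtain i b where ib: "last v = (i, b)" by fastforce
    have i: "i \<in> {1..r}" using last_L[OF v] ib by simp
    have "(\<Sum>j=1..r. if last v = (j, False) then 0 else c (hd v)) =
        (\<Sum>j=1..r. c (hd v) - (if i = j then if b then 0 else c (hd v) else 0))"
      by (rule sum.cong) (auto simp: ib)
    also have "\<dots> = real r * c (hd v) - (if b then 0 else c (hd v))"
      using i by (simp add: sum_subtractf)
    finally have 1: "(\<Sum>j=1..r. if last v = (j, False) then 0 else c (hd v)) =
        real r * c (hd v) - (if b then 0 else c (hd v))" .
    have "(\<Sum>j=1..r. if last v = (j, True) then c (hd v) else 0) =
        (\<Sum>j=1..r. if i = j then if b then c (hd v) else 0 else 0)"
      by (rule sum.cong) (auto simp: ib)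
    also have "\<dots> = (if b then c (hd v) else 0)" using i by simp
    finally show "(\<Sum>j=1..r. if last v = (j, False) then 0 else c (hd v)) =
        (\<Sum>j=1..r. if last v = (j, True) then c (hd v) else 0) + (real r - 1) * c (hd v)"
      using 1 by (cases b) (simp_all add: algebra_simps)
  qed
  also have "\<dots> = (\<Sum>j=1..r. \<Sum>v\<in>?L. if last v = (j, True) then c (hd v) else 0) + (real r - 1) * (\<Sum>v\<in>?L. c (hd v))"
    by (simp add: sum.distrib sum_distrib_left sum.swap[of _ _ ?L])
  finally show ?thesis by (simp add: pos)
qed

text \<open>
  Enlarging the ball by one sphere changes the first sum by the weight of that sphere, and by the
  preceding lemma the second sum changes by \<open>r - 1\<close> times the same weight.
\<close>

lemma weighted_euler_characteristic:
  fixes c :: "nat \<times> bool \<Rightarrow> real"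
  shows "(1 - real r) * (\<Sum>v\<in>{u \<in> W. length u \<le> n} - {[]}. c (hd v)) +
    (\<Sum>j=1..r. \<Sum>v\<in>sphere_to (Suc n) (j, True). c (hd v)) = (\<Sum>j=1..r. c (j, True))"
proof (induction n)
  case 0
  have "sphere_to (Suc 0) (j, True) = {[(j, True)]}" if "j \<in> {1..r}" for j
    using that by (auto simp: sphere_to_def Cons_words length_Suc_conv)
  moreover have ball: "(\<Sum>v\<in>{u \<in> W. length u \<le> 0} - {[]}. c (hd v)) = 0" by (rule sum.neutral) auto
  ultimately show ?case unfolding ball by simp
next
  case (Suc n)
  have "finite ({u \<in> W. length u \<le> n} - {[]})" "finite {v \<in> W. length v = Suc n}"
    by (auto intro: finite_subset[OF _ finite_words_le[of k r "Suc n"]])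
  moreover have "{u \<in> W. length u \<le> Suc n} - {[]} = ({u \<in> W. length u \<le> n} - {[]}) \<union> {v \<in> W. length v = Suc n}"
    by (auto simp: le_Suc_eq)
  moreover have "({u \<in> W. length u \<le> n} - {[]}) \<inter> {v \<in> W. length v = Suc n} = {}" by auto
  ultimately have "(\<Sum>v\<in>{u \<in> W. length u \<le> Suc n} - {[]}. c (hd v)) =
      (\<Sum>v\<in>{u \<in> W. length u \<le> n} - {[]}. c (hd v)) + (\<Sum>v\<in>{v \<in> W. length v = Suc n}. c (hd v))"
    by (simp add: sum.union_disjoint)
  then show ?case using Suc.IH by (simp add: sum_sphere_to_positive_Suc algebra_simps del: One_nat_def)
qed

end

section \<open>The Markov property relative to a coarsening\<close>

text \<open>
  The map \<open>b\<close> chooses for each atom \<open>A\<close> of \<open>\<alpha>\<close> an atom of \<open>\<beta>\<close> that contains it up to a null set. The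
  label \<open>b (atom_of \<alpha> x)\<close> is an exact function of the \<open>\<alpha>\<close>-label and almost surely equals the
  \<open>\<beta>\<close>-label.
\<close>

locale hidden_markov = free_generators k G r s + prob_space M
  for k :: free_kind and G :: "('g, 'b) monoid_scheme" and r :: nat and s :: "nat \<Rightarrow> 'g"
    and M :: "'a measure" +
  fixes T :: "'g \<Rightarrow> 'a \<Rightarrow> 'a" and \<alpha> \<beta> :: "'a set set" and b :: "'a set \<Rightarrow> 'a set"
  assumes markov: "markov_process G (letters k G r s) T M \<alpha>"
    and \<beta>_part: "measurable_partition M \<beta>"
    and b_mem: "\<And>A. A \<in> \<alpha> \<Longrightarrow> b A \<in> \<beta>"
    and b_null: "\<And>A. A \<in> \<alpha> \<Longrightarrow> emeasure M (A - b A) = 0"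
begin

abbreviation "lab \<equiv> atom_of \<alpha>"

text \<open>
  Fine labels have first index \<open>True\<close>, coarse labels have first index \<open>False\<close>. Off the carrier the
  label is constant, so that every index gives a measurable label.
\<close>

definition Z :: "bool \<times> 'g \<Rightarrow> 'a \<Rightarrow> 'a set" where
  "Z i x = (if snd i \<in> carrier G then (if fst i then id else b) (lab (T (snd i) x)) else {})"

lemma action: "mp_action G M T" and \<alpha>_part: "measurable_partition M \<alpha>"
  using markov by (auto simp: markov_process_def G_process_def)

lemma T_one: "x \<in> space M \<Longrightarrow> T \<one>\<^bsub>G\<^esub> x = x"
  using action by (simp add: mp_action_def)

lemma T_mult: "g \<in> carrier G \<Longrightarrow> h \<in> carrier G \<Longrightarrow> x \<in> space M \<Longrightarrow> T (g \<otimes>\<^bsub>G\<^esub> h) x = T g (T h x)"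
  using action by (simp add: mp_action_def)

lemma T_measurable: "g \<in> carrier G \<Longrightarrow> T g \<in> measurable M M"
  using action by (simp add: mp_action_def measure_preserving_map_def)

lemma T_space: "g \<in> carrier G \<Longrightarrow> x \<in> space M \<Longrightarrow> T g x \<in> space M"
  using measurable_space[OF T_measurable] by blast

lemma T_emeasure: "g \<in> carrier G \<Longrightarrow> A \<in> sets M \<Longrightarrow> emeasure M (T g -` A \<inter> space M) = emeasure M A"
  using action by (simp add: mp_action_def measure_preserving_map_def)

lemma T_distr: "g \<in> carrier G \<Longrightarrow> distr M M (T g) = M"
  by (rule measure_eqI) (simp_all add: emeasure_distr T_measurable T_emeasure)

lemma T_AE:
  assumes g: "g \<in> carrier G" and P: "AE x in M. P x"
  shows "AE x in M. P (T g x)"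
proof (rule AE_distrD[OF T_measurable[OF g]])
  show "AE x in distr M M (T g). P x" unfolding T_distr[OF g] by (rule P)
qed

lemma \<alpha>_partition: "partition_on (space M) \<alpha>" and \<alpha>_countable: "countable \<alpha>" and \<alpha>_sets: "\<alpha> \<subseteq> sets M"
  using \<alpha>_part by (auto simp: measurable_partition_def)

lemma \<beta>_partition: "partition_on (space M) \<beta>" and \<beta>_countable: "countable \<beta>" and \<beta>_sets: "\<beta> \<subseteq> sets M"
  using \<beta>_part by (auto simp: measurable_partition_def)

lemma atom_of_eq:
  assumes "partition_on \<Omega> \<gamma>" "A \<in> \<gamma>" "x \<in> A" shows "atom_of \<gamma> x = A"
  unfolding atom_of_def
  by (rule the_equality) (use assms in \<open>auto simp: partition_on_def disjoint_def\<close>)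

lemma atom_of_mem:
  assumes "partition_on \<Omega> \<gamma>" "x \<in> \<Omega>" shows "atom_of \<gamma> x \<in> \<gamma>" "x \<in> atom_of \<gamma> x"
proof -
  obtain A where "A \<in> \<gamma>" "x \<in> A" using assms by (auto simp: partition_on_def)
  then show "atom_of \<gamma> x \<in> \<gamma>" "x \<in> atom_of \<gamma> x" using atom_of_eq[OF assms(1)] by auto
qed

lemma lab_iff: "x \<in> space M \<Longrightarrow> A \<in> \<alpha> \<Longrightarrow> lab x = A \<longleftrightarrow> x \<in> A"
  using atom_of_eq[OF \<alpha>_partition] atom_of_mem[OF \<alpha>_partition] by blast

lemma lab_mem: "x \<in> space M \<Longrightarrow> lab x \<in> \<alpha>"
  using atom_of_mem[OF \<alpha>_partition] by blast

lemma lab_measurable: "lab \<in> measurable M (count_space UNIV)"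
proof (rule measurableI)
  fix C :: "'a set set"
  have "x \<in> lab -` C \<inter> space M \<longleftrightarrow> x \<in> \<Union>(C \<inter> \<alpha>)" for x
  proof (cases "x \<in> space M")
    case True
    then show ?thesis using lab_iff[OF True] lab_mem[OF True] by (metis IntE IntI UnionE UnionI vimageI2 vimageE)
  next
    case False
    then show ?thesis using partition_onD1[OF \<alpha>_partition] by auto
  qed
  then have "lab -` C \<inter> space M = \<Union>(C \<inter> \<alpha>)" by blast
  also have "\<dots> \<in> sets M" using \<alpha>_countable \<alpha>_sets by (intro sets.countable_Union) auto
  finally show "lab -` C \<inter> space M \<in> sets M" .
qed auto

sublocale label_family M Z
proof
  fix i :: "bool \<times> 'g"
  show "Z i \<in> measurable M (count_space UNIV)"
  proof (cases "snd i \<in> carrier G")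
    case True
    have "(\<lambda>x. (if fst i then id else b) (lab (T (snd i) x))) \<in> measurable M (count_space UNIV)"
      by (rule measurable_compose[OF measurable_compose[OF T_measurable[OF True] lab_measurable]]) simp
    then show ?thesis using True by (simp add: Z_def[abs_def])
  qed (simp add: Z_def[abs_def])
  have "Z i ` space M \<subseteq> insert {} ((if fst i then id else b) ` \<alpha>)"
    using lab_mem T_space by (auto simp: Z_def)
  then show "countable (Z i ` space M)" by (rule countable_subset) (simp add: \<alpha>_countable)
qed

lemma Z_mult:
  assumes "g \<in> carrier G" "h \<in> carrier G" "x \<in> space M"
  shows "Z (t, g \<otimes>\<^bsub>G\<^esub> h) x = Z (t, g) (T h x)"
  using assms by (simp add: Z_def T_mult)

lemma Z_True_image: "g \<in> carrier G \<Longrightarrow> Z (True, g) ` space M \<subseteq> \<alpha>"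
  using lab_mem T_space by (auto simp: Z_def)

lemma Z_True_vimage:
  "g \<in> carrier G \<Longrightarrow> A \<in> \<alpha> \<Longrightarrow> Z (True, g) -` {A} \<inter> space M = T g -` A \<inter> space M"
  by (auto simp: Z_def lab_iff T_space atom_of_mem[OF \<alpha>_partition])

abbreviation fines :: "(nat \<times> bool) list set \<Rightarrow> (bool \<times> 'g) set" where "fines J \<equiv> Pair True ` val ` J"
abbreviation coarses :: "(nat \<times> bool) list set \<Rightarrow> (bool \<times> 'g) set" where "coarses J \<equiv> Pair False ` val ` J"

lemma sets_alg_True:
  assumes "H \<subseteq> carrier G"
  shows "sets (alg (Pair True ` H)) = sets (sigma (space M) (\<Union>f\<in>H. pull_part M (T f) \<alpha>))"
proof -
  let ?E = "\<Union>f\<in>H. pull_part M (T f) \<alpha>"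
  have "sets (alg (Pair True ` H)) = sigma_sets (space M) ?E"
  proof (rule alg_eq_sigma_sets)
    show "?E \<subseteq> sets (alg (Pair True ` H))"
    proof
      fix U assume "U \<in> ?E"
      then obtain f A where "f \<in> H" "A \<in> \<alpha>" "U = T f -` A \<inter> space M" by (auto simp: pull_part_def)
      moreover from this have "T f -` A \<inter> space M = Z (True, f) -` {A} \<inter> space M"
        using Z_True_vimage[of f A] assms by blast
      ultimately show "U \<in> sets (alg (Pair True ` H))" by (simp add: Z_event_alg)
    qed
    fix i c assume i: "i \<in> Pair True ` H" and c: "c \<in> Z i ` space M"
    then obtain f where f: "f \<in> H" "i = (True, f)" by auto
    have "c \<in> \<alpha>" using c Z_True_image[of f] f assms by auto
    have fc: "f \<in> carrier G" using f assms by auto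
    have "Z i -` {c} \<inter> space M = T f -` c \<inter> space M"
      unfolding f(2) by (rule Z_True_vimage[OF fc \<open>c \<in> \<alpha>\<close>])
    moreover have "Z i -` {c} \<inter> space M \<noteq> {}" using c by auto
    ultimately have "Z i -` {c} \<inter> space M \<in> pull_part M (T f) \<alpha>"
      using \<open>c \<in> \<alpha>\<close> by (auto simp: pull_part_def)
    then show "Z i -` {c} \<inter> space M \<in> sigma_sets (space M) ?E" using f by (intro sigma_sets.Basic) auto
  qed
  moreover have "?E \<subseteq> Pow (space M)" by (auto simp: pull_part_def)
  ultimately show ?thesis by (simp add: sets_measure_of)
qed

lemma Z_b: "Z (False, g) x = (if g \<in> carrier G then b (Z (True, g) x) else {})"
  by (simp add: Z_def)

text \<open>The coarse labels are functions of the fine ones.\<close>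

lemma sets_alg_coarse:
  assumes "J' \<subseteq> J" "J \<subseteq> W"
  shows "sets (alg (fines J \<union> coarses J')) = sets (alg (fines J))"
proof
  show "sets (alg (fines J \<union> coarses J')) \<subseteq> sets (alg (fines J))"
  proof (rule alg_least')
    fix i C assume "i \<in> fines J \<union> coarses J'"
    then show "Z i -` C \<inter> space M \<in> sets (alg (fines J))"
    proof
      assume "i \<in> coarses J'"
      then obtain u where u: "u \<in> J" "u \<in> W" "i = (False, val u)" using assms by auto
      then have "Z i -` C \<inter> space M = Z (True, val u) -` (b -` C) \<inter> space M"
        using val_closed[of u] by (auto simp: Z_b)
      then show ?thesis using u by (auto intro: Z_event_alg)
    qed (rule Z_event_alg)
  qed simp
  show "sets (alg (fines J)) \<subseteq> sets (alg (fines J \<union> coarses J'))" by (rule alg_mono) auto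
qed

text \<open>
  The defining Markov property conditions on all labels in the past. By \<open>cprob_sandwich\<close> it passes to
  any set \<open>J\<close> of them that contains \<open>w\<close>.
\<close>

lemma markov_step:
  assumes v: "l # w \<in> W" and J: "J \<subseteq> {u \<in> W. \<not> suffix (l # w) u}" "w \<in> J"
    and c: "c \<in> Z (True, val (l # w)) ` space M"
  shows "AE x in M. cprob M (alg (fines J)) (Z (True, val (l # w)) -` {c} \<inter> space M) x =
                    cprob M (alg {(True, val w)}) (Z (True, val (l # w)) -` {c} \<inter> space M) x"
proof (rule cprob_sandwich[OF Z_event subalgebra_alg subalgebra_alg subalgebra_alg])
  let ?P = "Past G (letters k G r s) (val (l # w)) (val w)"
  have w: "w \<in> W" and l: "l \<in> \<Lambda>" using v by (auto simp: Cons_words)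
  have vc: "val (l # w) \<in> carrier G" and wc: "val w \<in> carrier G" using val_closed v w by auto
  have P: "?P \<subseteq> carrier G" by (auto simp: Past_def)
  show "sets (alg {(True, val w)}) \<subseteq> sets (alg (fines J))" by (rule alg_mono) (use J in auto)
  show "sets (alg (fines J)) \<subseteq> sets (alg (Pair True ` ?P))"
    by (rule alg_mono) (use J val_in_Past[OF v] in auto)
  have c\<alpha>: "c \<in> \<alpha>" using c Z_True_image[OF vc] by blast
  have "lv l \<in> letters k G r s" using l lv_image by blast
  then have "AE y in M.
      cprob M (sigma (space M) (\<Union>f\<in>Past G (letters k G r s) (lv l \<otimes>\<^bsub>G\<^esub> val w) (val w). pull_part M (T f) \<alpha>))
        (T (lv l \<otimes>\<^bsub>G\<^esub> val w) -` c \<inter> space M) y =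
      cprob M (sigma (space M) (pull_part M (T (val w)) \<alpha>)) (T (lv l \<otimes>\<^bsub>G\<^esub> val w) -` c \<inter> space M) y"
    using markov wc c\<alpha> unfolding markov_process_def by blast
  then show "AE x in M. cprob M (alg (Pair True ` ?P)) (Z (True, val (l # w)) -` {c} \<inter> space M) x =
                 cprob M (alg {(True, val w)}) (Z (True, val (l # w)) -` {c} \<inter> space M) x"
    using cprob_cong_sets[OF sets_alg_True[OF P]] cprob_cong_sets[OF sets_alg_True[of "{val w}"]] wc
    by (simp add: Z_True_vimage[OF vc c\<alpha>]) (simp add: val_Cons)
qed

definition desc :: "(nat \<times> bool) list \<Rightarrow> (nat \<times> bool) list set" where
  "desc v = {u \<in> W. suffix v u}"

text \<open>
  The subtree of \<open>l # w\<close> is explored level by level. Each new vertex depends on the labels outside the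
  subtree and on those explored before only through its parent, which has been explored.
\<close>

lemma screens_desc:
  assumes v: "l # w \<in> W"
  shows "screens {(True, val w)} (fines (W - desc (l # w))) (fines (insert w (desc (l # w))))"
proof -
  let ?v = "l # w" and ?Q = "{(True, val w)}" and ?P = "fines (W - desc (l # w))"
  have w: "w \<in> W" using v by (auto simp: Cons_words)
  have w': "\<not> suffix ?v w" using suffix_length_le[of ?v w] by auto
  define L where "L n = {u \<in> desc ?v. length u \<le> n}" for n
  have one: "screens ?Q ?P (fines (insert u D))"
    if S: "screens ?Q ?P (fines D)" and D: "w \<in> D" "D \<subseteq> W" "tl u \<in> D" and u: "u \<in> desc ?v"
      and nd: "\<And>u'. u' \<in> D \<Longrightarrow> \<not> suffix u u'" for u D
  proof -
    obtain l' u' where uu: "u = l' # u'" using u by (cases u) (auto simp: desc_def)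
    have uW: "l' # u' \<in> W" using u uu by (auto simp: desc_def)
    have P: "W - desc ?v \<subseteq> {x \<in> W. \<not> suffix (l' # u') x}"
      using u suffix_order.trans[of ?v u] by (auto simp: desc_def uu)
    have D': "D \<subseteq> {x \<in> W. \<not> suffix (l' # u') x}" using D nd uu by auto
    have "screens ?Q ?P (insert (True, val u) (fines D))"
    proof (rule screens_insert[OF S])
      show "?Q \<subseteq> fines D" using D(1) by auto
      fix c assume c: "c \<in> Z (True, val u) ` space M"
      have "AE x in M. cprob M (alg (fines (W - desc ?v \<union> D))) (Z (True, val u) -` {c} \<inter> space M) x =
          cprob M (alg {(True, val u')}) (Z (True, val u) -` {c} \<inter> space M) x"
        unfolding uu by (rule markov_step[OF uW]) (use P D' D(3) c uu in auto)
      moreover have "AE x in M. cprob M (alg (fines D)) (Z (True, val u) -` {c} \<inter> space M) x =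
          cprob M (alg {(True, val u')}) (Z (True, val u) -` {c} \<inter> space M) x"
        unfolding uu by (rule markov_step[OF uW]) (use D' D(3) c uu in auto)
      ultimately show "AE x in M. cprob M (alg (?P \<union> fines D)) (Z (True, val u) -` {c} \<inter> space M) x =
          cprob M (alg (fines D)) (Z (True, val u) -` {c} \<inter> space M) x"
        unfolding image_Un by eventually_elim simp
    qed
    then show ?thesis by simp
  qed
  have level: "screens ?Q ?P (fines (insert w (L n) \<union> K))"
    if "finite K" and S: "screens ?Q ?P (fines (insert w (L n)))" and "K \<subseteq> {u \<in> desc ?v. length u = Suc n}" for n K
    using that(1,3)
  proof (induction K rule: finite_induct)
    case empty then show ?case using S by simp
  next
    case (insert u K)
    let ?D = "insert w (L n) \<union> K"
    have u: "u \<in> desc ?v" "length u = Suc n" using insert.prems by auto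
    then obtain l' u' where uu: "u = l' # u'" by (cases u) auto
    have "screens ?Q ?P (fines (insert u ?D))"
    proof (rule one)
      show "screens ?Q ?P (fines ?D)" using insert by auto
      show "?D \<subseteq> W" using w insert.prems by (auto simp: L_def desc_def)
      show "u \<in> desc ?v" by fact
      have "u' \<in> W" using u uu by (auto simp: desc_def Cons_words)
      then show "tl u \<in> ?D" using u uu by (auto simp: L_def desc_def suffix_Cons)
      fix x assume "x \<in> ?D"
      then consider "x = w" | "x \<in> L n" | "x \<in> K" by blast
      then show "\<not> suffix u x"
      proof cases
        case 1
        then show ?thesis using u(1) w' suffix_order.trans[of ?v u w] by (auto simp: desc_def)
      next
        case 2 then show ?thesis using u(2) suffix_length_le[of u x] by (auto simp: L_def)
      next
        case 3
        then have "length x = length u" "x \<noteq> u" using insert u by auto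
        then show ?thesis by (auto simp: suffix_def)
      qed
    qed simp
    moreover have "insert u ?D = insert w (L n) \<union> insert u K" by auto
    ultimately show ?case by metis
  qed
  have step: "screens ?Q ?P (fines (insert w (L n)))" for n
  proof (induction n)
    case 0
    have "L 0 = {}" by (auto simp: L_def desc_def)
    then show ?case by (simp add: screens_def)
  next
    case (Suc n)
    have "insert w (L (Suc n)) = insert w (L n) \<union> {u \<in> desc ?v. length u = Suc n}"
      by (auto simp: L_def le_Suc_eq)
    moreover have "finite {u \<in> desc ?v. length u = Suc n}"
      by (rule finite_subset[OF _ finite_words_le[of k r "Suc n"]]) (auto simp: desc_def)
    ultimately show ?case using level[OF _ Suc.IH] by simp
  qed
  have "screens ?Q ?P (\<Union>n. fines (insert w (L n)))"
  proof (rule screens_UN[OF step])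
    show "incseq (\<lambda>n. fines (insert w (L n)))"
      by (intro incseq_SucI image_mono insert_mono) (auto simp: L_def)
  qed auto
  moreover have "(\<Union>n. fines (insert w (L n))) = fines (insert w (desc ?v))" by (auto simp: L_def)
  ultimately show ?thesis by simp
qed

text \<open>
  The Markov property relative to the coarse process. Coarse labels outside the subtree are functions of the
  fine labels there, from which the subtree is screened off. Coarse labels inside the subtree are
  functions of the fine labels in the subtree, so \<open>screens_swap\<close> moves them into the condition. The
  \<open>\<sigma>\<close>-algebra on the left lies between the two that occur in \<open>screens_swap\<close>.
\<close>

lemma cprob_relative_markov:
  assumes v: "l # w \<in> W" and J: "J \<subseteq> W - desc (l # w)" "w \<in> J"
  shows "AE x in M. cprob M (alg (fines J \<union> coarses W)) (Z (True, val (l # w)) -` C \<inter> space M) x =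
    cprob M (alg ({(True, val w)} \<union> coarses (desc (l # w)))) (Z (True, val (l # w)) -` C \<inter> space M) x"
proof -
  let ?v = "l # w" and ?A = "Z (True, val (l # w)) -` C \<inter> space M"
  let ?P = "fines (W - desc ?v) \<union> coarses (W - desc ?v)" and ?D = "fines (insert w (desc ?v)) \<union> coarses (desc ?v)"
  let ?Q = "{(True, val w)}"
  have w: "w \<in> W" using v by (auto simp: Cons_words)
  have wP: "w \<in> W - desc ?v" using J by blast
  have "W = (W - desc ?v) \<union> desc ?v" by (auto simp: desc_def)
  then have bW: "coarses W = coarses (W - desc ?v) \<union> coarses (desc ?v)" by (metis image_Un)
  have setsP: "sets (alg ?P) = sets (alg (fines (W - desc ?v)))" by (rule sets_alg_coarse) auto
  have setsD: "sets (alg ?D) = sets (alg (fines (insert w (desc ?v))))"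
    by (rule sets_alg_coarse) (use w in \<open>auto simp: desc_def\<close>)
  have S: "screens ?Q ?P ?D"
    using screens_desc[OF v] unfolding screens_def setsP cprob_cong_sets[OF setsD] .
  have big: "AE x in M. cprob M (alg (?P \<union> coarses (desc ?v))) ?A x = cprob M (alg (?Q \<union> coarses (desc ?v))) ?A x"
  proof (rule screens_swap[OF S])
    show "?Q \<subseteq> ?P" using wP by auto
    show "?A \<in> sets (alg ?D)" by (rule Z_event_alg) (use v in \<open>auto simp: desc_def\<close>)
  qed auto
  show ?thesis
  proof (rule cprob_sandwich[OF Z_event subalgebra_alg subalgebra_alg subalgebra_alg])
    show "sets (alg (?Q \<union> coarses (desc ?v))) \<subseteq> sets (alg (fines J \<union> coarses W))"
      by (rule alg_mono) (use J in \<open>auto simp: desc_def\<close>)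
    have "fines J \<subseteq> fines (W - desc ?v)" using J by blast
    then have "fines J \<subseteq> ?P \<union> coarses (desc ?v)" by (rule le_supI1[OF le_supI1])
    moreover have "coarses W \<subseteq> ?P \<union> coarses (desc ?v)" unfolding bW by (rule Un_mono[OF Un_upper2 order_refl])
    ultimately show "sets (alg (fines J \<union> coarses W)) \<subseteq> sets (alg (?P \<union> coarses (desc ?v)))"
      by (intro alg_mono Un_least)
    show "AE x in M. cprob M (alg (?P \<union> coarses (desc ?v))) ?A x = cprob M (alg (?Q \<union> coarses (desc ?v))) ?A x"
      by (rule big)
  qed
qed

text \<open>
  The entropy carried by an edge of the tree labelled \<open>l\<close>. Of the coarse labels only those in the subtree
  above the edge occur in the condition: right translation carries them to the coarse labels above the
  translated edge, whereas in a semigroup it does not map the family of all coarse labels onto itself.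
\<close>

definition edge_entropy :: "nat \<times> bool \<Rightarrow> ennreal" where
  "edge_entropy l = label_entropy {(True, val [l])} ({(True, \<one>\<^bsub>G\<^esub>)} \<union> coarses (desc [l]))"

lemma desc_Cons:
  assumes "l # w \<in> W" shows "desc (l # w) = (\<lambda>u. u @ w) ` desc [l]"
proof
  show "desc (l # w) \<subseteq> (\<lambda>u. u @ w) ` desc [l]"
  proof
    fix u assume "u \<in> desc (l # w)"
    then obtain u' where u: "u = u' @ l # w" "u \<in> W" by (auto simp: desc_def suffix_def)
    then have "(u' @ [l]) @ w \<in> W" by simp
    then have "u' @ [l] \<in> W" using append_words[of "u' @ [l]" w k r] by blast
    then have "u' @ [l] \<in> desc [l]" by (simp add: desc_def suffix_def)
    with u(1) show "u \<in> (\<lambda>u. u @ w) ` desc [l]" by (intro image_eqI[of _ _ "u' @ [l]"]) auto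
  qed
  show "(\<lambda>u. u @ w) ` desc [l] \<subseteq> desc (l # w)"
    using assms by (auto simp: desc_def suffix_def append_words Cons_words)
qed

text \<open>Right translation by \<open>w\<close> carries the edge from the root to \<open>[l]\<close> to the edge from \<open>w\<close> to \<open>l # w\<close>.\<close>

lemma label_entropy_edge:
  assumes v: "l # w \<in> W" and J: "J \<subseteq> W - desc (l # w)" "w \<in> J"
  shows "label_entropy {(True, val (l # w))} (coarses W \<union> fines J) = edge_entropy l"
proof -
  have w: "w \<in> W" and l: "[l] \<in> W" using v by (auto simp: Cons_words)
  have wc: "val w \<in> carrier G" by (rule val_closed[OF w])
  let ?\<sigma> = "\<lambda>i. (fst i, snd i \<otimes>\<^bsub>G\<^esub> val w)"
  let ?B = "{(True, val [l])}" and ?I = "{(True, \<one>\<^bsub>G\<^esub>)} \<union> coarses (desc [l])"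
  have ap: "val (u @ w) = val u \<otimes>\<^bsub>G\<^esub> val w" if "u \<in> W" for u
    by (rule val_append) (use words_set w that in auto)
  have "label_entropy {(True, val (l # w))} (coarses W \<union> fines J) =
    label_entropy {(True, val (l # w))} ({(True, val w)} \<union> coarses (desc (l # w)))"
    unfolding label_entropy_def
  proof (rule label_entropy_cong_cprob)
    fix x0
    have "fibre {(True, val (l # w))} x0 = Z (True, val (l # w)) -` {Z (True, val (l # w)) x0} \<inter> space M"
      by (auto simp: fibre_def)
    then show "AE x in M. cprob M (alg (coarses W \<union> fines J)) (fibre {(True, val (l # w))} x0) x =
        cprob M (alg ({(True, val w)} \<union> coarses (desc (l # w)))) (fibre {(True, val (l # w))} x0) x"
      using cprob_relative_markov[OF v J] by (simp only: Un_commute[of "coarses W"])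
  qed simp
  also have "\<dots> = label_entropy (?\<sigma> ` ?B) (?\<sigma> ` ?I)"
  proof (rule arg_cong2[where f = label_entropy])
    show "{(True, val (l # w))} = ?\<sigma> ` ?B" using ap[OF l] by simp
    have "val ` desc (l # w) = (\<lambda>g. g \<otimes>\<^bsub>G\<^esub> val w) ` val ` desc [l]"
      unfolding desc_Cons[OF v] image_image by (rule image_cong) (auto simp: desc_def ap)
    then show "{(True, val w)} \<union> coarses (desc (l # w)) = ?\<sigma> ` ?I" using wc by (simp add: image_Un image_image)
  qed
  also have "label_entropy (?\<sigma> ` ?B) (?\<sigma> ` ?I) = label_entropy ?B ?I"
  proof (rule label_entropy_shift[OF T_measurable[OF wc] T_distr[OF wc]])
    fix i x assume i: "i \<in> ?I \<union> ?B" and x: "x \<in> space M"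
    have "snd i \<in> carrier G" using i val_closed[OF l] val_closed by (auto simp: desc_def)
    then show "Z (?\<sigma> i) x = Z i (T (val w) x)" using Z_mult[of "snd i" "val w" x "fst i"] wc x by simp
  qed simp
  finally show ?thesis by (simp add: edge_entropy_def)
qed

definition root_entropy :: ennreal where "root_entropy = label_entropy (fines {[]}) (coarses W)"

text \<open>
  Remove a longest word \<open>v\<close>. The remaining set is still a subtree, it lies outside the subtree of \<open>v\<close>, and it
  contains the parent of \<open>v\<close>; so the chain rule contributes the entropy of one edge.
\<close>

lemma label_entropy_subtree:
  assumes "finite B" "B \<subseteq> W" "[] \<in> B" "\<And>v. v \<in> B \<Longrightarrow> tl v \<in> B"
  shows "label_entropy (fines B) (coarses W) = root_entropy + (\<Sum>v\<in>B - {[]}. edge_entropy (hd v))"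
  using assms
proof (induction "card B" arbitrary: B)
  case 0 then show ?case by auto
next
  case (Suc n)
  show ?case
  proof (cases "B = {[]}")
    case True then show ?thesis by (simp add: root_entropy_def)
  next
    case False
    have "Max (length ` B) \<in> length ` B" using Suc.prems(1,3) by (intro Max_in) auto
    then obtain v where "v \<in> B" "length v = Max (length ` B)" by auto
    then have v: "v \<in> B" "\<And>u. u \<in> B \<Longrightarrow> length u \<le> length v" using Suc.prems(1) by auto
    have ne: "v \<noteq> []"
    proof
      assume "v = []"
      then have "B \<subseteq> {[]}" using v(2) by force
      with False Suc.prems(3) show False by blast
    qed
    then obtain l w where lw: "v = l # w" by (cases v) auto
    let ?B = "B - {v}"
    have vW: "l # w \<in> W" using Suc.prems(2) v(1) lw by blast
    have wB: "w \<in> ?B" using Suc.prems(4)[OF v(1)] lw by auto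
    have tlB: "tl u \<in> ?B" if "u \<in> ?B" for u
    proof -
      have "tl u \<noteq> v"
      proof
        assume "tl u = v"
        with ne have "length u = Suc (length v)" by (cases u) auto
        with v(2)[of u] that show False by auto
      qed
      with Suc.prems(4) that show ?thesis by auto
    qed
    have nd: "?B \<subseteq> W - desc (l # w)"
    proof
      fix u assume u: "u \<in> ?B"
      have "\<not> suffix v u"
      proof
        assume s: "suffix v u"
        with v(2)[of u] u have "length u = length v" using suffix_length_le[of v u] by auto
        with s u show False by (auto simp: suffix_def)
      qed
      with u Suc.prems(2) lw show "u \<in> W - desc (l # w)" by (auto simp: desc_def)
    qed
    have IH: "label_entropy (fines ?B) (coarses W) = root_entropy + (\<Sum>v\<in>?B - {[]}. edge_entropy (hd v))"
      by (rule Suc.hyps(1)) (use Suc.hyps(2) Suc.prems v(1) ne tlB in auto)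
    have "fines B = insert (True, val v) (fines ?B)" using v(1) by auto
    then have "label_entropy (fines B) (coarses W) = label_entropy (fines ?B) (coarses W) + label_entropy {(True, val v)} (coarses W \<union> fines ?B)"
      using label_entropy_chain[of "fines ?B" "(True, val v)" "coarses W"] Suc.prems(1) by simp
    also have "label_entropy {(True, val v)} (coarses W \<union> fines ?B) = edge_entropy l" unfolding lw by (rule label_entropy_edge[OF vW]) (use nd wB lw in auto)
    also have "label_entropy (fines ?B) (coarses W) + edge_entropy l = root_entropy + ((\<Sum>v\<in>?B - {[]}. edge_entropy (hd v)) + edge_entropy (hd v))"
      using IH lw by (simp add: add.assoc)
    also have "(\<Sum>v\<in>?B - {[]}. edge_entropy (hd v)) + edge_entropy (hd v) = (\<Sum>v\<in>B - {[]}. edge_entropy (hd v))"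
    proof -
      have "B - {[]} = insert v (?B - {[]})" using v(1) ne by auto
      then show ?thesis using Suc.prems(1) by (simp add: add.commute)
    qed
    finally show ?thesis .
  qed
qed

lemma label_entropy_singleton_le:
  assumes "g \<in> carrier G" shows "label_entropy {(True, g)} I \<le> entropy_part M \<alpha>"
proof -
  have "label_entropy {(True, g)} I \<le> (\<Sum>\<^sub>\<infinity>A\<in>\<alpha>. ennreal (- (measure M (Z (True, g) -` {A} \<inter> space M) *
      ln (measure M (Z (True, g) -` {A} \<inter> space M)))))"
    by (rule label_entropy_singleton_le_entropy[OF \<alpha>_countable Z_True_image[OF assms]])
  also have "\<dots> = entropy_part M \<alpha>"
    unfolding entropy_part_def
  proof (rule infsum_cong)
    fix A assume A: "A \<in> \<alpha>"
    have "emeasure M (T g -` A \<inter> space M) = emeasure M A" using A \<alpha>_sets assms by (intro T_emeasure) auto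
    then have "measure M (Z (True, g) -` {A} \<inter> space M) = measure M A"
      using Z_True_vimage[OF assms A] by (simp add: measure_def)
    then show "ennreal (- (measure M (Z (True, g) -` {A} \<inter> space M) * ln (measure M (Z (True, g) -` {A} \<inter> space M)))) =
      ennreal (- (measure M A * ln (measure M A)))" by simp
  qed
  finally show ?thesis .
qed

text \<open>
  The set \<open>{e, s\<^sub>j}\<close> is the right translate by \<open>s\<^sub>j\<close> of \<open>{s\<^sub>j\<inverse>, e}\<close>, and in a group this translation maps
  the family of all coarse labels onto itself. So both joins have the same entropy, and the finite
  entropy of the root can be cancelled.
\<close>

lemma edge_entropy_inv:
  assumes fin: "entropy_part M \<alpha> < \<infinity>" and l: "l \<in> \<Lambda>"
  shows "edge_entropy l = edge_entropy (fst l, True)"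
proof (cases "snd l")
  case True then show ?thesis by (cases l) auto
next
  case False
  then obtain j where lj: "l = (j, False)" by (cases l) auto
  have j: "j \<in> {1..r}" using fst_alphabet[OF l] lj by simp
  have kG: "k = Free_Group"
    by (rule inv_letter_notin_semigroup[of "(j, True)"]) (use j l lj in \<open>auto simp: inv_letter_def\<close>)
  interpret gr: group G by (rule group_G[OF kG])
  have sj: "s j \<in> carrier G" by (rule gen_closed[OF j])
  have two: "label_entropy (fines {[], [l']}) (coarses W) = root_entropy + edge_entropy l'" if "l' \<in> \<Lambda>" for l'
  proof -
    have "{[], [l']} - {[]} = {[l']}" by auto
    moreover have "label_entropy (fines {[], [l']}) (coarses W) = root_entropy + (\<Sum>v\<in>{[], [l']} - {[]}. edge_entropy (hd v))"
      by (rule label_entropy_subtree) (use that in \<open>auto simp: Cons_words\<close>)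
    ultimately show ?thesis by simp
  qed
  let ?\<sigma> = "\<lambda>i::bool \<times> 'g. (fst i, snd i \<otimes>\<^bsub>G\<^esub> s j)"
  have inv: "val [l] = inv\<^bsub>G\<^esub> (s j)" using lj sj by (simp add: val_Cons letter_val_def)
  have "label_entropy (?\<sigma> ` fines {[], [l]}) (?\<sigma> ` coarses W) = label_entropy (fines {[], [l]}) (coarses W)"
  proof (rule label_entropy_shift[OF T_measurable[OF sj] T_distr[OF sj]])
    fix i x assume i: "i \<in> coarses W \<union> fines {[], [l]}" and x: "x \<in> space M"
    have "snd i \<in> carrier G" using i val_closed sj inv by auto
    then show "Z (?\<sigma> i) x = Z i (T (s j) x)" using Z_mult[of "snd i" "s j" x "fst i"] sj x by simp
  qed simp
  moreover have "?\<sigma> ` fines {[], [l]} = fines {[], [(j, True)]}"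
  proof -
    have "val [l] \<otimes>\<^bsub>G\<^esub> s j = \<one>\<^bsub>G\<^esub>" unfolding inv by (simp add: sj)
    moreover have "val [(j, True)] = s j" by (simp add: val_Cons sj)
    ultimately show ?thesis using sj by (simp add: insert_commute)
  qed
  moreover have "?\<sigma> ` coarses W = coarses W"
  proof -
    have "(\<lambda>g. g \<otimes>\<^bsub>G\<^esub> s j) ` carrier G = carrier G"
    proof
      show "carrier G \<subseteq> (\<lambda>g. g \<otimes>\<^bsub>G\<^esub> s j) ` carrier G"
      proof
        fix g assume "g \<in> carrier G"
        then show "g \<in> (\<lambda>g. g \<otimes>\<^bsub>G\<^esub> s j) ` carrier G"
          using sj by (intro image_eqI[of _ _ "g \<otimes>\<^bsub>G\<^esub> inv\<^bsub>G\<^esub> (s j)"]) (auto simp: m_assoc)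
      qed
    qed (use sj in auto)
    moreover have "?\<sigma> ` coarses W = Pair False ` (\<lambda>g. g \<otimes>\<^bsub>G\<^esub> s j) ` val ` W"
      by (simp only: image_image fst_conv snd_conv)
    ultimately show ?thesis by (simp only: val_surj)
  qed
  ultimately have "root_entropy + edge_entropy (j, True) = root_entropy + edge_entropy l"
    using two[of "(j, True)"] two[OF l] j by simp
  moreover have "root_entropy < \<infinity>"
    using label_entropy_singleton_le[of "\<one>\<^bsub>G\<^esub>" "coarses W"] fin by (auto simp: root_entropy_def)
  ultimately show ?thesis using lj by (auto simp: ennreal_add_left_cancel)
qed

end

section \<open>Entropy of tree-shaped joins and the four invariants\<close>

context hidden_markov
begin

lemma sets_inv_hull:
  "sets (inv_hull G M T \<beta>) = sigma_sets (space M) {T g -` B \<inter> space M | g B. g \<in> carrier G \<and> B \<in> \<beta>}"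
  (is "_ = sigma_sets _ ?E")
proof -
  let ?F = "{\<A>. invariant_sigma_algebra G M T \<A> \<and> \<beta> \<subseteq> \<A>}"
  have EM: "?E \<subseteq> sets M" using \<beta>_sets measurable_sets[OF T_measurable] by blast
  then have EP: "?E \<subseteq> Pow (space M)" using sets.space_closed by blast
  have sa: "sigma_algebra (space M) (sigma_sets (space M) ?E)" by (rule sigma_algebra_sigma_sets[OF EP])
  have "sigma_sets (space M) ?E \<in> ?F"
    unfolding mem_Collect_eq invariant_sigma_algebra_def
  proof (intro conjI ballI)
    show "sigma_algebra (space M) (sigma_sets (space M) ?E)" by (rule sa)
    show "sigma_sets (space M) ?E \<subseteq> sets M" by (rule sets.sigma_sets_subset[OF EM])
    show "\<beta> \<subseteq> sigma_sets (space M) ?E"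
    proof
      fix B assume B: "B \<in> \<beta>"
      have "B \<subseteq> space M" using B \<beta>_sets sets.sets_into_space by blast
      then have "B = T \<one>\<^bsub>G\<^esub> -` B \<inter> space M" using T_one by auto
      with B have "B \<in> ?E" using one_closed by blast
      then show "B \<in> sigma_sets (space M) ?E" by (rule sigma_sets.Basic)
    qed
    fix g A assume g: "g \<in> carrier G" and "A \<in> sigma_sets (space M) ?E"
    from this(2) show "T g -` A \<inter> space M \<in> sigma_sets (space M) ?E"
    proof (induction rule: sigma_sets.induct)
      case (Basic A)
      then obtain h B where h: "h \<in> carrier G" "B \<in> \<beta>" "A = T h -` B \<inter> space M" by blast
      have "T g -` A \<inter> space M = T (h \<otimes>\<^bsub>G\<^esub> g) -` B \<inter> space M"
        using g h T_mult T_space by auto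
      moreover have "h \<otimes>\<^bsub>G\<^esub> g \<in> carrier G" using g h by simp
      ultimately have "T g -` A \<inter> space M \<in> ?E" using h(2) by blast
      then show ?case by (rule sigma_sets.Basic)
    next
      case Empty then show ?case by (simp add: sigma_sets.Empty)
    next
      case (Compl A)
      have "T g -` (space M - A) \<inter> space M = space M - (T g -` A \<inter> space M)"
        using T_space[OF g] by auto
      then show ?case using Compl.IH by (simp add: sigma_sets.Compl)
    next
      case (Union A)
      have "T g -` (\<Union>i. A i) \<inter> space M = (\<Union>i. T g -` A i \<inter> space M)" by auto
      then show ?case by (simp only:) (rule sigma_sets.Union, rule Union.IH)
    qed
  qed
  moreover have "?E \<subseteq> \<A>" if "\<A> \<in> ?F" for \<A>
    using that unfolding invariant_sigma_algebra_def by blast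
  then have "sigma_sets (space M) ?E \<subseteq> \<A>" if "\<A> \<in> ?F" for \<A>
    using sigma_algebra.sigma_sets_subset[of "space M" \<A> ?E] that
    unfolding invariant_sigma_algebra_def by blast
  ultimately have "\<Inter>?F = sigma_sets (space M) ?E" by blast
  moreover have "sigma_sets (space M) ?E \<subseteq> Pow (space M)"
    using sigma_sets_into_sp[OF EP] by blast
  ultimately show ?thesis
    unfolding inv_hull_def using sigma_algebra.sigma_sets_eq[OF sa] by (simp add: sets_measure_of)
qed

lemma AE_b_lab: "AE x in M. \<forall>B\<in>\<beta>. x \<in> B \<longleftrightarrow> b (lab x) = B"
proof -
  have "AE x in M. \<forall>A\<in>\<alpha>. x \<notin> A - b A"
  proof (rule AE_ball_countable[THEN iffD2, OF \<alpha>_countable], rule ballI)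
    fix A assume A: "A \<in> \<alpha>"
    have "A - b A \<in> null_sets M"
      using b_null[OF A] b_mem[OF A] A \<alpha>_sets \<beta>_sets by (auto intro!: null_setsI)
    then show "AE x in M. x \<notin> A - b A" by (rule AE_not_in)
  qed
  then show ?thesis using AE_space
  proof eventually_elim
    case (elim x)
    have "x \<in> lab x" "lab x \<in> \<alpha>" using atom_of_mem[OF \<alpha>_partition elim(2)] by auto
    with elim(1) have x: "x \<in> b (lab x)" "b (lab x) \<in> \<beta>" using b_mem by auto
    show ?case
    proof
      fix B assume "B \<in> \<beta>"
      with x show "x \<in> B \<longleftrightarrow> b (lab x) = B"
        using partition_onD2[OF \<beta>_partition] by (auto simp: disjoint_def)
    qed
  qed
qed

lemma AE_coarse_label:
  assumes g: "g \<in> carrier G"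
  shows "AE x in M. \<forall>B\<in>\<beta>. T g x \<in> B \<longleftrightarrow> Z (False, g) x = B"
  using T_AE[OF g AE_b_lab] g by (simp add: Z_def)

text \<open>The exact coarse labels may stand in for the \<open>\<sigma>\<close>-algebra \<open>\<beta>\<^sup>G\<close>, from which they differ by null sets.\<close>

lemma cprob_inv_hull:
  assumes A: "A \<in> sets M"
  shows "AE x in M. cprob M (inv_hull G M T \<beta>) A x = cprob M (alg (coarses W)) A x"
proof (rule cprob_null_equivalent[OF A sets_inv_hull _ sets_alg])
  let ?E = "{T g -` B \<inter> space M | g B. g \<in> carrier G \<and> B \<in> \<beta>}"
  show EM: "?E \<subseteq> sets M" using \<beta>_sets measurable_sets[OF T_measurable] by blast
  show "{Z i -` C \<inter> space M | i C. i \<in> coarses W} \<subseteq> sets M" by auto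
  show "\<exists>V\<in>sets (alg (coarses W)). AE x in M. x \<in> U \<longleftrightarrow> x \<in> V" if UE: "U \<in> ?E" for U
  proof -
    obtain g B where gB: "g \<in> carrier G" "B \<in> \<beta>" "U = T g -` B \<inter> space M"
      using UE unfolding mem_Collect_eq by iprover
    have "g \<in> val ` W" using gB(1) by (simp only: val_surj)
    then have "(False, g) \<in> coarses W" by (rule imageI)
    then have "Z (False, g) -` {B} \<inter> space M \<in> sets (alg (coarses W))" by (rule Z_event_alg)
    moreover have "AE x in M. x \<in> U \<longleftrightarrow> x \<in> Z (False, g) -` {B} \<inter> space M"
      using AE_coarse_label[OF gB(1)] AE_space by eventually_elim (use gB in auto)
    ultimately show ?thesis by blast
  qed
  show "\<exists>V\<in>sets (inv_hull G M T \<beta>). AE x in M. x \<in> U \<longleftrightarrow> x \<in> V"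
    if U: "U \<in> {Z i -` C \<inter> space M | i C. i \<in> coarses W}" for U
  proof -
    obtain i C where i: "i \<in> coarses W" and UC': "U = Z i -` C \<inter> space M"
      using U unfolding mem_Collect_eq by iprover
    obtain g where ig: "i = (False, g)" and "g \<in> val ` W" using i by (rule imageE)
    then have g: "g \<in> carrier G" by (simp only: val_surj)
    have UC: "U = Z (False, g) -` C \<inter> space M" using UC' ig by simp
    let ?V = "\<Union>B\<in>\<beta> \<inter> C. T g -` B \<inter> space M"
    have "?E \<subseteq> Pow (space M)" by auto
    then have sa: "sigma_algebra (space M) (sigma_sets (space M) ?E)" by (rule sigma_algebra_sigma_sets)
    have "?V \<in> sigma_sets (space M) ?E"
      by (rule sigma_algebra.countable_UN'[OF sa])
        (use \<beta>_countable g in \<open>auto intro!: sigma_sets.Basic\<close>)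
    moreover have "AE x in M. x \<in> U \<longleftrightarrow> x \<in> ?V"
      using AE_coarse_label[OF g] AE_space
    proof eventually_elim
      case (elim x)
      have "Z (False, g) x \<in> \<beta>" using g b_mem lab_mem[OF T_space[OF g elim(2)]] by (simp add: Z_def)
      with elim show ?case by (auto simp: UC)
    qed
    ultimately show ?thesis unfolding sets_inv_hull by blast
  qed
qed

text \<open>
  Partitions are compared through their equivalence relations: pullbacks and joins of partitions
  become pullbacks and conjunctions of relations, and conditional entropy depends on the relation only.
\<close>

definition atoms_by :: "'a set set \<Rightarrow> ('a \<Rightarrow> 'a \<Rightarrow> bool) \<Rightarrow> bool" where
  "atoms_by \<gamma> R \<longleftrightarrow> partition_on (space M) \<gamma> \<and> (\<forall>x\<in>space M. atom_of \<gamma> x = {y \<in> space M. R x y})"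

lemma atoms_byI:
  assumes "{} \<notin> \<gamma>" "\<And>A. A \<in> \<gamma> \<Longrightarrow> \<exists>x\<in>space M. A = {y \<in> space M. R x y}"
    "\<And>x. x \<in> space M \<Longrightarrow> {y \<in> space M. R x y} \<in> \<gamma>"
    "\<And>x. x \<in> space M \<Longrightarrow> R x x"
    "\<And>x y z. x \<in> space M \<Longrightarrow> y \<in> space M \<Longrightarrow> z \<in> space M \<Longrightarrow> R x y \<Longrightarrow> R x z \<longleftrightarrow> R y z"
  shows "atoms_by \<gamma> R"
proof -
  have part: "partition_on (space M) \<gamma>"
  proof (rule partition_onI)
    show "\<Union>\<gamma> = space M"
    proof
      show "\<Union>\<gamma> \<subseteq> space M" using assms(2) by blast
      show "space M \<subseteq> \<Union>\<gamma>" using assms(3,4) by blast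
    qed
    fix A A' assume A: "A \<in> \<gamma>" "A' \<in> \<gamma>" "A \<noteq> A'"
    obtain x where x: "x \<in> space M" "A = {y \<in> space M. R x y}" using assms(2) A by blast
    obtain x' where x': "x' \<in> space M" "A' = {y \<in> space M. R x' y}" using assms(2) A by blast
    have "A = A'" if "z \<in> A" "z \<in> A'" for z
    proof -
      have "A = {y \<in> space M. R z y}" using assms(5)[of x z] x that(1) by auto
      moreover have "A' = {y \<in> space M. R z y}" using assms(5)[of x' z] x' that(2) by auto
      ultimately show ?thesis by simp
    qed
    with A(3) show "disjnt A A'" by (auto simp: disjnt_def)
  qed (use assms(1) in auto)
  moreover have "atom_of \<gamma> x = {y \<in> space M. R x y}" if x: "x \<in> space M" for x
    by (rule atom_of_eq[OF part assms(3)[OF x]]) (use assms(4) x in auto)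
  ultimately show ?thesis by (simp add: atoms_by_def)
qed

lemma atoms_byD:
  assumes "atoms_by \<gamma> R"
  shows "{} \<notin> \<gamma>" "A \<in> \<gamma> \<Longrightarrow> \<exists>x\<in>space M. A = {y \<in> space M. R x y}"
    "x \<in> space M \<Longrightarrow> {y \<in> space M. R x y} \<in> \<gamma>"
    "x \<in> space M \<Longrightarrow> R x x"
    "x \<in> space M \<Longrightarrow> y \<in> space M \<Longrightarrow> z \<in> space M \<Longrightarrow> R x y \<Longrightarrow> R x z \<longleftrightarrow> R y z"
proof -
  have part: "partition_on (space M) \<gamma>" and at: "\<And>x. x \<in> space M \<Longrightarrow> atom_of \<gamma> x = {y \<in> space M. R x y}"
    using assms by (auto simp: atoms_by_def)
  show ne: "{} \<notin> \<gamma>" using partition_onD3[OF part] .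
  show mem: "{y \<in> space M. R x y} \<in> \<gamma>" if "x \<in> space M" for x
    using atom_of_mem(1)[OF part that] at[OF that] by simp
  show refl: "R x x" if "x \<in> space M" for x
    using atom_of_mem(2)[OF part that] at[OF that] by simp
  show "\<exists>x\<in>space M. A = {y \<in> space M. R x y}" if A: "A \<in> \<gamma>" for A
  proof -
    obtain x where x: "x \<in> A" using ne A by fastforce
    have "x \<in> space M" using partition_onD1[OF part] A x by auto
    then show ?thesis using atom_of_eq[OF part A x] at by auto
  qed
  show "R x z \<longleftrightarrow> R y z" if "x \<in> space M" "y \<in> space M" "z \<in> space M" "R x y" for x y z
  proof -
    have "y \<in> {y \<in> space M. R x y}" using that by simp
    then have "atom_of \<gamma> y = {y \<in> space M. R x y}" by (rule atom_of_eq[OF part mem[OF that(1)]])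
    then have "{z \<in> space M. R y z} = {z \<in> space M. R x z}" using at[OF that(2)] by simp
    then show ?thesis using that(3) by blast
  qed
qed

lemma atoms_by_cong:
  assumes "atoms_by \<gamma> R" "\<And>x y. x \<in> space M \<Longrightarrow> y \<in> space M \<Longrightarrow> R x y \<longleftrightarrow> R' x y"
  shows "atoms_by \<gamma> R'"
  using assms by (auto simp: atoms_by_def)

lemma atoms_by_\<alpha>: "atoms_by \<alpha> (\<lambda>x y. lab y = lab x)"
proof -
  have "atom_of \<alpha> x = {y \<in> space M. lab y = lab x}" if x: "x \<in> space M" for x
    using lab_iff[OF _ lab_mem[OF x]] lab_mem[OF x] \<alpha>_sets sets.sets_into_space by blast
  then show ?thesis using \<alpha>_partition by (simp add: atoms_by_def)
qed

lemma atoms_by_pull: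
  assumes R: "atoms_by \<gamma> R" and t: "\<And>x. x \<in> space M \<Longrightarrow> t x \<in> space M"
  shows "atoms_by (pull_part M t \<gamma>) (\<lambda>x y. R (t x) (t y))"
proof (rule atoms_byI)
  show "{} \<notin> pull_part M t \<gamma>" by (simp add: pull_part_def)
  show "R (t x) (t x)" if "x \<in> space M" for x using atoms_byD(4)[OF R] t that by blast
  show "{y \<in> space M. R (t x) (t y)} \<in> pull_part M t \<gamma>" if x: "x \<in> space M" for x
  proof -
    have "{y \<in> space M. R (t x) (t y)} = t -` {y \<in> space M. R (t x) y} \<inter> space M" using t by auto
    moreover have "x \<in> {y \<in> space M. R (t x) (t y)}" using atoms_byD(4)[OF R] t x by blast
    ultimately show ?thesis using atoms_byD(3)[OF R t[OF x]] unfolding pull_part_def by blast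
  qed
  show "\<exists>x\<in>space M. A = {y \<in> space M. R (t x) (t y)}" if A: "A \<in> pull_part M t \<gamma>" for A
  proof -
    obtain B where B: "B \<in> \<gamma>" "A = t -` B \<inter> space M" "A \<noteq> {}"
      using A unfolding pull_part_def by blast
    then obtain x where x: "x \<in> space M" "t x \<in> B" by auto
    obtain z where z: "z \<in> space M" "B = {y \<in> space M. R z y}" using atoms_byD(2)[OF R B(1)] by blast
    have "R z (t x)" using x z by blast
    then have "R z y \<longleftrightarrow> R (t x) y" if "y \<in> space M" for y
      using atoms_byD(5)[OF R z(1) t[OF x(1)] that] by blast
    then have "A = {y \<in> space M. R (t x) (t y)}" using B z t by auto
    then show ?thesis using x by blast
  qed
  show "R (t x) (t z) \<longleftrightarrow> R (t y) (t z)"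
    if "x \<in> space M" "y \<in> space M" "z \<in> space M" "R (t x) (t y)" for x y z
    using atoms_byD(5)[OF R] t that by blast
qed

lemma atoms_by_Join:
  assumes R: "\<And>i. i \<in> I \<Longrightarrow> atoms_by (P i) (R i)"
  shows "atoms_by (Join_part M I P) (\<lambda>x y. \<forall>i\<in>I. R i x y)"
proof (rule atoms_byI)
  show "{} \<notin> Join_part M I P" by (simp add: Join_part_def)
  show "\<forall>i\<in>I. R i x x" if "x \<in> space M" for x using atoms_byD(4)[OF R] that by blast
  show "{y \<in> space M. \<forall>i\<in>I. R i x y} \<in> Join_part M I P" if x: "x \<in> space M" for x
  proof -
    have "{y \<in> space M. \<forall>i\<in>I. R i x y} = {y \<in> space M. \<forall>i\<in>I. y \<in> {y \<in> space M. R i x y}}" by auto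
    moreover have "\<forall>i\<in>I. {y \<in> space M. R i x y} \<in> P i" using atoms_byD(3)[OF R x] by blast
    moreover have "x \<in> {y \<in> space M. \<forall>i\<in>I. R i x y}" using atoms_byD(4)[OF R] x by blast
    ultimately show ?thesis unfolding Join_part_def
      by (intro DiffI CollectI exI[of _ "\<lambda>i. {y \<in> space M. R i x y}"]) auto
  qed
  show "\<exists>x\<in>space M. A = {y \<in> space M. \<forall>i\<in>I. R i x y}" if A: "A \<in> Join_part M I P" for A
  proof -
    obtain c where c: "\<And>i. i \<in> I \<Longrightarrow> c i \<in> P i" "A = {x \<in> space M. \<forall>i\<in>I. x \<in> c i}" "A \<noteq> {}"
      using A unfolding Join_part_def by blast
    then obtain x where x: "x \<in> space M" "\<And>i. i \<in> I \<Longrightarrow> x \<in> c i" by auto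
    have "y \<in> c i \<longleftrightarrow> R i x y" if i: "i \<in> I" and y: "y \<in> space M" for i y
    proof -
      obtain z where z: "z \<in> space M" "c i = {y \<in> space M. R i z y}" using atoms_byD(2)[OF R[OF i] c(1)[OF i]] by blast
      have "R i z x" using x(2)[OF i] z by simp
      then show ?thesis using atoms_byD(5)[OF R[OF i] z(1) x(1) y] z(2) y by simp
    qed
    then have "A = {y \<in> space M. \<forall>i\<in>I. R i x y}" using c(2) by blast
    then show ?thesis using x by blast
  qed
  show "(\<forall>i\<in>I. R i x z) \<longleftrightarrow> (\<forall>i\<in>I. R i y z)"
    if "x \<in> space M" "y \<in> space M" "z \<in> space M" "\<forall>i\<in>I. R i x y" for x y z
    using atoms_byD(5)[OF R] that by blast
qed

lemma atoms_by_join: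
  assumes R: "atoms_by \<gamma> R" and R': "atoms_by \<delta> R'"
  shows "atoms_by (join_part \<gamma> \<delta>) (\<lambda>x y. R x y \<and> R' x y)"
proof (rule atoms_by_cong)
  have \<gamma>: "\<gamma> \<subseteq> Pow (space M)" using R by (auto simp: atoms_by_def partition_on_def)
  have "{A \<inter> B | A B. A \<in> \<gamma> \<and> B \<in> \<delta>} =
    {{x \<in> space M. \<forall>i\<in>UNIV. x \<in> c i} | c. \<forall>i\<in>UNIV. c i \<in> (if i then \<gamma> else \<delta>)}"
  proof (intro Set.set_eqI iffI)
    fix X assume "X \<in> {A \<inter> B | A B. A \<in> \<gamma> \<and> B \<in> \<delta>}"
    then obtain A B where "X = A \<inter> B" "A \<in> \<gamma>" "B \<in> \<delta>" by blast
    with \<gamma> show "X \<in> {{x \<in> space M. \<forall>i\<in>UNIV. x \<in> c i} | c. \<forall>i\<in>UNIV. c i \<in> (if i then \<gamma> else \<delta>)}"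
      by (intro CollectI exI[of _ "\<lambda>i. if i then A else B"]) (auto split: if_splits)
  next
    fix X assume "X \<in> {{x \<in> space M. \<forall>i\<in>UNIV. x \<in> c i} | c. \<forall>i\<in>UNIV. c i \<in> (if i then \<gamma> else \<delta>)}"
    then obtain c where c: "X = {x \<in> space M. \<forall>i\<in>UNIV. x \<in> c i}" "\<forall>i\<in>UNIV. c i \<in> (if i then \<gamma> else \<delta>)" by blast
    then have "c True \<in> \<gamma>" "c False \<in> \<delta>" by (metis UNIV_I)+
    moreover from this \<gamma> have "X = c True \<inter> c False" unfolding c(1) by (auto simp: UNIV_bool)
    ultimately show "X \<in> {A \<inter> B | A B. A \<in> \<gamma> \<and> B \<in> \<delta>}" by blast
  qed
  then have "join_part \<gamma> \<delta> = Join_part M UNIV (\<lambda>i. if i then \<gamma> else \<delta>)"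
    unfolding join_part_def Join_part_def by (rule arg_cong)
  then show "atoms_by (join_part \<gamma> \<delta>) (\<lambda>x y. \<forall>i\<in>UNIV. (if i then R else R') x y)"
    using atoms_by_Join[of UNIV "\<lambda>i. if i then \<gamma> else \<delta>" "\<lambda>i. if i then R else R'"] R R' by simp
qed (auto simp: UNIV_bool)

definition same_labels :: "(nat \<times> bool) list set \<Rightarrow> 'a \<Rightarrow> 'a \<Rightarrow> bool" where
  "same_labels B x y \<longleftrightarrow> (\<forall>u\<in>B. lab (T (val u) y) = lab (T (val u) x))"

lemma cond_entropy_eq_label_entropy:
  assumes B: "finite B" "B \<subseteq> W" and at: "atoms_by \<gamma> (same_labels B)"
  shows "cond_entropy M (inv_hull G M T \<beta>) \<gamma> = enn2ereal (label_entropy (fines B) (coarses W))"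
proof -
  have fin: "finite (fines B)" using B by simp
  have fibre: "fibre (fines B) x = atom_of \<gamma> x" if "x \<in> space M" for x
  proof -
    have "Z (True, val u) y = lab (T (val u) y)" if "u \<in> B" for u y
      using val_closed[of u] that B by (auto simp: Z_def)
    then have "fibre (fines B) x = {y \<in> space M. same_labels B x y}" by (simp add: fibre_def same_labels_def)
    also have "\<dots> = atom_of \<gamma> x" using at that by (simp add: atoms_by_def)
    finally show ?thesis .
  qed
  have "(\<integral>\<^sup>+x. ennreal (- ln (cprob M (inv_hull G M T \<beta>) (atom_of \<gamma> x) x)) \<partial>M) =
      (\<integral>\<^sup>+x. ennreal (- ln (cprob M (inv_hull G M T \<beta>) (fibre (fines B) x) x)) \<partial>M)"
    by (rule nn_integral_cong) (simp add: fibre)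
  also have "\<dots> = label_entropy (fines B) (coarses W)"
    unfolding label_entropy_def by (rule label_entropy_cong_cprob[OF fin cprob_inv_hull[OF fibre_event[OF fin]]])
  finally show ?thesis by (simp add: cond_entropy_def)
qed

text \<open>
  As \<open>T\<^sub>g T\<^sub>s\<^sup>i\<close> is the map \<open>T\<close> of \<open>g s\<^sup>i\<close>, the joins in the definition of the entropy rate observe
  right translates of the ball.
\<close>

lemma atoms_by_orbit:
  assumes at: "atoms_by \<gamma> (same_labels {u \<in> W. length u \<le> n})" and j: "j \<in> {1..r}"
  shows "atoms_by (Join_part M {0..N} (\<lambda>i. pull_part M (T (s j) ^^ i) \<gamma>)) (same_labels (ball_orbit n j N))"
proof -
  have sj: "s j \<in> carrier G" by (rule gen_closed[OF j])
  have pow: "(T (s j) ^^ i) x = T (s j [^]\<^bsub>G\<^esub> i) x" if x: "x \<in> space M" for i x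
  proof (induction i)
    case 0 then show ?case using T_one x by simp
  next
    case (Suc i)
    have "T (s j [^]\<^bsub>G\<^esub> Suc i) x = T (s j \<otimes>\<^bsub>G\<^esub> s j [^]\<^bsub>G\<^esub> i) x" by (simp only: nat_pow_Suc2[OF sj])
    also have "\<dots> = T (s j) (T (s j [^]\<^bsub>G\<^esub> i) x)" using sj x by (intro T_mult) auto
    finally show ?case using Suc by simp
  qed
  have "atoms_by (Join_part M {0..N} (\<lambda>i. pull_part M (T (s j) ^^ i) \<gamma>))
    (\<lambda>x y. \<forall>i\<in>{0..N}. same_labels {u \<in> W. length u \<le> n} ((T (s j) ^^ i) x) ((T (s j) ^^ i) y))"
    by (intro atoms_by_Join atoms_by_pull[OF at]) (use pow T_space sj in simp)
  then show ?thesis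
  proof (rule atoms_by_cong)
    fix x y assume x: "x \<in> space M" and y: "y \<in> space M"
    have T: "T (val u) ((T (s j) ^^ i) x) = T (val u \<otimes>\<^bsub>G\<^esub> s j [^]\<^bsub>G\<^esub> i) x" if "x \<in> space M" "u \<in> W" for x u i
      using that sj val_closed by (simp add: pow T_mult)
    have "(\<forall>i\<in>{0..N}. same_labels {u \<in> W. length u \<le> n} ((T (s j) ^^ i) x) ((T (s j) ^^ i) y)) \<longleftrightarrow>
      (\<forall>i\<in>{0..N}. \<forall>u\<in>{u \<in> W. length u \<le> n}. lab (T (val u \<otimes>\<^bsub>G\<^esub> s j [^]\<^bsub>G\<^esub> i) y) =
        lab (T (val u \<otimes>\<^bsub>G\<^esub> s j [^]\<^bsub>G\<^esub> i) x))"
      using x y by (simp add: same_labels_def T)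
    also have "\<dots> \<longleftrightarrow> (\<forall>g\<in>{val u \<otimes>\<^bsub>G\<^esub> s j [^]\<^bsub>G\<^esub> m | u m. u \<in> W \<and> length u \<le> n \<and> m \<le> N}. lab (T g y) = lab (T g x))"
    proof -
      have "(\<forall>i\<in>{0..N}. \<forall>u\<in>{u \<in> W. length u \<le> n}. Q (f u i)) \<longleftrightarrow>
        (\<forall>g\<in>{f u m | u m. u \<in> W \<and> length u \<le> n \<and> m \<le> N}. Q g)" for Q :: "'g \<Rightarrow> bool" and f
        by fastforce
      then show ?thesis .
    qed
    also have "\<dots> \<longleftrightarrow> same_labels (ball_orbit n j N) x y"
      unfolding val_ball_orbit[OF j, symmetric] same_labels_def by simp
    finally show "(\<forall>i\<in>{0..N}. same_labels {u \<in> W. length u \<le> n} ((T (s j) ^^ i) x) ((T (s j) ^^ i) y)) \<longleftrightarrow>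
      same_labels (ball_orbit n j N) x y" .
  qed
qed

lemma atoms_by_ball_part:
  "atoms_by (ball_part G (letters k G r s) M T \<alpha> n) (same_labels {u \<in> W. length u \<le> n})"
proof -
  have "atoms_by (ball_part G (letters k G r s) M T \<alpha> n)
     (\<lambda>x y. \<forall>g\<in>val ` {u \<in> W. length u \<le> n}. lab (T g y) = lab (T g x))"
    unfolding ball_part_def word_ball_eq
    by (intro atoms_by_Join atoms_by_pull[OF atoms_by_\<alpha>]) (use T_space val_closed in auto)
  then show ?thesis by (rule atoms_by_cong) (simp add: same_labels_def)
qed

lemma atoms_by_\<alpha>_ball: "atoms_by \<alpha> (same_labels {u \<in> W. length u \<le> 0})"
  by (rule atoms_by_cong[OF atoms_by_\<alpha>]) (auto simp: same_labels_def T_one)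

context
  assumes fin: "entropy_part M \<alpha> < \<infinity>"
begin

definition root_value :: real where "root_value = enn2real root_entropy"
text \<open>By \<open>edge_entropy_inv\<close> a letter and its inverse may be given the value of the generator.\<close>

definition edge_value :: "nat \<times> bool \<Rightarrow> real" where "edge_value l = enn2real (edge_entropy (fst l, True))"

lemma root_value_nonneg [simp]: "0 \<le> root_value" and edge_value_nonneg [simp]: "0 \<le> edge_value l"
  by (simp_all add: root_value_def edge_value_def)

lemma root_entropy_eq: "root_entropy = ennreal root_value"
proof -
  have "root_entropy < \<infinity>"
    using le_less_trans[OF label_entropy_singleton_le[of "\<one>\<^bsub>G\<^esub>" "coarses W"] fin] by (simp add: root_entropy_def)
  then show ?thesis by (simp add: root_value_def)
qed

lemma edge_entropy_eq:
  assumes "l \<in> \<Lambda>" shows "edge_entropy l = ennreal (edge_value l)"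
proof -
  have "(fst l, True) \<in> \<Lambda>" using fst_alphabet[OF assms] by simp
  then have "val [(fst l, True)] \<in> carrier G" by (intro val_closed) (simp add: Cons_words)
  then have "edge_entropy (fst l, True) < \<infinity>"
    unfolding edge_entropy_def by (rule le_less_trans[OF label_entropy_singleton_le fin])
  then show ?thesis using edge_entropy_inv[OF fin assms] by (simp add: edge_value_def)
qed

lemma cond_entropy_subtree:
  assumes B: "finite B" "B \<subseteq> W" "[] \<in> B" "\<And>v. v \<in> B \<Longrightarrow> tl v \<in> B" and at: "atoms_by \<gamma> (same_labels B)"
  shows "cond_entropy M (inv_hull G M T \<beta>) \<gamma> = ereal (root_value + (\<Sum>v\<in>B - {[]}. edge_value (hd v)))"
proof -
  have "(\<Sum>v\<in>B - {[]}. edge_entropy (hd v)) = (\<Sum>v\<in>B - {[]}. ennreal (edge_value (hd v)))"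
  proof (rule sum.cong[OF refl])
    fix v assume "v \<in> B - {[]}"
    then have "hd v \<in> \<Lambda>" using B(2) words_alphabet[of v k r "hd v"] by auto
    then show "edge_entropy (hd v) = ennreal (edge_value (hd v))" by (rule edge_entropy_eq)
  qed
  also have "\<dots> = ennreal (\<Sum>v\<in>B - {[]}. edge_value (hd v))" by (rule sum_ennreal) simp
  finally have "label_entropy (fines B) (coarses W) = ennreal (root_value + (\<Sum>v\<in>B - {[]}. edge_value (hd v)))"
    using label_entropy_subtree[OF B] by (simp add: root_entropy_eq sum_nonneg)
  then show ?thesis
    using cond_entropy_eq_label_entropy[OF B(1,2) at] by (simp only: enn2ereal_ennreal add_nonneg_nonneg root_value_nonneg sum_nonneg edge_value_nonneg)
qed

definition ball_entropy :: "nat \<Rightarrow> real" where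
  "ball_entropy n = root_value + (\<Sum>v\<in>{u \<in> W. length u \<le> n} - {[]}. edge_value (hd v))"

text \<open>The entropy gained with each further right translate of the ball by \<open>s j\<close>.\<close>

definition increment :: "nat \<Rightarrow> nat \<Rightarrow> real" where
  "increment n j = (\<Sum>v\<in>sphere_to (Suc n) (j, True). edge_value (hd v))"

lemma cond_entropy_orbit:
  assumes "atoms_by \<gamma> (same_labels (ball_orbit n j N))"
  shows "cond_entropy M (inv_hull G M T \<beta>) \<gamma> = ereal (ball_entropy n + real N * increment n j)"
  using cond_entropy_subtree[OF finite_ball_orbit ball_orbit_words Nil_ball_orbit tl_ball_orbit assms]
  by (simp add: sum_ball_orbit ball_entropy_def increment_def)

lemma euler: "(1 - real r) * ball_entropy n + (\<Sum>j=1..r. increment n j) =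
    (1 - real r) * root_value + (\<Sum>j=1..r. edge_value (j, True))"
  using weighted_euler_characteristic[where n = n and c = edge_value]
  by (simp add: ball_entropy_def increment_def algebra_simps del: One_nat_def)

text \<open>The join \<open>\<gamma> \<or> T\<^sub>s\<inverse>\<gamma>\<close> is the case \<open>N = 1\<close> of the joins that define the entropy rate.\<close>

lemma F_cond_value:
  assumes at: "atoms_by \<gamma> (same_labels {u \<in> W. length u \<le> n})"
  shows "F_cond r s M T (inv_hull G M T \<beta>) \<gamma> = ereal ((1 - real r) * root_value + (\<Sum>j=1..r. edge_value (j, True)))"
proof -
  have base: "cond_entropy M (inv_hull G M T \<beta>) \<gamma> = ereal (ball_entropy n)"
    using cond_entropy_orbit[of \<gamma> n 0 0] at by (simp add: ball_orbit_0)
  have step: "cond_entropy M (inv_hull G M T \<beta>) (join_part \<gamma> (pull_part M (T (s j)) \<gamma>)) =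
      ereal (ball_entropy n + increment n j)" if j: "j \<in> {1..r}" for j
  proof -
    have "atoms_by (join_part \<gamma> (pull_part M (T (s j)) \<gamma>))
      (\<lambda>x y. same_labels {u \<in> W. length u \<le> n} x y \<and> same_labels {u \<in> W. length u \<le> n} (T (s j) x) (T (s j) y))"
      by (intro atoms_by_join at atoms_by_pull[OF at]) (use T_space gen_closed[OF j] in auto)
    moreover have "atoms_by (Join_part M {0..1} (\<lambda>i. pull_part M (T (s j) ^^ i) \<gamma>))
      (\<lambda>x y. \<forall>i\<in>{0..1::nat}. same_labels {u \<in> W. length u \<le> n} ((T (s j) ^^ i) x) ((T (s j) ^^ i) y))"
    proof (intro atoms_by_Join atoms_by_pull[OF at])
      fix i x assume "i \<in> {0..1::nat}" "x \<in> space M"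
      then show "(T (s j) ^^ i) x \<in> space M" using T_space gen_closed[OF j] by (cases i) auto
    qed
    moreover have "{0..1::nat} = {0, 1}" by auto
    ultimately have "atoms_by (join_part \<gamma> (pull_part M (T (s j)) \<gamma>)) (same_labels (ball_orbit n j 1))"
      using atoms_by_orbit[OF at j, of 1] by (auto simp: atoms_by_def)
    then show ?thesis using cond_entropy_orbit[of _ n j 1] by simp
  qed
  have "F_cond r s M T (inv_hull G M T \<beta>) \<gamma> =
      ereal (1 - 2 * real r) * ereal (ball_entropy n) + (\<Sum>j=1..r. ereal (ball_entropy n + increment n j))"
    unfolding F_cond_def base using step by (intro arg_cong2[where f = "(+)"] sum.cong) auto
  also have "\<dots> = ereal ((1 - 2 * real r) * ball_entropy n + (\<Sum>j=1..r. ball_entropy n + increment n j))"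
    by simp
  also have "(1 - 2 * real r) * ball_entropy n + (\<Sum>j=1..r. ball_entropy n + increment n j) =
      (1 - real r) * ball_entropy n + (\<Sum>j=1..r. increment n j)"
    by (simp add: sum.distrib algebra_simps)
  finally show ?thesis by (simp only: euler)
qed

lemma entropy_rate_value:
  assumes at: "atoms_by \<gamma> (same_labels {u \<in> W. length u \<le> n})" and j: "j \<in> {1..r}"
  shows "entropy_rate M (T (s j)) (inv_hull G M T \<beta>) \<gamma> = ereal (increment n j)"
proof -
  let ?h = "ball_entropy n" and ?d = "increment n j"
  have "(\<lambda>N. ?d + (?h - ?d) * inverse (real (Suc N))) \<longlonglongrightarrow> ?d + (?h - ?d) * 0"
    by (intro tendsto_intros LIMSEQ_inverse_real_of_nat)
  moreover have "?d + (?h - ?d) * inverse (real (Suc N)) = 1 / real (N + 1) * (?h + real N * ?d)" for N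
    by (simp add: field_simps)
  ultimately have "(\<lambda>N. ereal (1 / real (N + 1)) * ereal (?h + real N * ?d)) \<longlonglongrightarrow> ereal ?d"
    by simp
  then have "(\<lambda>N. ereal (1 / real (N + 1)) * cond_entropy M (inv_hull G M T \<beta>)
      (Join_part M {0..N} (\<lambda>i. pull_part M (T (s j) ^^ i) \<gamma>))) \<longlonglongrightarrow> ereal (increment n j)"
    using cond_entropy_orbit[OF atoms_by_orbit[OF at j]] by simp
  then show ?thesis unfolding entropy_rate_def by (rule limI)
qed

lemma F_star_cond_value:
  assumes at: "atoms_by \<gamma> (same_labels {u \<in> W. length u \<le> n})"
  shows "F_star_cond r s M T (inv_hull G M T \<beta>) \<gamma> = ereal ((1 - real r) * root_value + (\<Sum>j=1..r. edge_value (j, True)))"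
proof -
  have base: "cond_entropy M (inv_hull G M T \<beta>) \<gamma> = ereal (ball_entropy n)"
    using cond_entropy_orbit[of \<gamma> n 0 0] at by (simp add: ball_orbit_0)
  have "F_star_cond r s M T (inv_hull G M T \<beta>) \<gamma> =
      ereal (1 - real r) * ereal (ball_entropy n) + (\<Sum>j=1..r. ereal (increment n j))"
    unfolding F_star_cond_def base
    by (intro arg_cong2[where f = "(+)"] sum.cong) (auto simp: entropy_rate_value[OF at])
  also have "\<dots> = ereal ((1 - real r) * ball_entropy n + (\<Sum>j=1..r. increment n j))" by simp
  finally show ?thesis by (simp only: euler)
qed

lemma markov_invariants_coincide:
  "f_cond k G r s M T (inv_hull G M T \<beta>) \<alpha> = F_cond r s M T (inv_hull G M T \<beta>) \<alpha> \<and>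
   F_cond r s M T (inv_hull G M T \<beta>) \<alpha> = F_star_cond r s M T (inv_hull G M T \<beta>) \<alpha> \<and>
   F_star_cond r s M T (inv_hull G M T \<beta>) \<alpha> = f_star_cond k G r s M T (inv_hull G M T \<beta>) \<alpha>"
  unfolding f_cond_def f_star_cond_def
  by (simp add: F_cond_value[OF atoms_by_ball_part] F_star_cond_value[OF atoms_by_ball_part]
      F_cond_value[OF atoms_by_\<alpha>_ball] F_star_cond_value[OF atoms_by_\<alpha>_ball])

end
end

theorem theorem6p1:
  fixes k :: free_kind
    and G :: "('g, 'b) monoid_scheme"
    and r :: nat
    and s :: "nat \<Rightarrow> 'g"
    and T :: "'g \<Rightarrow> 'a \<Rightarrow> 'a"
    and M :: "'a measure"
    and \<alpha> \<beta> :: "'a set set"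
  assumes "is_free k G r s"
    and "markov_process G (letters k G r s) T M \<alpha>"
    and "entropy_part M \<alpha> < \<infinity>"
    and "measurable_partition M \<beta>"
    and "coarsening M \<beta> \<alpha>"
  shows "f_cond k G r s M T (inv_hull G M T \<beta>) \<alpha> = F_cond r s M T (inv_hull G M T \<beta>) \<alpha> \<and>
         F_cond r s M T (inv_hull G M T \<beta>) \<alpha> = F_star_cond r s M T (inv_hull G M T \<beta>) \<alpha> \<and>
         F_star_cond r s M T (inv_hull G M T \<beta>) \<alpha> = f_star_cond k G r s M T (inv_hull G M T \<beta>) \<alpha>"
proof -
  have "standard_prob_space M"
    using assms(2) by (simp add: markov_process_def G_process_def mp_action_def)
  then have "prob_space M"
    unfolding standard_prob_space_def using prob_space.prob_space_completion by blast
  moreover obtain b where "\<And>A. A \<in> \<alpha> \<Longrightarrow> b A \<in> \<beta> \<and> emeasure M (A - b A) = 0"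
    using assms(5) unfolding coarsening_def by metis
  ultimately interpret hidden_markov k G r s M T \<alpha> \<beta> b
    using assms(1,2,4)
    by (simp add: hidden_markov_def hidden_markov_axioms_def free_generators_def)
  show ?thesis by (rule markov_invariants_coincide[OF assms(3)])
qed

end
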